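(* Let $\mu=\sum_{\lambda\in\Lambda}\mu(\lambda)\delta_\lambda$ and $\nu=\sum_{\gamma\in\Gamma}\nu(\gamma)\delta_\gamma$ be discrete measures from $S^*(\mathbb{R}^d)$, with $\Lambda=\operatorname{supp}\mu$, $\Gamma=\operatorname{supp}\nu$, such that $\hat\mu,\hat\nu$ are atomic measures and $|\hat\mu|,|\hat\nu|\in S^*(\mathbb{R}^d)$. Let $E\subset\mathbb{R}^d$ be a set for which there exist balls $B(x_k,r_k)$, $k=1,2,\dots$, with $r_k\to\infty$, $r_k/|x_k|\to0$ and $\bigcup_{k=1}^\infty B(x_k,r_k)\subset E$. Suppose that there are numberings (enumerations without repetition) $\Lambda=\{\lambda_n\}_{n=1}^\infty$, $\Gamma=\{\gamma_n\}_{n=1}^\infty$ such that: (i) there is $N<\infty$ such that for all $x\in E$ $$\#\{n:\lambda_n\in B(x,1)\}\le N,\qquad \#\{n:\gamma_n\in B(x,1)\}\le N;$$ (ii) $\lambda_n-\gamma_n\to0$ and $\mu(\lambda_n)-\nu(\gamma_n)\to0$ as $n\to\infty$ along those $n$ for which $\lambda_n\in E$ or $\gamma_n\in E$. Then the measures $\mu$ and $\nu$ coincide.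
   Context: Here $B(x,r)=\{y\in\mathbb{R}^d:|y-x|<r\}$ and $\delta_\lambda$ is the unit mass at $\lambda\in\mathbb{R}^d$. $S(\mathbb{R}^d)$ is the Schwartz space and $S^*(\mathbb{R}^d)$ its dual, the space of temperate (tempered) distributions. The Fourier transform is $\hat f(\varphi)=f(\hat\varphi)$ for $\varphi\in S(\mathbb{R}^d)$, where $\hat\varphi(y)=\int_{\mathbb{R}^d}\varphi(x)e^{-2\pi i\langle x,y\rangle}dx$. Measures are complex Radon (locally finite, not necessarily finite) measures on $\mathbb{R}^d$; $|\mu|$ is the total variation measure; a measure is said to belong to $S^*(\mathbb{R}^d)$ if the distribution it defines is (extends to) a temperate distribution. A measure $\mu$ is discrete if for each $\lambda\in\operatorname{supp}\mu$ there is $\varepsilon>0$ with $B(\lambda,\varepsilon)\cap\operatorname{supp}\mu=\{\lambda\}$. A measure $\mu$ is atomic if $\mu=\sum_{\lambda\in\Lambda}a_\lambda\delta_\lambda$ with $a_\lambda\in\mathbb{C}$ and $\Lambda$ countable; then one writes $\mu(\lambda)=a_\lambda$. *)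

theory Defs
  imports "HOL-Analysis.Analysis"
begin

section \<open>Schwartz functions and temperate distributions\<close>

text \<open>The space $R^d$ is an arbitrary Euclidean space; a list of basis vectors
  plays the role of a multi-index.\<close>

primrec partials :: "'a::euclidean_space list \<Rightarrow> ('a \<Rightarrow> complex) \<Rightarrow> 'a \<Rightarrow> complex" where
  "partials [] f = f"
| "partials (b # bs) f = (\<lambda>x. frechet_derivative (partials bs f) (at x) b)"

definition smooth :: "('a::euclidean_space \<Rightarrow> complex) \<Rightarrow> bool" where
  "smooth f \<longleftrightarrow> (\<forall>bs. set bs \<subseteq> Basis \<longrightarrow> partials bs f differentiable_on UNIV)"

definition test_functions :: "('a::euclidean_space \<Rightarrow> complex) set" where
  "test_functions = {f. smooth f \<and> compact (closure {x. f x \<noteq> 0})}"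

definition schwartz :: "('a::euclidean_space \<Rightarrow> complex) set" where
  "schwartz = {f. smooth f \<and>
     (\<forall>bs k. set bs \<subseteq> Basis \<longrightarrow> bounded (range (\<lambda>x. (1 + norm x) ^ k *\<^sub>R partials bs f x)))}"

definition schwartz_norm :: "nat \<Rightarrow> ('a::euclidean_space \<Rightarrow> complex) \<Rightarrow> real" where
  "schwartz_norm k f =
     (SUP (bs, x) \<in> {bs. set bs \<subseteq> Basis \<and> length bs \<le> k} \<times> UNIV.
        (1 + norm x) ^ k * norm (partials bs f x))"

text \<open>The norms increase with their index, so the sets \<open>{f. schwartz_norm k f < d}\<close> form a
  neighbourhood base of zero; for a linear functional continuity at zero suffices.
  Values of a functional outside the Schwartz space are irrelevant.\<close>

definition temperate :: "(('a::euclidean_space \<Rightarrow> complex) \<Rightarrow> complex) \<Rightarrow> bool" where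
  "temperate T \<longleftrightarrow>
     (\<forall>f\<in>schwartz. \<forall>g\<in>schwartz. T (\<lambda>x. f x + g x) = T f + T g) \<and>
     (\<forall>c. \<forall>f\<in>schwartz. T (\<lambda>x. c * f x) = c * T f) \<and>
     (\<forall>e>0. \<exists>k. \<exists>d>0. \<forall>f\<in>schwartz. schwartz_norm k f < d \<longrightarrow> norm (T f) < e)"

definition fourier :: "('a::euclidean_space \<Rightarrow> complex) \<Rightarrow> 'a \<Rightarrow> complex" where
  "fourier f y = (LINT x|lborel. f x * exp (- 2 * of_real pi * \<i> * of_real (x \<bullet> y)))"

definition fourier_distribution ::
  "(('a::euclidean_space \<Rightarrow> complex) \<Rightarrow> complex) \<Rightarrow> ('a \<Rightarrow> complex) \<Rightarrow> complex" where
  "fourier_distribution T f = T (fourier f)"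


section \<open>Complex Radon measures\<close>

text \<open>A complex measure that need not be finite has values only on bounded Borel sets.
  It is modelled as a function on all sets whose other values are irrelevant.
  Regularity is automatic in Euclidean space.\<close>

definition bounded_borel :: "'a::euclidean_space set set" where
  "bounded_borel = {A \<in> sets borel. bounded A}"

definition radon :: "('a::euclidean_space set \<Rightarrow> complex) \<Rightarrow> bool" where
  "radon \<mu> \<longleftrightarrow>
     (\<forall>A :: nat \<Rightarrow> 'a set. range A \<subseteq> bounded_borel \<longrightarrow> disjoint_family A \<longrightarrow> bounded (\<Union>i. A i) \<longrightarrow>
        (\<lambda>i. \<mu> (A i)) sums \<mu> (\<Union>i. A i))"

definition total_variation :: "('a::euclidean_space set \<Rightarrow> complex) \<Rightarrow> 'a set \<Rightarrow> complex" where
  "total_variation \<mu> A =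
     of_real (SUP P \<in> {P. finite P \<and> P \<subseteq> sets borel \<and> partition_on A P}. \<Sum>B\<in>P. norm (\<mu> B))"

definition supp :: "('a::euclidean_space set \<Rightarrow> complex) \<Rightarrow> 'a set" where
  "supp \<mu> = {x. \<forall>e>0. \<exists>A\<in>bounded_borel. A \<subseteq> ball x e \<and> \<mu> A \<noteq> 0}"

text \<open>The positive variation of a locally finite signed measure; together with the positive
  variation of the negated measure it gives the Jordan decomposition. Negative values of
  \<open>\<sigma>\<close> are sent to zero by \<open>ennreal\<close>, which does not change the supremum because the
  empty set contributes zero.\<close>

definition positive_variation :: "('a::euclidean_space set \<Rightarrow> real) \<Rightarrow> 'a measure" where
  "positive_variation \<sigma> =
     measure_of UNIV (sets borel) (\<lambda>A. SUP B \<in> {B \<in> bounded_borel. B \<subseteq> A}. ennreal (\<sigma> B))"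

definition radon_integral ::
  "('a::euclidean_space set \<Rightarrow> complex) \<Rightarrow> ('a \<Rightarrow> complex) \<Rightarrow> complex" where
  "radon_integral \<mu> f =
     ((LINT x|positive_variation (\<lambda>A. Re (\<mu> A)). f x) -
      (LINT x|positive_variation (\<lambda>A. - Re (\<mu> A)). f x)) +
     \<i> * ((LINT x|positive_variation (\<lambda>A. Im (\<mu> A)). f x) -
          (LINT x|positive_variation (\<lambda>A. - Im (\<mu> A)). f x))"

definition discrete_measure :: "('a::euclidean_space set \<Rightarrow> complex) \<Rightarrow> bool" where
  "discrete_measure \<mu> \<longleftrightarrow> (\<forall>x\<in>supp \<mu>. \<exists>e>0. ball x e \<inter> supp \<mu> = {x})"

text \<open>\<open>\<mu>\<close> is the sum over \<open>x \<in> L\<close> of the unit masses at \<open>x\<close> with coefficients \<open>a x\<close>;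
  then \<open>a x = \<mu> {x}\<close> for \<open>x \<in> L\<close>.\<close>

definition is_point_mass_sum ::
  "('a::euclidean_space set \<Rightarrow> complex) \<Rightarrow> 'a set \<Rightarrow> ('a \<Rightarrow> complex) \<Rightarrow> bool" where
  "is_point_mass_sum \<mu> L a \<longleftrightarrow> (\<forall>A\<in>bounded_borel. (a has_sum \<mu> A) (L \<inter> A))"

definition atomic_measure :: "('a::euclidean_space set \<Rightarrow> complex) \<Rightarrow> bool" where
  "atomic_measure \<mu> \<longleftrightarrow> (\<exists>L a. countable L \<and> is_point_mass_sum \<mu> L a)"


section \<open>Measures as temperate distributions\<close>

definition extends_measure ::
  "(('a::euclidean_space \<Rightarrow> complex) \<Rightarrow> complex) \<Rightarrow> ('a set \<Rightarrow> complex) \<Rightarrow> bool" where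
  "extends_measure T \<mu> \<longleftrightarrow> (\<forall>f\<in>test_functions. T f = radon_integral \<mu> f)"

definition temperate_measure :: "('a::euclidean_space set \<Rightarrow> complex) \<Rightarrow> bool" where
  "temperate_measure \<mu> \<longleftrightarrow> (\<exists>T. temperate T \<and> extends_measure T \<mu>)"

text \<open>The Fourier transform of the temperate measure \<open>\<mu>\<close> is the measure \<open>\<rho>\<close>. Test functions
  are dense in the Schwartz space, so \<open>T\<close> is unique there and \<open>\<rho>\<close> is determined by \<open>\<mu>\<close>.\<close>

definition has_fourier_measure ::
  "('a::euclidean_space set \<Rightarrow> complex) \<Rightarrow> ('a set \<Rightarrow> complex) \<Rightarrow> bool" where
  "has_fourier_measure \<mu> \<rho> \<longleftrightarrow>
     radon \<rho> \<and>
     (\<exists>T. temperate T \<and> extends_measure T \<mu> \<and> extends_measure (fourier_distribution T) \<rho>)"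

end

theory Submission
  imports Defs "HOL-Library.Diagonal_Subsequence"
begin

text \<open>For a test function \<open>f\<close> the smoothed measure \<open>t \<mapsto> \<integral> f (y - t) d(\<mu> - \<nu>)(y)\<close> equals an
  absolutely convergent sum of exponentials over the atoms of the Fourier transforms, because a measure
  whose variation is temperate has polynomial growth. Hence it is almost periodic: along a subsequence
  its translates by \<open>x k\<close> form a uniform Cauchy sequence. Suppose \<open>\<mu> {p} \<noteq> \<nu> {p}\<close> and take
  \<open>2 N + 1\<close> functions \<open>f\<close> equal to 1 inside and 0 outside pairwise disjoint thin shells around 0, so
  small that each smoothed measure has the value \<open>\<mu> {p} - \<nu> {p}\<close> at \<open>p\<close>. By almost periodicity all
  of them stay away from 0 at points \<open>t\<close> deep inside the distant balls. But around such a \<open>t\<close> there are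
  at most \<open>2 N\<close> atoms, so one of the shells contains none of them; for the corresponding \<open>f\<close> the
  value at \<open>t\<close> is a sum of at most \<open>2 N\<close> differences \<open>\<mu> {l n} - \<nu> {g n}\<close> with large \<open>n\<close>, which is
  arbitrarily small.\<close>

section \<open>Directional derivatives\<close>

text \<open>\<open>T\<close> composed with the Fourier transform is identified with the measure
  \<rho> on test functions alone, while the transform of a test function need not have compact
  support. So the exponential sum comes from a cutoff on the Fourier side and two limits: in
  \<open>T\<close> by continuity, in the sum by absolute convergence. The variation of \<rho> enters
  in the second: by positivity one dilated bump bounds all masses in a ball, where the masses of
  \<rho> itself could cancel.

  Almost periodicity is used for differences: \<open>x (s k) - x (s m)\<close> is almost a common
  period of all smoothed measures once k and m are large. Fixing m keeps the point
  \<open>t k\<close> at a constant offset from the centre \<open>x (s k)\<close>. The growing radii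
  absorb this offset, and the centres, whose norms are eventually at least the radii, leave behind
  the finitely many pairs of atoms without good estimates.

  The free shell is known only after t. Hence the lower bound at t must hold for all 2 N + 1
  functions at once, and \<mu> and \<nu> must share one sequence of translations.\<close>

definition pd :: "'a::euclidean_space \<Rightarrow> ('a \<Rightarrow> complex) \<Rightarrow> 'a \<Rightarrow> complex" where
  "pd b f = (\<lambda>x. frechet_derivative f (at x) b)"

lemma partials_Cons: "partials (b # bs) f = pd b (partials bs f)"
  by (simp add: pd_def)

declare partials.simps(2) [simp del] partials_Cons [simp]

text \<open>The recursion of \<open>partials\<close> exposes the outermost derivative; with this the
  innermost one can be split off, as closure of function classes under \<open>pd\<close>
  demands.\<close>

lemma partials_append: "partials (as @ bs) f = partials as (partials bs f)"
  by (induction as) simp_all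

lemma pd_eq: "(f has_derivative D) (at x) \<Longrightarrow> pd b f x = D b"
  unfolding pd_def using frechet_derivative_at by metis

lemma has_derivative_frechet:
  "f differentiable_on UNIV \<Longrightarrow> (f has_derivative frechet_derivative f (at x)) (at x)"
  by (simp add: differentiable_on_def frechet_derivative_works)

lemma pd_const [simp]: "pd b (\<lambda>_. c) = (\<lambda>_. 0)"
  by (auto simp: fun_eq_iff intro!: pd_eq[where D="\<lambda>_. 0"])

lemma pd_add:
  assumes "f differentiable_on UNIV" "g differentiable_on UNIV"
  shows "pd b (\<lambda>x. f x + g x) = (\<lambda>x. pd b f x + pd b g x)"
  unfolding pd_def
  using pd_eq[OF has_derivative_add[OF assms[THEN has_derivative_frechet]]]
  by (auto simp: pd_def)

lemma pd_mult:
  assumes "f differentiable_on UNIV" "g differentiable_on UNIV"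
  shows "pd b (\<lambda>x. f x * g x) = (\<lambda>x. f x * pd b g x + pd b f x * g x)"
  unfolding pd_def
  using pd_eq[OF has_derivative_mult[OF assms[THEN has_derivative_frechet]]]
  by (auto simp: pd_def)

lemma has_derivative_affine:
  assumes "f differentiable_on UNIV"
  shows "((\<lambda>x. f (s *\<^sub>R x + t)) has_derivative
    (\<lambda>v. s *\<^sub>R frechet_derivative f (at (s *\<^sub>R x + t)) v)) (at x)"
proof -
  have "((\<lambda>x. f (s *\<^sub>R x + t)) has_derivative
    (\<lambda>v. frechet_derivative f (at (s *\<^sub>R x + t)) (s *\<^sub>R v + 0))) (at x)"
    by (rule has_derivative_compose[where g=f and f="\<lambda>x. s *\<^sub>R x + t", OF _ has_derivative_frechet[OF assms]])
      (auto intro!: derivative_eq_intros)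
  then show ?thesis
    by (simp add: linear_cmul[OF linear_frechet_derivative] assms[unfolded differentiable_on_def, simplified])
qed

lemma pd_affine:
  assumes "f differentiable_on UNIV"
  shows "pd b (\<lambda>x. f (s *\<^sub>R x + t)) = (\<lambda>x. s *\<^sub>R pd b f (s *\<^sub>R x + t))"
  using pd_eq[OF has_derivative_affine[OF assms]] by (auto simp: pd_def)

lemma differentiable_affine:
  "f differentiable_on UNIV \<Longrightarrow> (\<lambda>x. f (s *\<^sub>R x + t)) differentiable_on UNIV"
  using has_derivative_affine[of f s t] unfolding differentiable_on_def differentiable_def by blast

section \<open>Smooth functions\<close>

text \<open>An induction on the multi-index keeps every derivative inside F. Choosing F well
  replaces all formulas for higher derivatives.\<close>

lemma smooth_coinduct:
  assumes "f \<in> F"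
    and F: "\<And>g. g \<in> F \<Longrightarrow> g differentiable_on UNIV"
    and pd: "\<And>g b. g \<in> F \<Longrightarrow> b \<in> Basis \<Longrightarrow> pd b g \<in> F"
  shows "smooth f"
proof -
  have "set bs \<subseteq> Basis \<Longrightarrow> partials bs f \<in> F" for bs
    by (induction bs) (use assms in auto)
  then show ?thesis using F by (auto simp: smooth_def)
qed

lemma smooth_differentiable: "smooth f \<Longrightarrow> f differentiable_on UNIV"
  unfolding smooth_def by (metis empty_subsetI list.set(1) partials.simps(1))

lemma smooth_continuous: "smooth f \<Longrightarrow> continuous_on S f"
  by (meson continuous_on_subset differentiable_imp_continuous_on smooth_differentiable subset_UNIV)

lemma smooth_pd: "smooth f \<Longrightarrow> b \<in> Basis \<Longrightarrow> smooth (pd b f)"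
  unfolding smooth_def
proof (intro allI impI)
  fix bs assume *: "\<forall>bs. set bs \<subseteq> Basis \<longrightarrow> partials bs f differentiable_on UNIV"
    "b \<in> Basis" "set bs \<subseteq> (Basis::'a set)"
  then have "set (bs @ [b]) \<subseteq> Basis" by auto
  then have "partials (bs @ [b]) f differentiable_on UNIV" using *(1) by blast
  then show "partials bs (pd b f) differentiable_on UNIV" by (simp add: partials_append)
qed

lemma smooth_partials: "smooth f \<Longrightarrow> set bs \<subseteq> Basis \<Longrightarrow> smooth (partials bs f)"
  by (induction bs) (auto simp: smooth_pd)

text \<open>The ring generated by G and the constants. By the sum and product rules it is closed
  under \<open>pd\<close> as soon as the derivatives of the generators lie in it, so Leibniz's
  formula never has to be written out.\<close>

inductive_set ring_hull :: "('a::euclidean_space \<Rightarrow> complex) set \<Rightarrow> ('a \<Rightarrow> complex) set"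
  for G where
  gen: "g \<in> G \<Longrightarrow> g \<in> ring_hull G"
| const: "(\<lambda>_. c) \<in> ring_hull G"
| add: "f \<in> ring_hull G \<Longrightarrow> g \<in> ring_hull G \<Longrightarrow> (\<lambda>x. f x + g x) \<in> ring_hull G"
| mult: "f \<in> ring_hull G \<Longrightarrow> g \<in> ring_hull G \<Longrightarrow> (\<lambda>x. f x * g x) \<in> ring_hull G"

lemma smooth_ring_hull:
  assumes G: "\<And>g. g \<in> G \<Longrightarrow> g differentiable_on UNIV"
    and pdG: "\<And>g b. g \<in> G \<Longrightarrow> b \<in> Basis \<Longrightarrow> pd b g \<in> ring_hull G"
    and f: "f \<in> ring_hull G"
  shows "smooth f"
proof (rule smooth_coinduct[OF f])
  have diff: "g differentiable_on UNIV" if "g \<in> ring_hull G" for g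
    using that by induction (auto simp: G)
  then show "g differentiable_on UNIV" if "g \<in> ring_hull G" for g using that by blast
  show "pd b g \<in> ring_hull G" if "g \<in> ring_hull G" "b \<in> Basis" for g b
    using that
    by induction (auto simp: pdG pd_add pd_mult diff intro: ring_hull.intros)
qed

lemma smooth_const [simp]: "smooth (\<lambda>_. c)"
  by (rule smooth_ring_hull[of "{}"]) (auto intro: ring_hull.const)

lemma smooth_hull: "f \<in> ring_hull (Collect smooth) \<Longrightarrow> smooth f"
  by (erule smooth_ring_hull[rotated 2]) (auto simp: smooth_differentiable intro: ring_hull.gen smooth_pd)

lemma smooth_add: "smooth f \<Longrightarrow> smooth g \<Longrightarrow> smooth (\<lambda>x. f x + g x)"
  by (rule smooth_hull) (auto intro: ring_hull.intros)

lemma smooth_mult: "smooth f \<Longrightarrow> smooth g \<Longrightarrow> smooth (\<lambda>x. f x * g x)"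
  by (rule smooth_hull) (auto intro: ring_hull.intros)

lemma has_derivative_coordinate:
  "((\<lambda>x. complex_of_real (x \<bullet> v)) has_derivative (\<lambda>u. complex_of_real (u \<bullet> v))) (at x)"
  by (auto intro!: derivative_eq_intros)

lemma pd_coordinate: "pd b (\<lambda>x. complex_of_real (x \<bullet> v)) = (\<lambda>_. complex_of_real (b \<bullet> v))"
  using pd_eq[OF has_derivative_coordinate] by blast

lemma differentiable_coordinate: "(\<lambda>x. complex_of_real (x \<bullet> v)) differentiable_on UNIV"
  using has_derivative_coordinate unfolding differentiable_on_def differentiable_def by blast

lemma smooth_coordinate: "smooth (\<lambda>x. complex_of_real (x \<bullet> v))"
  by (rule smooth_ring_hull[of "{\<lambda>x. complex_of_real (x \<bullet> v)}"])
    (auto simp: pd_coordinate differentiable_coordinate intro: ring_hull.intros)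

text \<open>The derivative of 1/f is -f' (1/f)^2, a polynomial in 1/f and smooth functions; these
  are the generators.\<close>

lemma smooth_inverse:
  assumes f: "smooth f" and nz: "\<And>x. f x \<noteq> 0"
  shows "smooth (\<lambda>x. inverse (f x))"
proof -
  define G where "G = insert (\<lambda>x. inverse (f x)) (Collect smooth)"
  have der: "((\<lambda>x. inverse (f x)) has_derivative
      (\<lambda>v. - (inverse (f x) * frechet_derivative f (at x) v * inverse (f x)))) (at x)" for x
    using Deriv.has_derivative_inverse[OF nz has_derivative_frechet[OF smooth_differentiable[OF f]]] .
  have inv: "(\<lambda>x. inverse (f x)) \<in> ring_hull G" by (auto simp: G_def intro: ring_hull.gen)
  show ?thesis
  proof (rule smooth_ring_hull[OF _ _ inv])
    show "g differentiable_on UNIV" if "g \<in> G" for g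
      using that der smooth_differentiable
      unfolding G_def differentiable_on_def differentiable_def by fastforce
    fix g and b :: 'a assume g: "g \<in> G" and b: "b \<in> Basis"
    show "pd b g \<in> ring_hull G"
    proof (cases "smooth g")
      case True
      then show ?thesis using b by (auto simp: G_def intro!: ring_hull.gen smooth_pd)
    next
      case False
      with g have "g = (\<lambda>x. inverse (f x))" by (auto simp: G_def)
      then have "pd b g = (\<lambda>x. (-1) * (inverse (f x) * (inverse (f x) * pd b f x)))"
        using pd_eq[OF der] by (auto simp: pd_def)
      moreover have "pd b f \<in> ring_hull G"
        using f b by (auto simp: G_def intro!: ring_hull.gen smooth_pd)
      ultimately show ?thesis by (simp only:) (intro ring_hull.mult ring_hull.const inv)
    qed
  qed
qed

lemma partials_affine:
  assumes "smooth f" "set bs \<subseteq> Basis"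
  shows "partials bs (\<lambda>x. f (s *\<^sub>R x + t)) = (\<lambda>x. s ^ length bs *\<^sub>R partials bs f (s *\<^sub>R x + t))"
  using assms(2)
proof (induction bs)
  case (Cons b bs)
  have d: "partials bs f differentiable_on UNIV" using assms Cons by (auto simp: smooth_def)
  have "pd b (\<lambda>x. of_real (s ^ length bs) * partials bs f (s *\<^sub>R x + t)) =
      (\<lambda>x. of_real (s ^ length bs) * (s *\<^sub>R pd b (partials bs f) (s *\<^sub>R x + t)))"
    by (subst pd_mult) (auto simp: pd_affine[OF d] differentiable_affine[OF d])
  then show ?case using Cons by (simp add: scaleR_conv_of_real mult_ac)
qed auto

lemma smooth_affine:
  assumes "smooth f"
  shows "smooth (\<lambda>x. f (s *\<^sub>R x + t))"
  unfolding smooth_def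
proof (intro allI impI)
  fix bs :: "'a list" assume bs: "set bs \<subseteq> Basis"
  have "partials bs f differentiable_on UNIV" using assms bs by (auto simp: smooth_def)
  from differentiable_affine[OF this]
  show "partials bs (\<lambda>x. f (s *\<^sub>R x + t)) differentiable_on UNIV"
    by (simp add: partials_affine[OF assms bs] scaleR_conv_of_real)
qed

section \<open>Flat functions and bumps\<close>

definition flat :: "nat \<Rightarrow> real \<Rightarrow> real" where
  "flat k s = (if s > 0 then inverse s ^ k * exp (- inverse s) else 0)"

lemma flat_right: "(flat k \<longlongrightarrow> 0) (at_right 0)"
proof -
  have "((\<lambda>x::real. x ^ k / exp x) \<longlongrightarrow> 0) at_top" by (rule tendsto_power_div_exp_0)
  then have "((\<lambda>x::real. inverse x ^ k / exp (inverse x)) \<longlongrightarrow> 0) (at_right 0)"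
    by (rule filterlim_compose[OF _ filterlim_inverse_at_top_right])
  moreover have "eventually (\<lambda>x::real. inverse x ^ k / exp (inverse x) = flat k x) (at_right 0)"
    by (auto simp: eventually_at_filter flat_def exp_minus field_simps)
  ultimately show ?thesis using tendsto_cong by force
qed

text \<open>Differentiating s^(-k) exp (-1/s) gives two functions of the same kind with larger k.
  This is why the whole family is considered and not only exp (-1/s).\<close>

lemma flat_DERIV: "(flat k has_real_derivative flat (k + 2) s - k * flat (k + 1) s) (at s)"
proof -
  consider "s > 0" | "s < 0" | "s = 0" by linarith
  then show ?thesis
  proof cases
    case 1
    \<comment> \<open>For k = 0 the truncated exponent is wrong, but the factor k removes that
      term.\<close>
    have k: "real k * inverse s ^ (k - Suc 0) * inverse s = real k * inverse s ^ k" for s :: real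
      by (cases k) (auto simp: mult_ac)
    have "((\<lambda>s. inverse s ^ k * exp (- inverse s)) has_real_derivative
        inverse s ^ k * (exp (- inverse s) * (inverse s * inverse s)) +
        (real k * inverse s ^ (k - Suc 0) * inverse s) * (- inverse s) * exp (- inverse s)) (at s)"
      using 1 by (auto intro!: derivative_eq_intros)
    then have "((\<lambda>s. inverse s ^ k * exp (- inverse s)) has_real_derivative
        flat (k + 2) s - k * flat (k + 1) s) (at s)"
      unfolding k using 1 by (simp add: flat_def algebra_simps power_add power2_eq_square)
    then show ?thesis
      by (rule has_field_derivative_transform_within_open[where S="{0<..}"])
         (use 1 in \<open>auto simp: flat_def\<close>)
  next
    case 2
    have "((\<lambda>s. 0) has_real_derivative flat (k + 2) s - k * flat (k + 1) s) (at s)"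
      using 2 by (auto simp: flat_def)
    then show ?thesis
      by (rule has_field_derivative_transform_within_open[where S="{..<0}"])
         (use 2 in \<open>auto simp: flat_def\<close>)
  next
    case 3
    \<comment> \<open>For y > 0 the difference quotient at 0 is \<open>flat (Suc k) y\<close>; for y
      < 0 it is 0.\<close>
    have "((\<lambda>y. flat k y / y) \<longlongrightarrow> 0) (at_right 0)"
      using flat_right[of "Suc k"]
      by (rule Lim_transform_eventually) (auto simp: eventually_at_filter flat_def field_simps)
    moreover have "((\<lambda>y. flat k y / y) \<longlongrightarrow> 0) (at_left 0)"
      by (rule tendsto_eventually) (auto simp: eventually_at_filter flat_def)
    ultimately have "((\<lambda>y. flat k y / y) \<longlongrightarrow> 0) (at 0)"
      by (simp add: filterlim_at_split)
    then show ?thesis using 3 by (simp add: has_field_derivative_iff flat_def)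
  qed
qed

text \<open>The inner function is quadratic, so each derivative is a coordinate times a combination
  of members of the flat family. Coordinates and these compositions generate a suitable
  ring.\<close>

lemma smooth_flat: "smooth (\<lambda>x::'a::euclidean_space. complex_of_real (flat 0 (s * (x \<bullet> x) + c)))"
proof -
  define fl where "fl k = (\<lambda>x::'a. complex_of_real (flat k (s * (x \<bullet> x) + c)))" for k
  define G where "G = range fl \<union> range (\<lambda>v x. complex_of_real (x \<bullet> v))"
  have D: "(flat k has_derivative (\<lambda>h. h * (flat (k + 2) t - k * flat (k + 1) t))) (at t)" for k t
    using flat_DERIV[of k t] by (simp add: has_field_derivative_def mult.commute[of _ "_ - _"])
  have der: "(fl k has_derivative (\<lambda>v. complex_of_real ((2 * s * (x \<bullet> v)) *
     (flat (k + 2) (s * (x \<bullet> x) + c) - k * flat (k + 1) (s * (x \<bullet> x) + c))))) (at x)" for k x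
    unfolding fl_def
    by (auto intro!: derivative_eq_intros has_derivative_compose[OF _ D] simp: inner_commute algebra_simps)
  have pdfl: "pd b (fl k) = (\<lambda>x. (of_real (2 * s) * of_real (x \<bullet> b)) *
      (fl (k + 2) x + of_real (- real k) * fl (k + 1) x))" for b k
    using pd_eq[OF der] by (auto simp: fl_def)
  have fl: "fl k \<in> ring_hull G" for k by (auto simp: G_def intro: ring_hull.gen)
  have co: "(\<lambda>x. complex_of_real (x \<bullet> v)) \<in> ring_hull G" for v
    by (auto simp: G_def intro: ring_hull.gen)
  show ?thesis unfolding fl_def[symmetric]
  proof (rule smooth_ring_hull[OF _ _ fl])
    show "g differentiable_on UNIV" if "g \<in> G" for g
      using that der differentiable_coordinate
      unfolding G_def differentiable_on_def differentiable_def by blast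
    fix g and b :: 'a assume "g \<in> G"
    then consider k where "g = fl k" | v where "g = (\<lambda>x. complex_of_real (x \<bullet> v))"
      unfolding G_def by blast
    then show "pd b g \<in> ring_hull G"
    proof cases
      case 1
      then show ?thesis
        by (simp only: pdfl) (intro ring_hull.mult ring_hull.add ring_hull.const fl co)
    qed (auto simp: pd_coordinate intro: ring_hull.const)
  qed
qed

lemma flat_nonneg: "flat k s \<ge> 0" and flat_pos: "s > 0 \<Longrightarrow> flat k s > 0"
  and flat_zero: "s \<le> 0 \<Longrightarrow> flat k s = 0"
  by (auto simp: flat_def)

text \<open>Take u / (u + w) with u positive exactly inside radius q and w positive exactly outside
  radius p. Since p < q, the denominator never vanishes. The two radii are free because the
  transition zone will be a prescribed thin shell; realness and positivity serve the mass estimates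
  and the inversion constant.\<close>

lemma exists_bump:
  assumes "0 < p" "p < q"
  shows "\<exists>\<phi>\<in>test_functions. (\<forall>x::'a::euclidean_space. norm x \<le> p \<longrightarrow> \<phi> x = 1) \<and>
    (\<forall>x. norm x \<ge> q \<longrightarrow> \<phi> x = 0) \<and> (\<forall>x. \<phi> x = of_real (Re (\<phi> x)) \<and> Re (\<phi> x) \<ge> 0)"
proof -
  define u where "u x = flat 0 ((-1) * (x \<bullet> x) + q^2)" for x :: 'a
  define w where "w x = flat 0 (1 * (x \<bullet> x) + - (p^2))" for x :: 'a
  have pq: "p^2 < q^2" using assms by (simp add: power_strict_mono)
  have nn: "u x \<ge> 0" "w x \<ge> 0" for x by (auto simp: u_def w_def flat_nonneg)
  have pos: "u x + w x > 0" for x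
  proof (cases "x \<bullet> x < q^2")
    case True
    then have "u x > 0" by (auto simp: u_def intro: flat_pos)
    then show ?thesis using nn[of x] by linarith
  next
    case False
    then have "w x > 0" using pq by (auto simp: w_def intro: flat_pos)
    then show ?thesis using nn[of x] by linarith
  qed
  define \<phi> where "\<phi> x = complex_of_real (u x) * inverse (complex_of_real (u x) + complex_of_real (w x))" for x
  have eq: "\<phi> x = of_real (u x / (u x + w x))" for x
    by (simp add: \<phi>_def divide_inverse)
  have nz: "complex_of_real (u x) + complex_of_real (w x) \<noteq> 0" for x
    using pos[of x] by (metis of_real_add of_real_eq_0_iff less_irrefl)
  have sm: "smooth \<phi>" unfolding \<phi>_def
    by (intro smooth_mult smooth_inverse smooth_add nz) (simp_all only: u_def w_def smooth_flat)
  have z: "\<phi> x = 0" if "norm x \<ge> q" for x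
  proof -
    have "q^2 \<le> x \<bullet> x" using that assms by (simp add: power2_norm_eq_inner[symmetric])
    then show ?thesis by (simp add: eq u_def flat_zero)
  qed
  have o: "\<phi> x = 1" if "norm x \<le> p" for x
  proof -
    have "x \<bullet> x \<le> p^2" using that assms by (simp add: power2_norm_eq_inner[symmetric])
    then have "w x = 0" by (simp add: w_def flat_zero)
    then show ?thesis using pos[of x] by (simp add: eq)
  qed
  have "{x. \<phi> x \<noteq> 0} \<subseteq> cball 0 q" using z by (auto simp: not_le[symmetric] intro: less_imp_le)
    (meson linear)
  then have "compact (closure {x. \<phi> x \<noteq> 0})"
    by (meson bounded_cball bounded_subset compact_closure)
  with sm have "\<phi> \<in> test_functions" by (simp add: test_functions_def)
  moreover have "\<phi> x = of_real (Re (\<phi> x)) \<and> Re (\<phi> x) \<ge> 0" for x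
    using nn[of x] by (simp add: eq)
  ultimately show ?thesis using z o by blast
qed

section \<open>Schwartz functions\<close>

definition decays :: "('a::euclidean_space \<Rightarrow> complex) \<Rightarrow> bool" where
  "decays f \<longleftrightarrow> (\<forall>k. \<exists>C. \<forall>x. (1 + norm x) ^ k * norm (f x) \<le> C)"

lemma schwartz_iff:
  "f \<in> schwartz \<longleftrightarrow> smooth f \<and> (\<forall>bs. set bs \<subseteq> Basis \<longrightarrow> decays (partials bs f))"
proof -
  have "bounded (range (\<lambda>x. (1 + norm x) ^ k *\<^sub>R f x)) \<longleftrightarrow> (\<exists>C. \<forall>x. (1 + norm x) ^ k * norm (f x) \<le> C)"
    for f :: "'a \<Rightarrow> complex" and k
    by (auto simp: bounded_iff)
  then show ?thesis unfolding schwartz_def decays_def by auto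
qed

lemma schwartz_smooth: "f \<in> schwartz \<Longrightarrow> smooth f"
  by (simp add: schwartz_iff)

lemma schwartz_decays: "f \<in> schwartz \<Longrightarrow> decays f"
  unfolding schwartz_iff by (metis empty_subsetI list.set(1) partials.simps(1))

lemma schwartz_differentiable: "f \<in> schwartz \<Longrightarrow> f differentiable_on UNIV"
  by (simp add: schwartz_smooth smooth_differentiable)

lemma schwartz_coinduct:
  assumes "f \<in> F"
    and F: "\<And>g. g \<in> F \<Longrightarrow> g differentiable_on UNIV" "\<And>g. g \<in> F \<Longrightarrow> decays g"
    and pd: "\<And>g b. g \<in> F \<Longrightarrow> b \<in> Basis \<Longrightarrow> pd b g \<in> F"
  shows "f \<in> schwartz"
proof -
  have "set bs \<subseteq> Basis \<Longrightarrow> partials bs f \<in> F" for bs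
    by (induction bs) (use assms in auto)
  then show ?thesis using F by (auto simp: smooth_def schwartz_iff)
qed

lemma schwartz_pd: "f \<in> schwartz \<Longrightarrow> b \<in> Basis \<Longrightarrow> pd b f \<in> schwartz"
  unfolding schwartz_iff
proof (intro conjI allI impI; (elim conjE)?)
  fix bs :: "'a list" assume "\<forall>bs. set bs \<subseteq> Basis \<longrightarrow> decays (partials bs f)" "b \<in> Basis" "set bs \<subseteq> Basis"
  moreover from this have "set (bs @ [b]) \<subseteq> Basis" by simp
  ultimately have "decays (partials (bs @ [b]) f)" by blast
  then show "decays (partials bs (pd b f))" by (simp add: partials_append)
qed (simp add: smooth_pd)

lemma schwartz_partials: "f \<in> schwartz \<Longrightarrow> set bs \<subseteq> Basis \<Longrightarrow> partials bs f \<in> schwartz"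
  by (induction bs) (auto simp: schwartz_pd)

lemma decays_add:
  assumes "decays f" "decays g"
  shows "decays (\<lambda>x. f x + g x)"
  unfolding decays_def
proof
  fix k
  obtain C D where C: "\<And>x. (1 + norm x) ^ k * norm (f x) \<le> C" and D: "\<And>x. (1 + norm x) ^ k * norm (g x) \<le> D"
    using assms unfolding decays_def by metis
  have "(1 + norm x) ^ k * norm (f x + g x) \<le> C + D" for x
  proof -
    have "(1 + norm x) ^ k * norm (f x + g x) \<le> (1 + norm x) ^ k * (norm (f x) + norm (g x))"
      by (intro mult_left_mono norm_triangle_ineq) auto
    also have "\<dots> \<le> C + D" using C[of x] D[of x] by (simp add: distrib_left)
    finally show ?thesis .
  qed
  then show "\<exists>C. \<forall>x. (1 + norm x) ^ k * norm (f x + g x) \<le> C" by blast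
qed

section \<open>Multipliers and affine substitutions\<close>

definition moderate :: "('a::euclidean_space \<Rightarrow> complex) \<Rightarrow> bool" where
  "moderate f \<longleftrightarrow> (\<exists>C k. \<forall>x. norm (f x) \<le> C * (1 + norm x) ^ k)"

text \<open>The space usually written O_M.\<close>

definition multipliers :: "('a::euclidean_space \<Rightarrow> complex) set" where
  "multipliers = {p. smooth p \<and> (\<forall>bs. set bs \<subseteq> Basis \<longrightarrow> moderate (partials bs p))}"

lemma multipliers_pd: "f \<in> multipliers \<Longrightarrow> b \<in> Basis \<Longrightarrow> pd b f \<in> multipliers"
  unfolding multipliers_def mem_Collect_eq
proof (intro conjI allI impI; (elim conjE)?)
  fix bs :: "'a list" assume "\<forall>bs. set bs \<subseteq> Basis \<longrightarrow> moderate (partials bs f)" "b \<in> Basis" "set bs \<subseteq> Basis"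
  moreover from this have "set (bs @ [b]) \<subseteq> Basis" by simp
  ultimately have "moderate (partials (bs @ [b]) f)" by blast
  then show "moderate (partials bs (pd b f))" by (simp add: partials_append)
qed (simp add: smooth_pd)

lemma decays_moderate_mult:
  assumes "moderate p" "decays f"
  shows "decays (\<lambda>x. p x * f x)"
  unfolding decays_def
proof
  fix k
  obtain C m where C: "\<And>x. norm (p x) \<le> C * (1 + norm x) ^ m" using assms unfolding moderate_def by metis
  obtain D where D: "\<And>x. (1 + norm x) ^ (k + m) * norm (f x) \<le> D"
    using assms unfolding decays_def by metis
  have C0: "C \<ge> 0" using order_trans[OF norm_ge_zero C[of 0]] by simp
  have "(1 + norm x) ^ k * norm (p x * f x) \<le> C * D" for x
  proof -
    have "(1 + norm x) ^ k * norm (p x * f x) = (1 + norm x) ^ k * norm (f x) * norm (p x)"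
      by (simp add: norm_mult mult_ac)
    also have "\<dots> \<le> (1 + norm x) ^ k * norm (f x) * (C * (1 + norm x) ^ m)"
      by (intro mult_left_mono C) auto
    also have "\<dots> = C * ((1 + norm x) ^ (k + m) * norm (f x))" by (simp add: power_add mult_ac)
    also have "\<dots> \<le> C * D" by (intro mult_left_mono D C0)
    finally show ?thesis .
  qed
  then show "\<exists>C. \<forall>x. (1 + norm x) ^ k * norm (p x * f x) \<le> C" by blast
qed

text \<open>Finite sums of products are stable under \<open>pd\<close> by the product rule, and each
  of them decays; this yields the multiplier property of O_M without expanding higher
  derivatives.\<close>

inductive_set mult_hull :: "('a::euclidean_space \<Rightarrow> complex) set" where
  base: "p \<in> multipliers \<Longrightarrow> f \<in> schwartz \<Longrightarrow> (\<lambda>x. p x * f x) \<in> mult_hull"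
| add: "f \<in> mult_hull \<Longrightarrow> g \<in> mult_hull \<Longrightarrow> (\<lambda>x. f x + g x) \<in> mult_hull"

lemma mult_hull_schwartz:
  assumes "f \<in> mult_hull" shows "f \<in> schwartz"
proof (rule schwartz_coinduct[OF assms])
  have dm: "p \<in> multipliers \<Longrightarrow> p differentiable_on UNIV" for p :: "'a \<Rightarrow> complex"
    by (simp add: multipliers_def smooth_differentiable)
  have mm: "p \<in> multipliers \<Longrightarrow> moderate p" for p :: "'a \<Rightarrow> complex"
    unfolding multipliers_def by (metis (no_types, lifting) empty_subsetI list.set(1) mem_Collect_eq partials.simps(1))
  show d: "g differentiable_on UNIV" if "g \<in> mult_hull" for g :: "'a \<Rightarrow> complex"
    using that by induction (auto simp: dm schwartz_differentiable)
  show "decays g" if "g \<in> mult_hull" for g :: "'a \<Rightarrow> complex"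
    using that by induction (auto simp: mm schwartz_decays decays_moderate_mult decays_add)
  show "pd b g \<in> mult_hull" if "g \<in> mult_hull" "b \<in> Basis" for g :: "'a \<Rightarrow> complex" and b
    using that
  proof induction
    case (base p f)
    then show ?case
      by (simp add: pd_mult dm schwartz_differentiable)
        (intro mult_hull.intros multipliers_pd schwartz_pd)
  next
    case (add f g)
    then show ?case by (simp add: pd_add d mult_hull.add)
  qed
qed

lemma schwartz_mult: "p \<in> multipliers \<Longrightarrow> f \<in> schwartz \<Longrightarrow> (\<lambda>x. p x * f x) \<in> schwartz"
  by (rule mult_hull_schwartz, rule mult_hull.base)

lemma partials_const: "bs \<noteq> [] \<Longrightarrow> partials bs (\<lambda>_. c) = (\<lambda>_. 0)"
proof (induction bs)
  case (Cons b bs)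
  then show ?case by (cases bs) auto
qed auto

lemma const_multiplier: "(\<lambda>_. c) \<in> multipliers"
proof -
  have "moderate (\<lambda>_. c)" for c unfolding moderate_def by (rule exI[of _ "norm c"], rule exI[of _ 0]) auto
  then have "moderate (partials bs (\<lambda>_. c))" for bs
    by (cases bs) (auto simp: partials_const simp del: partials_Cons)
  then show ?thesis by (auto simp: multipliers_def)
qed

lemma coordinate_multiplier: "(\<lambda>x. complex_of_real (x \<bullet> v)) \<in> multipliers"
proof -
  have 1: "moderate (\<lambda>_. c)" for c unfolding moderate_def by (rule exI[of _ "norm c"], rule exI[of _ 0]) auto
  have 2: "moderate (\<lambda>x. complex_of_real (x \<bullet> v))"
    unfolding moderate_def
  proof (rule exI[of _ "norm v"], rule exI[of _ 1], intro allI)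
    fix x :: 'a
    have "norm (complex_of_real (x \<bullet> v)) \<le> norm x * norm v" by (simp add: Cauchy_Schwarz_ineq2)
    also have "\<dots> \<le> norm v * (1 + norm x) ^ 1" by (simp add: algebra_simps)
    finally show "norm (complex_of_real (x \<bullet> v)) \<le> norm v * (1 + norm x) ^ 1" .
  qed
  have "partials bs (\<lambda>x. complex_of_real (x \<bullet> v)) = (\<lambda>x. complex_of_real (x \<bullet> v)) \<or>
      (\<exists>c. partials bs (\<lambda>x. complex_of_real (x \<bullet> v)) = (\<lambda>_. c))" for bs
    by (induction bs) (auto simp: pd_coordinate)
  then have "moderate (partials bs (\<lambda>x. complex_of_real (x \<bullet> v)))" for bs
    by (metis 1 2)
  then show ?thesis by (auto simp: multipliers_def smooth_coordinate)
qed

lemma schwartz_cmult: "f \<in> schwartz \<Longrightarrow> (\<lambda>x. c * f x) \<in> schwartz"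
  using schwartz_mult[OF const_multiplier] by blast

lemma schwartz_add: assumes "f \<in> schwartz" "g \<in> schwartz" shows "(\<lambda>x. f x + g x) \<in> schwartz"
  using mult_hull_schwartz[OF mult_hull.add[OF mult_hull.base[OF const_multiplier[of 1] assms(1)]
    mult_hull.base[OF const_multiplier[of 1] assms(2)]]] by simp

lemma decays_affine:
  assumes "decays f" "s \<noteq> 0" shows "decays (\<lambda>x. f (s *\<^sub>R x + t))"
  unfolding decays_def
proof
  fix k
  obtain C where C: "\<And>x. (1 + norm x) ^ k * norm (f x) \<le> C" using assms unfolding decays_def by metis
  \<comment> \<open>Solving y = s x + t for x gives 1 + |x| \<le> K (1 + |y|), which compares the
    two weights.\<close>
  define K where "K = 1 + norm (inverse s) + norm (inverse s *\<^sub>R t)"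
  have "(1 + norm x) ^ k * norm (f (s *\<^sub>R x + t)) \<le> K ^ k * C" for x
  proof -
    define y where "y = s *\<^sub>R x + t"
    have "x = inverse s *\<^sub>R y - inverse s *\<^sub>R t" using assms by (simp add: y_def scaleR_add_right)
    then have "norm x \<le> norm (inverse s *\<^sub>R y) + norm (inverse s *\<^sub>R t)" by (metis norm_triangle_ineq4)
    then have "1 + norm x \<le> 1 + norm (inverse s) * norm y + norm (inverse s *\<^sub>R t)" by simp
    also have "\<dots> \<le> K * (1 + norm y)"
    proof -
      have "0 \<le> norm (inverse s) + norm y + norm (inverse s *\<^sub>R t) * norm y" by simp
      then show ?thesis unfolding K_def by (simp add: algebra_simps del: norm_scaleR norm_inverse)
    qed
    finally have "(1 + norm x) ^ k \<le> (K * (1 + norm y)) ^ k" by (intro power_mono) auto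
    then have "(1 + norm x) ^ k * norm (f y) \<le> (K * (1 + norm y)) ^ k * norm (f y)"
      by (rule mult_right_mono) auto
    also have "\<dots> = K ^ k * ((1 + norm y) ^ k * norm (f y))" by (simp add: power_mult_distrib)
    also have "\<dots> \<le> K ^ k * C" by (intro mult_left_mono C) (auto simp: K_def)
    finally show ?thesis by (simp add: y_def)
  qed
  then show "\<exists>C. \<forall>x. (1 + norm x) ^ k * norm (f (s *\<^sub>R x + t)) \<le> C" by blast
qed

lemma decays_cmult: "decays f \<Longrightarrow> decays (\<lambda>x. c * f x)"
proof (rule decays_moderate_mult)
  show "moderate (\<lambda>_. c)" unfolding moderate_def by (rule exI[of _ "norm c"], rule exI[of _ 0]) auto
qed

lemma schwartz_affine:
  assumes "f \<in> schwartz" "s \<noteq> 0" shows "(\<lambda>x. f (s *\<^sub>R x + t)) \<in> schwartz"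
  unfolding schwartz_iff
proof (intro conjI allI impI)
  show "smooth (\<lambda>x. f (s *\<^sub>R x + t))" using assms by (simp add: schwartz_smooth smooth_affine)
  fix bs :: "'a list" assume bs: "set bs \<subseteq> Basis"
  have "decays (\<lambda>x. of_real (s ^ length bs) * partials bs f (s *\<^sub>R x + t))"
    by (rule decays_cmult, rule decays_affine, rule schwartz_decays, rule schwartz_partials)
      (use assms bs in auto)
  then show "decays (partials bs (\<lambda>x. f (s *\<^sub>R x + t)))"
    by (simp add: partials_affine bs schwartz_smooth assms scaleR_conv_of_real)
qed

section \<open>Compactly supported functions\<close>

lemma pd_zero_outside:
  assumes "closed K" "\<And>x. x \<notin> K \<Longrightarrow> f x = 0" "x \<notin> K"
  shows "pd b f x = 0"
proof -
  have "((\<lambda>_. 0) has_derivative (\<lambda>_. 0)) (at x)" by simp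
  then have "(f has_derivative (\<lambda>_. 0)) (at x)"
    by (rule has_derivative_transform_within_open[where s="- K"]) (use assms in auto)
  then show ?thesis using pd_eq by blast
qed

lemma partials_zero_outside:
  assumes "closed K" "\<And>x. x \<notin> K \<Longrightarrow> f x = 0"
  shows "x \<notin> K \<Longrightarrow> partials bs f x = 0"
proof (induction bs arbitrary: x)
  case (Cons b bs)
  then show ?case using pd_zero_outside[OF assms(1), of "partials bs f"] by simp
qed (use assms in simp)

lemma test_functionsI:
  assumes "smooth f" "\<And>x. norm x > r \<Longrightarrow> f x = 0"
  shows "f \<in> test_functions"
proof -
  have "{x. f x \<noteq> 0} \<subseteq> cball 0 r" using assms(2) by (auto simp flip: not_less)
  then have "compact (closure {x. f x \<noteq> 0})" by (meson bounded_cball bounded_subset compact_closure)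
  then show ?thesis using assms by (simp add: test_functions_def)
qed

lemma test_functions_support:
  assumes "f \<in> test_functions"
  shows "\<exists>r>0. \<forall>x. norm x > r \<longrightarrow> f x = 0"
proof -
  have "compact (closure {x. f x \<noteq> 0})" using assms by (simp add: test_functions_def)
  then have "bounded {x. f x \<noteq> 0}"
    using bounded_subset[OF compact_imp_bounded closure_subset] by blast
  then obtain r where "r > 0" "\<forall>x\<in>{x. f x \<noteq> 0}. norm x \<le> r" using bounded_pos by blast
  then have "\<forall>x. norm x > r \<longrightarrow> f x = 0" by force
  with \<open>r > 0\<close> show ?thesis by blast
qed

lemma bounded_support_decays:
  assumes "continuous_on UNIV f" "\<And>x. norm x > r \<Longrightarrow> f x = 0"
  shows "decays f"
  unfolding decays_def
proof
  fix k
  have "compact ((\<lambda>x. (1 + norm x) ^ k * norm (f x)) ` cball 0 r)"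
    by (intro compact_continuous_image continuous_intros continuous_on_subset[OF assms(1)]) auto
  from compact_imp_bounded[OF this]
  obtain C where "\<forall>x\<in>cball 0 r. norm ((1 + norm x) ^ k * norm (f x)) \<le> C"
    unfolding bounded_iff ball_simps by blast
  then have C: "norm ((1 + norm x) ^ k * norm (f x)) \<le> C" if "norm x \<le> r" for x
    using that by auto
  have "(1 + norm x) ^ k * norm (f x) \<le> max C 0" for x
    using C[of x] assms(2)[of x] by (cases "norm x \<le> r") auto
  then show "\<exists>C. \<forall>x. (1 + norm x) ^ k * norm (f x) \<le> C" by blast
qed

lemma partials_test:
  assumes "f \<in> test_functions" "set bs \<subseteq> Basis" shows "partials bs f \<in> test_functions"
proof -
  obtain r where r: "\<And>x. norm x > r \<Longrightarrow> f x = 0"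
    using test_functions_support[OF assms(1)] by auto
  have "partials bs f x = 0" if "norm x > r" for x
    by (rule partials_zero_outside[of "cball 0 r"]) (use r that in auto)
  then show ?thesis using assms
    by (intro test_functionsI[of _ r] smooth_partials) (auto simp: test_functions_def)
qed

lemma test_smooth: "f \<in> test_functions \<Longrightarrow> smooth f"
  by (simp add: test_functions_def)

lemma test_schwartz: "f \<in> test_functions \<Longrightarrow> f \<in> schwartz"
proof -
  have d: "decays g" if g: "g \<in> test_functions" for g :: "'a \<Rightarrow> complex"
  proof -
    obtain r where r: "\<And>x. norm x > r \<Longrightarrow> g x = 0"
      using test_functions_support[OF g] by auto
    show ?thesis
      using smooth_continuous[OF test_smooth[OF g]] r by (rule bounded_support_decays)
  qed
  show "f \<in> schwartz" if "f \<in> test_functions"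
    using that by (simp add: schwartz_iff test_smooth d partials_test)
qed

lemma test_mult:
  assumes "f \<in> test_functions" "smooth g"
  shows "(\<lambda>x. f x * g x) \<in> test_functions"
proof -
  obtain r where "\<And>x. norm x > r \<Longrightarrow> f x = 0"
    using test_functions_support[OF assms(1)] by auto
  then show ?thesis
    by (intro test_functionsI[of _ r] smooth_mult[OF test_smooth[OF assms(1)] assms(2)]) auto
qed

lemma test_affine:
  assumes "f \<in> test_functions" "s \<noteq> 0" shows "(\<lambda>x. f (s *\<^sub>R x + t)) \<in> test_functions"
proof -
  obtain r where r: "\<And>x. norm x > r \<Longrightarrow> f x = 0"
    using test_functions_support[OF assms(1)] by auto
  show ?thesis
  proof (rule test_functionsI[of _ "(r + norm t) / \<bar>s\<bar>"])
    show "smooth (\<lambda>x. f (s *\<^sub>R x + t))" using assms by (simp add: test_smooth smooth_affine)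
    fix x :: 'a assume "norm x > (r + norm t) / \<bar>s\<bar>"
    then have "r + norm t < norm (s *\<^sub>R x)" using assms by (simp add: field_simps)
    also have "\<dots> \<le> norm (s *\<^sub>R x + t) + norm t" by (metis add_diff_cancel norm_triangle_ineq4)
    finally show "f (s *\<^sub>R x + t) = 0" by (intro r) simp
  qed
qed

section \<open>Integrability of rapidly decaying functions\<close>

lemma emeasure_lborel_cball_le:
  assumes "r \<ge> 0"
  shows "emeasure lborel (cball (0::'a::euclidean_space) r) \<le> ennreal ((2 * r) ^ DIM('a))"
proof -
  have "cball (0::'a) r \<subseteq> cbox (- r *\<^sub>R One) (r *\<^sub>R One)"
  proof
    fix x :: 'a assume "x \<in> cball 0 r"
    then have "- r \<le> x \<bullet> i \<and> x \<bullet> i \<le> r" if "i \<in> Basis" for i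
      using Basis_le_norm[OF that, of x] by (simp add: abs_le_iff)
    then show "x \<in> cbox (- r *\<^sub>R One) (r *\<^sub>R One)"
      by (simp add: mem_box)
  qed
  then have "emeasure lborel (cball (0::'a) r) \<le> emeasure lborel (cbox (- r *\<^sub>R One) (r *\<^sub>R One :: 'a))"
    by (rule emeasure_mono) simp
  also have "\<dots> = ennreal (\<Prod>b\<in>(Basis::'a set). (r *\<^sub>R One - (- r *\<^sub>R One)) \<bullet> b)"
    using assms by (simp add: emeasure_lborel_cbox_eq)
  also have "(\<Prod>b\<in>(Basis::'a set). (r *\<^sub>R One - (- r *\<^sub>R One)) \<bullet> b) = (\<Prod>b\<in>(Basis::'a set). 2 * r)"
    by (rule prod.cong) (auto simp: inner_add_left)
  also have "\<dots> = (2 * r) ^ DIM('a)" by simp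
  finally show ?thesis .
qed

text \<open>A point x is charged to the ball of radius n + 1 with n the floor of |x|, where the
  function is at most (n+1)^(-d-2). The volume is at most (2(n+1))^d, so the exponent d + 2 leaves
  the convergent series of inverse squares.\<close>

lemma integrable_inverse_power_norm:
  "integrable lborel (\<lambda>x::'a::euclidean_space. inverse ((1 + norm x) ^ (DIM('a) + 2)))"
proof (rule integrableI_nonneg)
  let ?d = "DIM('a)"
  let ?f = "\<lambda>x::'a. inverse ((1 + norm x) ^ (?d + 2))"
  let ?g = "\<lambda>n (x::'a). ennreal (inverse (real (Suc n) ^ (?d + 2))) * indicator (cball 0 (real (Suc n))) x"
  have le: "ennreal (?f x) \<le> (\<Sum>n. ?g n x)" for x
  proof -
    define n where "n = nat \<lfloor>norm x\<rfloor>"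
    have n: "real n \<le> norm x" "norm x \<le> real (Suc n)"
      using norm_ge_zero[of x] unfolding n_def by linarith+
    have "?f x \<le> inverse (real (Suc n) ^ (?d + 2))"
      using n by (intro le_imp_inverse_le power_mono) auto
    then have "ennreal (?f x) \<le> ?g n x" using n by (simp add: ennreal_leI)
    moreover define G where "G = (\<lambda>n. ?g n x)"
    have "(\<Sum>m\<in>{n}. G m) \<le> (\<Sum>n. G n)"
      by (rule sum_le_suminf) (auto intro: summableI)
    then have "G n \<le> (\<Sum>n. G n)" by simp
    ultimately show ?thesis unfolding G_def by (rule order_trans)
  qed
  have "(\<integral>\<^sup>+x. ennreal (?f x) \<partial>lborel) \<le> (\<integral>\<^sup>+x. (\<Sum>n. ?g n x) \<partial>lborel)"
    by (intro nn_integral_mono le)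
  also have "\<dots> = (\<Sum>n. \<integral>\<^sup>+x. ?g n x \<partial>lborel)"
    by (intro nn_integral_suminf borel_measurable_times_ennreal borel_measurable_const
        borel_measurable_indicator) simp
  also have "\<dots> = (\<Sum>n. ennreal (inverse (real (Suc n) ^ (?d + 2))) * emeasure lborel (cball (0::'a) (real (Suc n))))"
    by (intro suminf_cong nn_integral_cmult_indicator) simp
  also have "\<dots> \<le> (\<Sum>n. ennreal (2 ^ ?d * inverse (real (Suc n) ^ 2)))"
  proof (intro suminf_le allI summableI)
    fix n
    have "ennreal (inverse (real (Suc n) ^ (?d + 2))) * emeasure lborel (cball (0::'a) (real (Suc n)))
        \<le> ennreal (inverse (real (Suc n) ^ (?d + 2))) * ennreal ((2 * real (Suc n)) ^ ?d)"
      by (intro mult_left_mono emeasure_lborel_cball_le) auto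
    also have "\<dots> = ennreal (inverse (real (Suc n) ^ (?d + 2)) * (2 * real (Suc n)) ^ ?d)"
      by (simp add: ennreal_mult)
    also have "inverse (real (Suc n) ^ (?d + 2)) * (2 * real (Suc n)) ^ ?d = 2 ^ ?d * inverse (real (Suc n) ^ 2)"
      by (simp add: power_mult_distrib power_add field_simps power2_eq_square del: of_nat_Suc)
    finally show "ennreal (inverse (real (Suc n) ^ (?d + 2))) * emeasure lborel (cball (0::'a) (real (Suc n)))
        \<le> ennreal (2 ^ ?d * inverse (real (Suc n) ^ 2))" .
  qed
  also have "\<dots> < \<infinity>"
  proof -
    have "summable (\<lambda>n. 2 ^ ?d * inverse (real (Suc n) ^ 2))"
      using inverse_power_summable[of 2, where 'a=real]
      by (intro summable_mult) (subst summable_Suc_iff, simp)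
    then have "(\<Sum>n. ennreal (2 ^ ?d * inverse (real (Suc n) ^ 2))) = ennreal (\<Sum>n. 2 ^ ?d * inverse (real (Suc n) ^ 2))"
      by (intro suminf_ennreal2) auto
    then show ?thesis by simp
  qed
  finally show "(\<integral>\<^sup>+x. ennreal (?f x) \<partial>lborel) < \<infinity>" .
qed auto

lemma decays_bound:
  assumes "decays (f :: 'a::euclidean_space \<Rightarrow> complex)"
  obtains C where "\<And>x. norm (f x) \<le> C * inverse ((1 + norm x) ^ k)" "C \<ge> 0"
proof -
  obtain C where C: "\<And>x. (1 + norm x) ^ k * norm (f x) \<le> C" using assms unfolding decays_def by metis
  have p: "(1 + norm x) ^ k > 0" for x :: 'a by (simp add: add_pos_nonneg)
  have "norm (f x) \<le> C * inverse ((1 + norm x) ^ k)" for x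
    using C[of x] p[of x] by (simp add: field_simps)
  moreover have "C \<ge> 0" using order_trans[OF _ C[of 0]] by simp
  ultimately show ?thesis using that by blast
qed

lemma decays_integrable:
  assumes "continuous_on UNIV f" "decays (f :: 'a::euclidean_space \<Rightarrow> complex)"
  shows "integrable lborel f"
proof -
  obtain C where C: "\<And>x. norm (f x) \<le> C * inverse ((1 + norm x) ^ (DIM('a) + 2))"
    using decays_bound[OF assms(2)] by metis
  have "integrable lborel (\<lambda>x::'a. C * inverse ((1 + norm x) ^ (DIM('a) + 2)))"
    by (rule integrable_mult_right[OF integrable_inverse_power_norm])
  then show ?thesis
  proof (rule Bochner_Integration.integrable_bound)
    show "f \<in> borel_measurable lborel"
      using borel_measurable_continuous_onI[OF assms(1)] by simp
    show "AE x in lborel. norm (f x) \<le> norm (C * inverse ((1 + norm x) ^ (DIM('a) + 2)))"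
      using C by (auto intro: order_trans[OF _ abs_ge_self])
  qed
qed

lemma schwartz_continuous: "f \<in> schwartz \<Longrightarrow> continuous_on S f"
  using schwartz_smooth smooth_continuous by blast

lemma schwartz_integrable: "f \<in> schwartz \<Longrightarrow> integrable lborel f"
  by (simp add: decays_integrable schwartz_continuous schwartz_decays)

lemma schwartz_measurable: "f \<in> schwartz \<Longrightarrow> f \<in> borel_measurable borel"
  by (simp add: borel_measurable_continuous_onI schwartz_continuous)

lemma schwartz_bounded:
  assumes "f \<in> schwartz" obtains C where "\<And>x. norm (f x) \<le> C" "C \<ge> 0"
  using decays_bound[OF schwartz_decays[OF assms], of 0] by auto

lemma integral_lborel_affine:
  fixes f :: "'a::euclidean_space \<Rightarrow> complex"
  assumes f: "integrable lborel f" and c: "c \<noteq> 0"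
  shows "(LINT x|lborel. f x) = of_real (\<bar>c\<bar> ^ DIM('a)) * (LINT x|lborel. f (c *\<^sub>R x + t))"
proof -
  have [measurable]: "f \<in> borel_measurable borel" using f by auto
  have eq: "lborel = density (distr lborel borel (\<lambda>x::'a. t + c *\<^sub>R x)) (\<lambda>_. ennreal (\<bar>c\<bar> ^ DIM('a)))"
    using lborel_affine[OF c, of t] by (simp add: ennreal_power)
  have "(LINT x|lborel. f x) =
    integral\<^sup>L (density (distr lborel borel (\<lambda>x::'a. t + c *\<^sub>R x)) (\<lambda>_. ennreal (\<bar>c\<bar> ^ DIM('a)))) f"
    using eq by metis
  also have "\<dots> = (LINT x|lborel. \<bar>c\<bar> ^ DIM('a) *\<^sub>R f (t + c *\<^sub>R x))"
    by (subst integral_density, simp, simp, simp, subst integral_distr, simp_all)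
  finally show "(LINT x|lborel. f x) = of_real (\<bar>c\<bar> ^ DIM('a)) * (LINT x|lborel. f (c *\<^sub>R x + t))"
    by (simp add: add.commute scaleR_conv_of_real)
qed

section \<open>The Fourier transform of Schwartz functions\<close>

definition wave :: "real \<Rightarrow> complex" where
  "wave t = exp (- 2 * of_real pi * \<i> * of_real t)"

lemma fourier_wave: "fourier f y = (LINT x|lborel. f x * wave (x \<bullet> y))"
  by (simp add: fourier_def wave_def)

lemma norm_wave [simp]: "norm (wave t) = 1"
proof -
  have "wave t = exp (\<i> * of_real (- 2 * pi * t))" by (simp add: wave_def mult_ac)
  then show ?thesis by (simp only: norm_exp_i_times)
qed

lemma wave_add: "wave (s + t) = wave s * wave t"
  by (simp add: wave_def exp_add[symmetric] algebra_simps)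

lemma wave_0 [simp]: "wave 0 = 1"
  by (simp add: wave_def)

lemma cnj_wave: "cnj (wave t) = wave (- t)"
  by (simp add: wave_def exp_cnj)

lemma continuous_on_wave [continuous_intros]:
  "continuous_on S f \<Longrightarrow> continuous_on S (\<lambda>x. wave (f x))"
  unfolding wave_def by (intro continuous_intros)

lemma measurable_wave [measurable]: "wave \<in> borel_measurable borel"
  by (intro borel_measurable_continuous_onI continuous_intros)

lemma integrable_mult_wave:
  assumes "integrable lborel f"
  shows "integrable lborel (\<lambda>x. f x * wave (x \<bullet> y))"
  by (rule Bochner_Integration.integrable_bound[OF assms]) (use assms in \<open>auto simp: norm_mult\<close>)

lemma norm_fourier_le:
  "norm (fourier f y) \<le> (LINT x|lborel. norm (f x))"
  unfolding fourier_wave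
  using integral_norm_bound[of lborel "\<lambda>x. f x * wave (x \<bullet> y)"] by (simp add: norm_mult)

lemma fourier_add:
  assumes "f \<in> schwartz" "g \<in> schwartz"
  shows "fourier (\<lambda>x. f x + g x) y = fourier f y + fourier g y"
  unfolding fourier_wave distrib_right
  by (intro Bochner_Integration.integral_add integrable_mult_wave schwartz_integrable assms)

lemma fourier_cmult: "fourier (\<lambda>x. c * f x) y = c * fourier f y"
  unfolding fourier_wave by (simp add: mult.assoc)

lemma fourier_affine:
  fixes f :: "'a::euclidean_space \<Rightarrow> complex"
  assumes "integrable lborel f" "c \<noteq> 0"
  shows "fourier (\<lambda>x. f (c *\<^sub>R x + t)) y =
    wave (- (t \<bullet> y) / c) * fourier f (inverse c *\<^sub>R y) / of_real (\<bar>c\<bar> ^ DIM('a))"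
proof -
  have "fourier f (inverse c *\<^sub>R y) = of_real (\<bar>c\<bar> ^ DIM('a)) *
      (LINT x|lborel. f (c *\<^sub>R x + t) * wave ((c *\<^sub>R x + t) \<bullet> (inverse c *\<^sub>R y)))"
    unfolding fourier_wave by (rule integral_lborel_affine[where f="\<lambda>x. f x * wave (x \<bullet> (inverse c *\<^sub>R y))"
        and t=t, OF integrable_mult_wave[OF assms(1)] assms(2)])
  also have "(\<lambda>x. f (c *\<^sub>R x + t) * wave ((c *\<^sub>R x + t) \<bullet> (inverse c *\<^sub>R y))) =
      (\<lambda>x. wave (t \<bullet> y / c) * (f (c *\<^sub>R x + t) * wave (x \<bullet> y)))"
  proof
    fix x
    have "(c *\<^sub>R x + t) \<bullet> (inverse c *\<^sub>R y) = t \<bullet> y / c + x \<bullet> y"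
      using assms(2) by (simp add: inner_add_left field_simps)
    then show "f (c *\<^sub>R x + t) * wave ((c *\<^sub>R x + t) \<bullet> (inverse c *\<^sub>R y)) =
        wave (t \<bullet> y / c) * (f (c *\<^sub>R x + t) * wave (x \<bullet> y))"
      by (simp only: wave_add mult_ac)
  qed
  also have "(LINT x|lborel. wave (t \<bullet> y / c) * (f (c *\<^sub>R x + t) * wave (x \<bullet> y))) =
      wave (t \<bullet> y / c) * fourier (\<lambda>x. f (c *\<^sub>R x + t)) y"
    by (simp add: fourier_wave)
  finally have F: "fourier f (inverse c *\<^sub>R y) =
      of_real (\<bar>c\<bar> ^ DIM('a)) * (wave (t \<bullet> y / c) * fourier (\<lambda>x. f (c *\<^sub>R x + t)) y)" .
  have "wave (- (t \<bullet> y) / c) * wave (t \<bullet> y / c) = 1"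
    by (simp flip: wave_add)
  then have "wave (- (t \<bullet> y) / c) * (wave (t \<bullet> y / c) * X) = X" for X
    by (simp flip: mult.assoc)
  then show ?thesis using assms(2) unfolding F by (simp add: mult.left_commute)
qed

section \<open>Derivatives of a Fourier transform\<close>

definition mulx :: "'a::euclidean_space \<Rightarrow> ('a \<Rightarrow> complex) \<Rightarrow> 'a \<Rightarrow> complex" where
  "mulx v f = (\<lambda>x. - 2 * of_real pi * \<i> * (of_real (x \<bullet> v) * f x))"

lemma schwartz_mulx: "f \<in> schwartz \<Longrightarrow> mulx v f \<in> schwartz"
  unfolding mulx_def
  by (rule schwartz_cmult, rule schwartz_mult[OF coordinate_multiplier])

text \<open>Taylor's formula of first order for the exponential. The argument is purely imaginary,
  so the factor exp |Re z| is 1 and the bound is uniform.\<close>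

lemma wave_remainder: "norm (wave t - 1 + 2 * of_real pi * \<i> * of_real t) \<le> (2 * pi * t)\<^sup>2"
proof -
  let ?z = "- 2 * of_real pi * \<i> * of_real t :: complex"
  have "norm (exp ?z - (\<Sum>k\<le>1. ?z ^ k / fact k)) \<le> exp \<bar>Re ?z\<bar> * norm ?z ^ Suc 1 / fact 1"
    by (rule Taylor_exp)
  then show ?thesis
    by (simp add: wave_def norm_mult power_mult_distrib algebra_simps flip: power2_eq_square)
qed

text \<open>\<open>mulx v\<close> multiplies by the derivative of the exponent in direction v.
  Instead of differentiating under the integral by a limit theorem, the quadratic remainder of the
  wave is integrated: the error is at most (2 pi |h|)^2 times the second moment of |f|.\<close>

lemma has_derivative_fourier:
  assumes f: "f \<in> schwartz"
  shows "(fourier f has_derivative (\<lambda>v. fourier (mulx v f) y)) (at y)"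
proof -
  \<comment> \<open>The second absolute moment, finite because f decays faster than every
    power.\<close>
  define M where "M = (LINT x|lborel. norm (complex_of_real ((norm x)\<^sup>2) * f x))"
  have "decays (\<lambda>x. complex_of_real ((norm x)\<^sup>2) * f x)"
  proof (rule decays_moderate_mult[OF _ schwartz_decays[OF f]])
    show "moderate (\<lambda>x::'a. complex_of_real ((norm x)\<^sup>2))"
      unfolding moderate_def
      by (rule exI[of _ 1], rule exI[of _ 2]) (auto simp: norm_power intro!: power_mono)
  qed
  then have intM: "integrable lborel (\<lambda>x. complex_of_real ((norm x)\<^sup>2) * f x)"
    by (intro decays_integrable continuous_intros schwartz_continuous f)
  have intm: "integrable lborel (\<lambda>x. mulx v f x * wave (x \<bullet> y))" for v y
    by (intro integrable_mult_wave schwartz_integrable schwartz_mulx f)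
  have intf: "integrable lborel (\<lambda>x. f x * wave (x \<bullet> y))" for y
    by (intro integrable_mult_wave schwartz_integrable f)
  have M0: "M \<ge> 0" by (simp add: M_def)
  have lin: "bounded_linear (\<lambda>v. fourier (mulx v f) y)"
    unfolding linear_conv_bounded_linear[symmetric]
  proof (rule linearI)
    fix u v and c :: real
    have "(\<lambda>x. mulx (u + v) f x * wave (x \<bullet> y)) = (\<lambda>x. mulx u f x * wave (x \<bullet> y) + mulx v f x * wave (x \<bullet> y))"
      by (auto simp: mulx_def inner_add_right algebra_simps)
    then show "fourier (mulx (u + v) f) y = fourier (mulx u f) y + fourier (mulx v f) y"
      unfolding fourier_wave using intm by simp
    have "(\<lambda>x. mulx (c *\<^sub>R v) f x * wave (x \<bullet> y)) = (\<lambda>x. c *\<^sub>R (mulx v f x * wave (x \<bullet> y)))"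
      by (auto simp: mulx_def scaleR_conv_of_real algebra_simps)
    then show "fourier (mulx (c *\<^sub>R v) f) y = c *\<^sub>R fourier (mulx v f) y"
      unfolding fourier_wave by simp
  qed
  show ?thesis
  proof (rule has_derivativeI_sandwich[OF zero_less_one lin])
    fix z
    assume "z \<noteq> y"
    define h where "h = z - y"
    have "(fourier f z - fourier f y) - fourier (mulx h f) y =
        (LINT x|lborel. (f x * wave (x \<bullet> z) - f x * wave (x \<bullet> y)) - mulx h f x * wave (x \<bullet> y))"
      unfolding fourier_wave
      by (simp add: Bochner_Integration.integral_diff Bochner_Integration.integrable_diff intf intm)
    also have "norm \<dots> \<le> (LINT x|lborel. (2 * pi * norm h)\<^sup>2 * norm (complex_of_real ((norm x)\<^sup>2) * f x))"
    proof (rule order_trans[OF integral_norm_bound integral_mono])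
      show "integrable lborel (\<lambda>x. norm (f x * wave (x \<bullet> z) - f x * wave (x \<bullet> y) - mulx h f x * wave (x \<bullet> y)))"
        by (intro integrable_norm Bochner_Integration.integrable_diff intf intm)
      show "integrable lborel (\<lambda>x. (2 * pi * norm h)\<^sup>2 * norm (complex_of_real ((norm x)\<^sup>2) * f x))"
        by (intro integrable_mult_right integrable_norm intM)
      fix x
      have "f x * wave (x \<bullet> z) - f x * wave (x \<bullet> y) - mulx h f x * wave (x \<bullet> y) =
          f x * wave (x \<bullet> y) * (wave (x \<bullet> h) - 1 + 2 * of_real pi * \<i> * of_real (x \<bullet> h))"
      proof -
        have "wave (x \<bullet> z) = wave (x \<bullet> y) * wave (x \<bullet> h)"
          by (simp add: h_def inner_diff_right flip: wave_add)
        then show ?thesis by (simp add: mulx_def algebra_simps)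
      qed
      then have "norm (f x * wave (x \<bullet> z) - f x * wave (x \<bullet> y) - mulx h f x * wave (x \<bullet> y)) \<le>
          norm (f x) * (2 * pi * (x \<bullet> h))\<^sup>2"
        using wave_remainder[of "x \<bullet> h"] by (simp add: norm_mult mult_left_mono)
      also have "\<dots> \<le> norm (f x) * (2 * pi * (norm x * norm h))\<^sup>2"
      proof (rule mult_left_mono)
        have "\<bar>x \<bullet> h\<bar>\<^sup>2 \<le> (norm x * norm h)\<^sup>2"
          by (rule power_mono[OF Cauchy_Schwarz_ineq2]) simp
        then show "(2 * pi * (x \<bullet> h))\<^sup>2 \<le> (2 * pi * (norm x * norm h))\<^sup>2"
          by (simp add: power_mult_distrib)
      qed simp
      finally show "norm (f x * wave (x \<bullet> z) - f x * wave (x \<bullet> y) - mulx h f x * wave (x \<bullet> y))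
          \<le> (2 * pi * norm h)\<^sup>2 * norm (complex_of_real ((norm x)\<^sup>2) * f x)"
        by (simp add: norm_mult power_mult_distrib mult_ac norm_power)
    qed
    also have "\<dots> = (2 * pi * norm h)\<^sup>2 * M" by (simp add: M_def)
    finally have "norm (fourier f z - fourier f y - fourier (mulx h f) y) \<le> (2 * pi * norm h)\<^sup>2 * M" .
    moreover have "norm h > 0" using \<open>z \<noteq> y\<close> by (simp add: h_def)
    ultimately show "norm (fourier f z - fourier f y - fourier (mulx (z - y) f) y) / norm (z - y)
        \<le> (2 * pi)\<^sup>2 * M * norm (z - y)"
      unfolding h_def[symmetric] by (simp add: field_simps power2_eq_square)
  next
    show "((\<lambda>z. (2 * pi)\<^sup>2 * M * norm (z - y)) \<longlongrightarrow> 0) (at y)"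
      by (auto intro!: tendsto_eq_intros)
  qed
qed

lemma fourier_differentiable: "f \<in> schwartz \<Longrightarrow> fourier f differentiable_on UNIV"
  using has_derivative_fourier unfolding differentiable_on_def differentiable_def by blast

lemma pd_fourier: "f \<in> schwartz \<Longrightarrow> pd b (fourier f) = fourier (mulx b f)"
  using pd_eq[OF has_derivative_fourier] by blast

lemma schwartz_foldr_mulx: "f \<in> schwartz \<Longrightarrow> foldr mulx bs f \<in> schwartz"
  by (induction bs) (auto simp: schwartz_mulx)

lemma partials_fourier: "f \<in> schwartz \<Longrightarrow> partials bs (fourier f) = fourier (foldr mulx bs f)"
  by (induction bs) (auto simp: pd_fourier schwartz_foldr_mulx)

lemma smooth_fourier: "f \<in> schwartz \<Longrightarrow> smooth (fourier f)"
  by (simp add: smooth_def partials_fourier fourier_differentiable schwartz_foldr_mulx)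

section \<open>Fourier transforms of derivatives and their decay\<close>

lemma has_vector_derivative_imp_LIMSEQ:
  fixes F :: "real \<Rightarrow> 'b::real_normed_vector"
  assumes "(F has_vector_derivative v) (at 0)"
  shows "(\<lambda>n. real (Suc n) *\<^sub>R (F (inverse (real (Suc n))) - F 0)) \<longlonglongrightarrow> v"
proof -
  have "((\<lambda>h. norm (F h - F 0 - h *\<^sub>R v) / norm h) \<longlongrightarrow> 0) (at 0)"
    using assms unfolding has_vector_derivative_def has_derivative_iff_norm by simp
  moreover have "filterlim (\<lambda>n. inverse (real (Suc n))) (at 0) sequentially"
    using LIMSEQ_inverse_real_of_nat by (simp add: filterlim_at)
  ultimately have "(\<lambda>n. norm (F (inverse (real (Suc n))) - F 0 - inverse (real (Suc n)) *\<^sub>R v)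
      / norm (inverse (real (Suc n)))) \<longlonglongrightarrow> 0"
    by (rule filterlim_compose)
  moreover have "norm (F (inverse (real (Suc n))) - F 0 - inverse (real (Suc n)) *\<^sub>R v)
      / norm (inverse (real (Suc n))) =
      norm (real (Suc n) *\<^sub>R (F (inverse (real (Suc n))) - F 0) - v)" for n
  proof -
    have "real (Suc n) *\<^sub>R (F (inverse (real (Suc n))) - F 0) - v =
       real (Suc n) *\<^sub>R (F (inverse (real (Suc n))) - F 0 - inverse (real (Suc n)) *\<^sub>R v)"
      by (simp add: scaleR_diff_right del: of_nat_Suc)
    then show ?thesis by (simp add: divide_inverse mult.commute del: of_nat_Suc)
  qed
  ultimately show ?thesis by (simp add: tendsto_norm_zero_iff LIM_zero_iff)
qed

lemma has_vector_derivative_direction: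
  assumes "f differentiable_on UNIV"
  shows "((\<lambda>h. f (x + h *\<^sub>R b)) has_vector_derivative pd b f (x + s *\<^sub>R b)) (at s within S)"
proof -
  have "((\<lambda>h. f (x + h *\<^sub>R b)) has_derivative
     (\<lambda>h. frechet_derivative f (at (x + s *\<^sub>R b)) (h *\<^sub>R b))) (at s within S)"
    by (rule has_derivative_compose[where g=f, OF _ has_derivative_frechet[OF assms]])
      (auto intro!: derivative_eq_intros)
  moreover have "linear (frechet_derivative f (at (x + s *\<^sub>R b)))"
    using assms by (intro linear_frechet_derivative) (simp add: differentiable_on_def)
  ultimately show ?thesis
    by (simp add: has_vector_derivative_def pd_def linear_cmul)
qed

text \<open>The mean value estimate moves the point by at most 1, so 1 + |x| at most doubles in
  comparison with the intermediate point; this costs the factor 2^k. The bound on the quotient does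
  not depend on h and serves as a dominating function.\<close>

lemma difference_quotient_bound:
  assumes f: "f \<in> schwartz" and b: "b \<in> Basis"
  obtains C where "\<And>x h. 0 < h \<Longrightarrow> h \<le> 1 \<Longrightarrow>
    norm (f (x + h *\<^sub>R b) - f x) \<le> C * inverse ((1 + norm x) ^ k) * h"
proof -
  obtain C where C: "\<And>x. norm (pd b f x) \<le> C * inverse ((1 + norm x) ^ k)" and C0: "C \<ge> 0"
    using decays_bound[OF schwartz_decays[OF schwartz_pd[OF f b]]] by metis
  have "norm (f (x + h *\<^sub>R b) - f x) \<le> (C * 2 ^ k) * inverse ((1 + norm x) ^ k) * h"
    if h: "0 < h" "h \<le> 1" for x h
  proof -
    have "norm (f (x + h *\<^sub>R b) - f (x + 0 *\<^sub>R b)) \<le> ((C * 2 ^ k) * inverse ((1 + norm x) ^ k)) * norm (h - 0)"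
    proof (rule differentiable_bound[where S="{0..1}" and f="\<lambda>s. f (x + s *\<^sub>R b)"
          and f'="\<lambda>s t. t *\<^sub>R pd b f (x + s *\<^sub>R b)"])
      show "((\<lambda>s. f (x + s *\<^sub>R b)) has_derivative (\<lambda>t. t *\<^sub>R pd b f (x + s *\<^sub>R b))) (at s within {0..1})" for s
        using has_vector_derivative_direction[OF schwartz_differentiable[OF f]]
        by (simp add: has_vector_derivative_def)
      fix s :: real assume s: "s \<in> {0..1}"
      have "norm x \<le> norm (x + s *\<^sub>R b) + norm (s *\<^sub>R b)" by (metis add_diff_cancel norm_triangle_ineq4)
      moreover have "norm (s *\<^sub>R b) \<le> 1" using s b by simp
      ultimately have "1 + norm x \<le> 2 * (1 + norm (x + s *\<^sub>R b))"
        using norm_ge_zero[of "x + s *\<^sub>R b"] by (simp del: norm_scaleR norm_ge_zero)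
      then have "(1 + norm x) ^ k \<le> 2 ^ k * (1 + norm (x + s *\<^sub>R b)) ^ k"
        by (subst power_mult_distrib[symmetric], intro power_mono) auto
      then have "inverse ((1 + norm (x + s *\<^sub>R b)) ^ k) \<le> 2 ^ k * inverse ((1 + norm x) ^ k)"
        by (simp add: field_simps add_pos_nonneg)
      then have "norm (pd b f (x + s *\<^sub>R b)) \<le> C * (2 ^ k * inverse ((1 + norm x) ^ k))"
        using C[of "x + s *\<^sub>R b"] C0 mult_left_mono order_trans by blast
      then have "\<bar>t\<bar> * norm (pd b f (x + s *\<^sub>R b)) \<le> \<bar>t\<bar> * (C * (2 ^ k * inverse ((1 + norm x) ^ k)))" for t :: real
        by (rule mult_left_mono) simp
      then show "onorm (\<lambda>t. t *\<^sub>R pd b f (x + s *\<^sub>R b)) \<le> (C * 2 ^ k) * inverse ((1 + norm x) ^ k)"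
        by (intro onorm_le) (simp add: mult_ac)
    qed (use h in auto)
    then show ?thesis using h by simp
  qed
  then show ?thesis using that by blast
qed

text \<open>Translating f multiplies its transform by a wave, so the transform of a difference
  quotient of f is a difference quotient of a wave at 0 times the transform of f. Dominated
  convergence along h = 1/(n+1) then replaces integration by parts.\<close>

lemma fourier_pd:
  assumes f: "f \<in> schwartz" and b: "b \<in> Basis"
  shows "fourier (pd b f) y = 2 * of_real pi * \<i> * of_real (b \<bullet> y) * fourier f y"
proof -
  define G where "G n = (\<lambda>x. real (Suc n) *\<^sub>R (f (x + inverse (real (Suc n)) *\<^sub>R b) - f x) * wave (x \<bullet> y))" for n
  obtain C where C: "\<And>x h. 0 < h \<Longrightarrow> h \<le> 1 \<Longrightarrow>
      norm (f (x + h *\<^sub>R b) - f x) \<le> C * inverse ((1 + norm x) ^ (DIM('a) + 2)) * h"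
    using difference_quotient_bound[OF f b] by metis
  have intf: "integrable lborel (\<lambda>x. f (x + t) * wave (x \<bullet> y))" for t
    using schwartz_integrable[OF schwartz_affine[OF f, of 1 t]] by (intro integrable_mult_wave) simp
  have "(\<lambda>n. LINT x|lborel. G n x) \<longlonglongrightarrow> (LINT x|lborel. pd b f x * wave (x \<bullet> y))"
  proof (rule integral_dominated_convergence)
    show "(\<lambda>x. pd b f x * wave (x \<bullet> y)) \<in> borel_measurable lborel"
      by (intro borel_measurable_integrable integrable_mult_wave schwartz_integrable schwartz_pd f b)
    have "integrable lborel (\<lambda>x. real (Suc n) *\<^sub>R (f (x + inverse (real (Suc n)) *\<^sub>R b) * wave (x \<bullet> y)
        - f (x + 0) * wave (x \<bullet> y)))" for n
      by (intro integrable_scaleR_right Bochner_Integration.integrable_diff intf)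
    then have "integrable lborel (G n)" for n
      by (simp add: G_def scaleR_conv_of_real algebra_simps)
    then show "G n \<in> borel_measurable lborel" for n by (rule borel_measurable_integrable)
    show "integrable lborel (\<lambda>x::'a. C * inverse ((1 + norm x) ^ (DIM('a) + 2)))"
      by (rule integrable_mult_right[OF integrable_inverse_power_norm])
    show "AE x in lborel. norm (G n x) \<le> C * inverse ((1 + norm x) ^ (DIM('a) + 2))" for n
    proof (rule AE_I2)
      fix x :: 'a
      have "norm (f (x + inverse (real (Suc n)) *\<^sub>R b) - f x) \<le>
          C * inverse ((1 + norm x) ^ (DIM('a) + 2)) * inverse (real (Suc n))"
        by (rule C) (auto simp: field_simps)
      then have "real (Suc n) * norm (f (x + inverse (real (Suc n)) *\<^sub>R b) - f x) \<le>
          real (Suc n) * (C * inverse ((1 + norm x) ^ (DIM('a) + 2)) * inverse (real (Suc n)))"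
        by (rule mult_left_mono) simp
      also have "\<dots> = C * inverse ((1 + norm x) ^ (DIM('a) + 2))"
        by (simp del: of_nat_Suc)
      finally show "norm (G n x) \<le> C * inverse ((1 + norm x) ^ (DIM('a) + 2))"
        by (simp add: G_def norm_mult del: of_nat_Suc)
    qed
    show "AE x in lborel. (\<lambda>n. G n x) \<longlonglongrightarrow> pd b f x * wave (x \<bullet> y)"
      unfolding G_def
      using has_vector_derivative_imp_LIMSEQ[OF has_vector_derivative_direction[where s=0 and b=b,
          OF schwartz_differentiable[OF f]]]
      by (intro AE_I2 tendsto_mult tendsto_const) simp
  qed
  moreover have "(LINT x|lborel. G n x) = real (Suc n) *\<^sub>R (wave (- (inverse (real (Suc n)) * (b \<bullet> y)))
      - wave (- (0 * (b \<bullet> y)))) * fourier f y" for n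
  proof -
    have tr: "(LINT x|lborel. f (x + t) * wave (x \<bullet> y)) = wave (- (t \<bullet> y)) * fourier f y" for t
      using fourier_affine[OF schwartz_integrable[OF f], of 1 t y] by (simp add: fourier_wave)
    have "(LINT x|lborel. G n x) = (LINT x|lborel. real (Suc n) *\<^sub>R (f (x + inverse (real (Suc n)) *\<^sub>R b) * wave (x \<bullet> y)
        - f (x + 0) * wave (x \<bullet> y)))"
      by (simp add: G_def scaleR_conv_of_real algebra_simps)
    also have "\<dots> = real (Suc n) *\<^sub>R ((LINT x|lborel. f (x + inverse (real (Suc n)) *\<^sub>R b) * wave (x \<bullet> y))
        - (LINT x|lborel. f (x + 0) * wave (x \<bullet> y)))"
      by (subst integral_scaleR_right, subst Bochner_Integration.integral_diff[OF intf intf]) simp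
    also have "\<dots> = real (Suc n) *\<^sub>R (wave (- (inverse (real (Suc n)) * (b \<bullet> y)))
      - wave (- (0 * (b \<bullet> y)))) * fourier f y"
      unfolding tr by (simp add: algebra_simps)
    finally show ?thesis .
  qed
  moreover have "(\<lambda>n. real (Suc n) *\<^sub>R (wave (- (inverse (real (Suc n)) * (b \<bullet> y)))
      - wave (- (0 * (b \<bullet> y)))) * fourier f y) \<longlonglongrightarrow> 2 * of_real pi * \<i> * of_real (b \<bullet> y) * fourier f y"
  proof (intro tendsto_mult tendsto_const has_vector_derivative_imp_LIMSEQ)
    show "((\<lambda>h. wave (- (h * (b \<bullet> y)))) has_vector_derivative
       2 * complex_of_real pi * \<i> * complex_of_real (b \<bullet> y)) (at 0)"
    proof -
      let ?c = "2 * complex_of_real pi * \<i> * complex_of_real (b \<bullet> y)"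
      have "((\<lambda>z. exp (?c * z)) has_field_derivative ?c) (at (of_real 0))"
        by (auto intro!: derivative_eq_intros)
      from has_vector_derivative_real_field[OF this] show ?thesis
        by (simp add: wave_def mult_ac)
    qed
  qed
  ultimately show ?thesis unfolding fourier_wave[of "pd b f"] by (simp add: LIMSEQ_unique)
qed

text \<open>A norm of Sobolev type W^(k,1), with multiplicities. The recursion mirrors (1+|y|)^(k+1)
  = (1+|y|)^k + |y| (1+|y|)^k, on which the decay estimate runs.\<close>

primrec deriv_L1 :: "nat \<Rightarrow> ('a::euclidean_space \<Rightarrow> complex) \<Rightarrow> real" where
  "deriv_L1 0 f = (LINT x|lborel. norm (f x))"
| "deriv_L1 (Suc k) f = deriv_L1 k f + (\<Sum>b\<in>Basis. deriv_L1 k (pd b f))"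

lemma fourier_decay:
  "f \<in> schwartz \<Longrightarrow> (1 + norm y) ^ k * norm (fourier f y) \<le> deriv_L1 k f"
proof (induction k arbitrary: f)
  case 0
  then show ?case by (simp add: norm_fourier_le)
next
  case (Suc k)
  let ?w = "(1 + norm y) ^ k"
  have "norm y * norm (fourier f y) \<le> (\<Sum>b\<in>Basis. \<bar>y \<bullet> b\<bar>) * norm (fourier f y)"
    by (intro mult_right_mono norm_le_l1) simp
  also have "\<dots> \<le> (\<Sum>b\<in>Basis. norm (fourier (pd b f) y))"
    unfolding sum_distrib_right
  proof (rule sum_mono)
    fix b :: 'a assume b: "b \<in> Basis"
    \<comment> \<open>The factor 2 pi produced by differentiation is at least 1 and may be
      dropped.\<close>
    have "1 * (\<bar>y \<bullet> b\<bar> * norm (fourier f y)) \<le> (2 * pi) * (\<bar>y \<bullet> b\<bar> * norm (fourier f y))"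
      using pi_gt3 by (intro mult_right_mono) auto
    also have "\<dots> = norm (fourier (pd b f) y)"
      by (simp add: fourier_pd[OF Suc.prems b] norm_mult inner_commute)
    finally show "\<bar>y \<bullet> b\<bar> * norm (fourier f y) \<le> norm (fourier (pd b f) y)" by simp
  qed
  finally have "?w * (norm y * norm (fourier f y)) \<le> ?w * (\<Sum>b\<in>Basis. norm (fourier (pd b f) y))"
    by (rule mult_left_mono) simp
  also have "\<dots> \<le> (\<Sum>b\<in>Basis. deriv_L1 k (pd b f))"
    unfolding sum_distrib_left by (intro sum_mono Suc.IH schwartz_pd Suc.prems)
  finally show ?case using Suc.IH[OF Suc.prems] by (simp add: algebra_simps)
qed

lemma decays_fourier: "f \<in> schwartz \<Longrightarrow> decays (fourier f)"
  unfolding decays_def using fourier_decay by blast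

lemma schwartz_fourier: "f \<in> schwartz \<Longrightarrow> fourier f \<in> schwartz"
  unfolding schwartz_iff[of "fourier f"]
  by (simp add: smooth_fourier partials_fourier decays_fourier schwartz_foldr_mulx)

lemma integrable_schwartz_mult:
  assumes "f \<in> schwartz" "g \<in> schwartz" shows "integrable lborel (\<lambda>x. f x * g x)"
proof -
  obtain C where C: "\<And>x. norm (f x) \<le> C" using schwartz_bounded[OF assms(1)] by metis
  have "integrable lborel (\<lambda>x. of_real C * g x)"
    by (intro integrable_mult_right schwartz_integrable assms)
  then show ?thesis
  proof (rule Bochner_Integration.integrable_bound)
    show "(\<lambda>x. f x * g x) \<in> borel_measurable lborel"
      using borel_measurable_times[OF assms[THEN schwartz_measurable]] by simp
    show "AE x in lborel. norm (f x * g x) \<le> norm (complex_of_real C * g x)"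
      using order_trans[OF C abs_ge_self] by (auto simp: norm_mult intro!: mult_right_mono)
  qed
qed

section \<open>Parseval's formula and inversion\<close>

lemma parseval:
  fixes f g :: "'a::euclidean_space \<Rightarrow> complex"
  assumes f: "f \<in> schwartz" and g: "g \<in> schwartz"
  shows "(LINT y|lborel. fourier f y * g y) = (LINT x|lborel. f x * fourier g x)"
proof -
  have [measurable]: "f \<in> borel_measurable borel" "g \<in> borel_measurable borel"
    using f g by (simp_all add: schwartz_measurable)
  have int: "integrable (lborel \<Otimes>\<^sub>M lborel) (\<lambda>(x, y). f x * wave (x \<bullet> y) * g y)"
  proof (rule lborel_pair.Fubini_integrable)
    have "integrable lborel (\<lambda>x. norm (f x) * (LINT y|lborel. norm (g y)))"
      by (intro integrable_mult_left integrable_norm schwartz_integrable f)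
    then show "integrable lborel (\<lambda>x. LINT y|lborel. norm (case (x, y) of (x, y) \<Rightarrow> f x * wave (x \<bullet> y) * g y))"
      by (simp add: norm_mult)
    show "AE x in lborel. integrable lborel (\<lambda>y. case (x, y) of (x, y) \<Rightarrow> f x * wave (x \<bullet> y) * g y)"
    proof (rule AE_I2)
      fix x
      have "integrable lborel (\<lambda>y. f x * (g y * wave (y \<bullet> x)))"
        by (intro integrable_mult_right integrable_mult_wave schwartz_integrable g)
      then show "integrable lborel (\<lambda>y. case (x, y) of (x, y) \<Rightarrow> f x * wave (x \<bullet> y) * g y)"
        by (simp add: mult_ac inner_commute)
    qed
  qed measurable
  have "(LINT y|lborel. fourier f y * g y) = (LINT y|lborel. LINT x|lborel. f x * wave (x \<bullet> y) * g y)"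
    by (simp add: fourier_wave)
  also have "\<dots> = (LINT x|lborel. LINT y|lborel. f x * wave (x \<bullet> y) * g y)"
    by (rule lborel_pair.Fubini_integral[OF int])
  also have "\<dots> = (LINT x|lborel. LINT y|lborel. f x * (g y * wave (y \<bullet> x)))"
    by (simp add: mult_ac inner_commute)
  also have "\<dots> = (LINT x|lborel. f x * fourier g x)"
    by (simp add: fourier_wave)
  finally show ?thesis .
qed

text \<open>The power of s from the transform of the dilated g cancels the Jacobian of the
  substitution on the other side. Both integrals therefore have limits as s tends to 0.\<close>

lemma parseval_scaled:
  fixes f g :: "'a::euclidean_space \<Rightarrow> complex"
  assumes f: "f \<in> schwartz" and g: "g \<in> schwartz" and s: "s > 0"
  shows "(LINT y|lborel. fourier f y * g (s *\<^sub>R y)) = (LINT x|lborel. f (s *\<^sub>R x) * fourier g x)"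
proof -
  have gs: "(\<lambda>y. g (s *\<^sub>R y)) \<in> schwartz" using schwartz_affine[OF g, of s 0] s by simp
  have "fourier (\<lambda>y. g (s *\<^sub>R y)) x = fourier g (inverse s *\<^sub>R x) / of_real (s ^ DIM('a))" for x
    using fourier_affine[OF schwartz_integrable[OF g], of s 0 x] s by simp
  then have "(LINT y|lborel. fourier f y * g (s *\<^sub>R y)) =
      (LINT x|lborel. f x * fourier g (inverse s *\<^sub>R x)) / of_real (s ^ DIM('a))"
    using parseval[OF f gs] by simp
  moreover have "integrable lborel (\<lambda>x. f x * fourier g (inverse s *\<^sub>R x))"
    using schwartz_affine[OF schwartz_fourier[OF g], of "inverse s" 0] s
    by (intro integrable_schwartz_mult f) simp
  from integral_lborel_affine[OF this, of s 0]
  have "(LINT x|lborel. f x * fourier g (inverse s *\<^sub>R x)) =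
      of_real (s ^ DIM('a)) * (LINT x|lborel. f (s *\<^sub>R x) * fourier g x)"
    using s by simp
  ultimately show ?thesis using s by simp
qed

lemma LIMSEQ_integral_dilate:
  fixes f g :: "'a::euclidean_space \<Rightarrow> complex"
  assumes f: "f \<in> schwartz" and g: "g \<in> schwartz"
  shows "(\<lambda>n. LINT x|lborel. f x * g (inverse (real (Suc n)) *\<^sub>R x)) \<longlonglongrightarrow> (LINT x|lborel. f x) * g 0"
proof -
  obtain C where C: "\<And>x. norm (g x) \<le> C" using schwartz_bounded[OF g] by metis
  have [measurable]: "f \<in> borel_measurable borel" "g \<in> borel_measurable borel"
    using f g by (simp_all add: schwartz_measurable)
  have "(\<lambda>n. LINT x|lborel. f x * g (inverse (real (Suc n)) *\<^sub>R x)) \<longlonglongrightarrow> (LINT x|lborel. f x * g 0)"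
  proof (rule integral_dominated_convergence)
    show "integrable lborel (\<lambda>x. norm (f x) * C)"
      by (intro integrable_mult_left integrable_norm schwartz_integrable f)
    show "AE x in lborel. norm (f x * g (inverse (real (Suc n)) *\<^sub>R x)) \<le> norm (f x) * C" for n
      by (intro AE_I2) (simp add: norm_mult mult_left_mono C)
    show "AE x in lborel. (\<lambda>n. f x * g (inverse (real (Suc n)) *\<^sub>R x)) \<longlonglongrightarrow> f x * g 0"
    proof (intro AE_I2 tendsto_mult tendsto_const)
      fix x :: 'a
      have "(\<lambda>n. inverse (real (Suc n)) *\<^sub>R x) \<longlonglongrightarrow> 0 *\<^sub>R x"
        by (intro tendsto_scaleR tendsto_const LIMSEQ_inverse_real_of_nat)
      moreover have "isCont g 0"
        using schwartz_continuous[OF g, of UNIV] by (simp add: continuous_on_eq_continuous_at)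
      ultimately show "(\<lambda>n. g (inverse (real (Suc n)) *\<^sub>R x)) \<longlonglongrightarrow> g 0"
        using isCont_tendsto_compose by fastforce
    qed
  qed measurable
  then show ?thesis by simp
qed

text \<open>Let the dilation factor tend to 0 in the scaled formula. The conclusion says that the
  integral of the transform of f is proportional to f 0; the proportionality factor becomes the
  inversion constant.\<close>

lemma integral_fourier_swap:
  fixes f g :: "'a::euclidean_space \<Rightarrow> complex"
  assumes f: "f \<in> schwartz" and g: "g \<in> schwartz"
  shows "(LINT y|lborel. fourier f y) * g 0 = f 0 * (LINT y|lborel. fourier g y)"
proof -
  have "(LINT y|lborel. fourier f y * g (inverse (real (Suc n)) *\<^sub>R y)) =
      (LINT x|lborel. fourier g x * f (inverse (real (Suc n)) *\<^sub>R x))" for n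
    using parseval_scaled[OF f g, of "inverse (real (Suc n))"] by (simp add: mult.commute)
  with LIMSEQ_integral_dilate[OF schwartz_fourier[OF f] g]
  have "(\<lambda>n. LINT x|lborel. fourier g x * f (inverse (real (Suc n)) *\<^sub>R x)) \<longlonglongrightarrow>
      (LINT x|lborel. fourier f x) * g 0"
    by simp
  from LIMSEQ_unique[OF this LIMSEQ_integral_dilate[OF schwartz_fourier[OF g] f]]
  show ?thesis by (simp add: mult.commute)
qed


lemma AE_lborel_ball:
  assumes "AE x in lborel. P x" "r > 0"
  shows "\<exists>x\<in>ball (a::'a::euclidean_space) r. P x"
proof (rule ccontr)
  assume "\<not> ?thesis"
  then have "AE x in lborel. x \<notin> ball a r"
    using assms(1) by (auto elim!: eventually_mono)
  then have "emeasure lborel (ball a r) = 0"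
    by (subst (asm) AE_iff_null_sets[symmetric]) auto
  then show False
    using content_ball_pos[OF assms(2), of a] by (simp add: measure_def)
qed

lemma integral_nonneg_zero:
  fixes f :: "'a::euclidean_space \<Rightarrow> real"
  assumes "integrable lborel f" "\<And>x. f x \<ge> 0" "(LINT x|lborel. f x) = 0" "isCont f a"
  shows "f a = 0"
proof (rule ccontr)
  assume "f a \<noteq> 0"
  then obtain d where d: "d > 0" "\<forall>y. dist a y < d \<longrightarrow> f y \<noteq> 0"
    using continuous_at_avoid[OF assms(4), of 0] by blast
  have "AE x in lborel. f x = 0"
    using integral_nonneg_eq_0_iff_AE[OF assms(1)] assms(2,3) by simp
  from AE_lborel_ball[OF this d(1), of a] show False using d(2) by auto
qed

text \<open>If the constant vanished, Parseval's formula would give \<open>\<integral> \<bar>fourier p\<bar>\<^sup>2 = 0\<close> for a bump function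
  \<open>p\<close>; that it equals 1 plays no role.\<close>

lemma fourier_inversion_const:
  obtains c where "c \<noteq> 0"
    "\<And>f x. f \<in> schwartz \<Longrightarrow> fourier (fourier f) (x::'a::euclidean_space) = c * f (- x)"
proof -
  obtain p :: "'a \<Rightarrow> complex" where p: "p \<in> test_functions" "\<And>x. norm x \<le> 1 \<Longrightarrow> p x = 1"
    "\<And>x. p x = of_real (Re (p x))" "\<And>x. Re (p x) \<ge> 0"
    using exists_bump[of 1 2, where 'a='a] by auto
  have ps: "p \<in> schwartz" using p(1) by (rule test_schwartz)
  define c where "c = (LINT y|lborel. fourier p y)"
  have c0: "(LINT y|lborel. fourier f y) = c * f 0" if "f \<in> schwartz" for f :: "'a \<Rightarrow> complex"
    using integral_fourier_swap[OF that ps] p(2)[of 0] by (simp add: c_def mult.commute)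
  have inv: "fourier (fourier f) x = c * f (- x)" if f: "f \<in> schwartz" for f and x :: 'a
  proof -
    \<comment> \<open>Translation reduces inversion at x to the proportionality at the
      origin.\<close>
    have "fourier (\<lambda>u. f (u + (- x))) y = fourier f y * wave (y \<bullet> x)" for y
      using fourier_affine[OF schwartz_integrable[OF f], of 1 "- x" y]
      by (simp add: inner_commute mult.commute)
    then have "fourier (fourier f) x = (LINT y|lborel. fourier (\<lambda>u. f (u + (- x))) y)"
      by (simp add: fourier_wave[of "fourier f"])
    also have "\<dots> = c * f (- x)"
      using c0[OF schwartz_affine[OF f, of 1 "- x"]] by simp
    finally show ?thesis .
  qed
  have "c \<noteq> 0"
  proof
    assume c: "c = 0"
    \<comment> \<open>Since p is real, reflecting it conjugates its transform; the product of the
      two transforms is then a squared modulus.\<close>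
    define q where "q = (\<lambda>x. p (- x))"
    have qs: "q \<in> schwartz" using schwartz_affine[OF ps, of "-1" 0] by (simp add: q_def)
    have "fourier q y = cnj (fourier p y)" for y
    proof -
      have "cnj (fourier p y) = (LINT x|lborel. cnj (p x * wave (x \<bullet> y)))"
        unfolding fourier_wave by (rule Bochner_Integration.integral_cnj[symmetric])
      also have "\<dots> = (LINT x|lborel. p x * wave (x \<bullet> (- y)))"
      proof (rule Bochner_Integration.integral_cong)
        fix x
        have "cnj (p x) = p x" by (subst (1 2) p(3)) simp
        then show "cnj (p x * wave (x \<bullet> y)) = p x * wave (x \<bullet> (- y))" by (simp add: cnj_wave)
      qed simp
      also have "\<dots> = fourier p (- y)" by (simp add: fourier_wave)
      also have "\<dots> = fourier q y"
        using fourier_affine[OF schwartz_integrable[OF ps], of "-1" 0 y] by (simp add: q_def)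
      finally show ?thesis by simp
    qed
    then have "of_real ((norm (fourier p y))\<^sup>2) = fourier p y * fourier q y" for y
      by (simp only: complex_norm_square)
    then have "of_real (LINT y|lborel. (norm (fourier p y))\<^sup>2) = (LINT y|lborel. fourier p y * fourier q y)"
      by (simp flip: integral_complex_of_real)
    also have "\<dots> = (LINT x|lborel. p x * fourier (fourier q) x)"
      by (rule parseval[OF ps schwartz_fourier[OF qs]])
    also have "\<dots> = 0" using inv[OF qs] c by simp
    finally have z: "(LINT y|lborel. (norm (fourier p y))\<^sup>2) = 0" by (simp only: of_real_eq_0_iff)
    have "integrable lborel (\<lambda>y. norm (fourier p y * fourier q y))"
      by (intro integrable_norm integrable_schwartz_mult schwartz_fourier ps qs)
    then have int: "integrable lborel (\<lambda>y. (norm (fourier p y))\<^sup>2)"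
      using \<open>\<And>y. fourier q y = cnj (fourier p y)\<close> by (simp add: norm_mult power2_eq_square)
    have cont: "isCont (fourier p) 0"
      using schwartz_continuous[OF schwartz_fourier[OF ps], of UNIV] by (simp add: continuous_on_eq_continuous_at)
    have "(norm (fourier p 0))\<^sup>2 = 0"
      by (rule integral_nonneg_zero[OF int _ z]) (auto intro!: continuous_intros cont)
    \<comment> \<open>The transform at 0 is the integral of p, which cannot vanish for a nonnegative
      continuous p with p 0 = 1.\<close>
    then have "(LINT x|lborel. p x) = 0" by (simp add: fourier_wave)
    moreover have "(LINT x|lborel. p x) = (LINT x|lborel. of_real (Re (p x)))"
      by (rule Bochner_Integration.integral_cong) (use p(3) in auto)
    then have "(LINT x|lborel. p x) = of_real (LINT x|lborel. Re (p x))"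
      by (simp only: integral_complex_of_real)
    ultimately have z: "(LINT x|lborel. Re (p x)) = 0" by simp
    have "isCont p 0"
      using schwartz_continuous[OF ps, of UNIV] by (simp add: continuous_on_eq_continuous_at)
    then have "isCont (\<lambda>x. Re (p x)) 0" by (simp add: continuous_Re)
    then have "Re (p 0) = 0"
      by (intro integral_nonneg_zero[OF _ _ z] integrable_Re schwartz_integrable ps p)
    then show False using p(2)[of 0] by simp
  qed
  then show ?thesis using that inv by blast
qed

section \<open>Cutoffs\<close>

text \<open>Modelled on a widening cutoff minus 1, which tends to 0 at each point but neither
  uniformly nor with decay. A bound uniform in n for each derivative is what dominated convergence
  asks for once a Schwartz factor is present.\<close>

definition vanishing :: "(nat \<Rightarrow> 'a::euclidean_space \<Rightarrow> complex) \<Rightarrow> bool" where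
  "vanishing a \<longleftrightarrow> (\<forall>bs. set bs \<subseteq> Basis \<longrightarrow>
     (\<forall>n. partials bs (a n) differentiable_on UNIV) \<and>
     (\<exists>C. \<forall>n x. norm (partials bs (a n) x) \<le> C) \<and>
     (\<forall>x. (\<lambda>n. partials bs (a n) x) \<longlonglongrightarrow> 0))"

lemma vanishingD:
  assumes "vanishing a"
  shows "a n \<in> multipliers" "\<exists>C. \<forall>n x. norm (a n x) \<le> C" "(\<lambda>n. a n x) \<longlonglongrightarrow> 0"
proof -
  have *: "(\<forall>n. partials [] (a n) differentiable_on UNIV) \<and>
     (\<exists>C. \<forall>n x. norm (partials [] (a n) x) \<le> C) \<and>
     (\<forall>x. (\<lambda>n. partials [] (a n) x) \<longlonglongrightarrow> 0)"
    using assms unfolding vanishing_def by (rule allE[of _ "[]"]) simp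
  then show "\<exists>C. \<forall>n x. norm (a n x) \<le> C" "(\<lambda>n. a n x) \<longlonglongrightarrow> 0" by auto
  have "moderate (partials bs (a n))" if bs: "set bs \<subseteq> Basis" for bs
  proof -
    obtain C where "\<forall>n x. norm (partials bs (a n) x) \<le> C"
      using assms bs unfolding vanishing_def by blast
    then show ?thesis unfolding moderate_def by (intro exI[of _ C] exI[of _ 0]) simp
  qed
  then show "a n \<in> multipliers"
    using assms by (simp add: multipliers_def smooth_def vanishing_def)
qed

lemma vanishing_pd:
  assumes a: "vanishing a" and b: "b \<in> Basis" shows "vanishing (\<lambda>n. pd b (a n))"
  unfolding vanishing_def
proof (intro allI impI)
  fix bs :: "'a list" assume "set bs \<subseteq> Basis"
  then have "set (bs @ [b]) \<subseteq> Basis" using b by simp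
  with a have "(\<forall>n. partials (bs @ [b]) (a n) differentiable_on UNIV) \<and>
     (\<exists>C. \<forall>n x. norm (partials (bs @ [b]) (a n) x) \<le> C) \<and>
     (\<forall>x. (\<lambda>n. partials (bs @ [b]) (a n) x) \<longlonglongrightarrow> 0)"
    unfolding vanishing_def by blast
  then show "(\<forall>n. partials bs (pd b (a n)) differentiable_on UNIV) \<and>
     (\<exists>C. \<forall>n x. norm (partials bs (pd b (a n)) x) \<le> C) \<and>
     (\<forall>x. (\<lambda>n. partials bs (pd b (a n)) x) \<longlonglongrightarrow> 0)"
    by (simp add: partials_append)
qed

text \<open>Sums are included so that the product rule stays inside the class. Closure under
  \<open>pd\<close> and \<open>mulx\<close> lets one L1 limit control every seminorm of the
  transforms.\<close>

inductive_set null_hull :: "(nat \<Rightarrow> 'a::euclidean_space \<Rightarrow> complex) set" where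
  base: "vanishing a \<Longrightarrow> f \<in> schwartz \<Longrightarrow> (\<lambda>n x. a n x * f x) \<in> null_hull"
| add: "g \<in> null_hull \<Longrightarrow> h \<in> null_hull \<Longrightarrow> (\<lambda>n x. g n x + h n x) \<in> null_hull"

lemma null_hull_schwartz: "h \<in> null_hull \<Longrightarrow> h n \<in> schwartz"
proof (induction rule: null_hull.induct)
  case (base a f)
  then show ?case using schwartz_mult[OF vanishingD(1)] by blast
next
  case (add g h)
  then show ?case using schwartz_add by blast
qed

lemma null_hull_pd: "h \<in> null_hull \<Longrightarrow> b \<in> Basis \<Longrightarrow> (\<lambda>n. pd b (h n)) \<in> null_hull"
proof (induction rule: null_hull.induct)
  case (base a f)
  have "a n differentiable_on UNIV" for n
    using vanishingD(1)[OF base(1), of n] by (simp add: multipliers_def smooth_differentiable)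
  then have "(\<lambda>n. pd b (\<lambda>x. a n x * f x)) = (\<lambda>n x. a n x * pd b f x + pd b (a n) x * f x)"
    using base by (simp add: pd_mult schwartz_differentiable)
  moreover have "\<dots> \<in> null_hull"
    by (rule null_hull.add[OF null_hull.base[OF base(1) schwartz_pd[OF base(2,3)]]
      null_hull.base[OF vanishing_pd[OF base(1,3)] base(2)]])
  ultimately show ?case by simp
next
  case (add g h)
  have "(\<lambda>n. pd b (\<lambda>x. g n x + h n x)) = (\<lambda>n x. pd b (g n) x + pd b (h n) x)"
    using add by (simp add: pd_add schwartz_differentiable null_hull_schwartz)
  then show ?case using null_hull.add[OF add.IH[OF add.prems]] by simp
qed

lemma null_hull_mulx: "h \<in> null_hull \<Longrightarrow> (\<lambda>n. mulx v (h n)) \<in> null_hull"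
proof (induction rule: null_hull.induct)
  case (base a f)
  have "(\<lambda>n. mulx v (\<lambda>x. a n x * f x)) = (\<lambda>n x. a n x * mulx v f x)"
    by (simp add: mulx_def fun_eq_iff mult_ac)
  then show ?case using null_hull.base[OF base(1) schwartz_mulx[OF base(2)]] by simp
next
  case (add g h)
  have "(\<lambda>n. mulx v (\<lambda>x. g n x + h n x)) = (\<lambda>n x. mulx v (g n) x + mulx v (h n) x)"
    by (simp add: mulx_def fun_eq_iff algebra_simps)
  then show ?case using null_hull.add[OF add.IH] by simp
qed

lemma null_hull_foldr_mulx: "h \<in> null_hull \<Longrightarrow> (\<lambda>n. foldr mulx bs (h n)) \<in> null_hull"
  by (induction bs) (auto intro: null_hull_mulx)

text \<open>The uniform bound times |f| dominates each product; a sum is handled by the triangle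
  inequality.\<close>

lemma null_hull_L1: "h \<in> null_hull \<Longrightarrow> (\<lambda>n. LINT x|lborel. norm (h n x)) \<longlonglongrightarrow> 0"
proof (induction rule: null_hull.induct)
  case (base a f)
  obtain C where C: "\<And>n x. norm (a n x) \<le> C" using vanishingD(2)[OF base(1)] by blast
  have "(\<lambda>n. LINT x|lborel. norm (a n x * f x)) \<longlonglongrightarrow> integral\<^sup>L lborel (\<lambda>x::'a. 0::real)"
  proof (rule integral_dominated_convergence)
    show "integrable lborel (\<lambda>x. C * norm (f x))"
      by (intro integrable_mult_right integrable_norm schwartz_integrable base)
    show "AE x in lborel. norm (norm (a n x * f x)) \<le> C * norm (f x)" for n
      by (intro AE_I2) (simp add: norm_mult mult_right_mono C)
    show "(\<lambda>x. norm (a n x * f x)) \<in> borel_measurable lborel" for n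
      by (intro borel_measurable_integrable integrable_norm schwartz_integrable
         schwartz_mult[OF vanishingD(1)] base)
    show "AE x in lborel. (\<lambda>n. norm (a n x * f x)) \<longlonglongrightarrow> 0"
      by (intro AE_I2 tendsto_norm_zero tendsto_mult_left_zero vanishingD(3) base)
  qed simp
  then show ?case by simp
next
  case (add g h)
  have int: "integrable lborel (g n)" "integrable lborel (h n)" for n
    using add by (simp_all add: null_hull_schwartz schwartz_integrable)
  have "(\<lambda>n. (LINT x|lborel. norm (g n x)) + (LINT x|lborel. norm (h n x))) \<longlonglongrightarrow> 0 + 0"
    by (intro tendsto_add add.IH)
  then have 0: "(\<lambda>n. (LINT x|lborel. norm (g n x)) + (LINT x|lborel. norm (h n x))) \<longlonglongrightarrow> 0" by simp
  show ?case
  proof (rule tendsto_sandwich[OF _ _ tendsto_const 0]; intro always_eventually allI)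
    fix n
    show "0 \<le> (LINT x|lborel. norm (g n x + h n x))" by simp
    have "(LINT x|lborel. norm (g n x + h n x)) \<le> (LINT x|lborel. norm (g n x) + norm (h n x))"
      by (intro integral_mono integrable_norm Bochner_Integration.integrable_add int norm_triangle_ineq)
    then show "(LINT x|lborel. norm (g n x + h n x)) \<le>
       (LINT x|lborel. norm (g n x)) + (LINT x|lborel. norm (h n x))"
      using int by simp
  qed
qed

lemma null_hull_deriv_L1: "h \<in> null_hull \<Longrightarrow> (\<lambda>n. deriv_L1 k (h n)) \<longlonglongrightarrow> 0"
proof (induction k arbitrary: h)
  case 0
  then show ?case by (simp add: null_hull_L1)
next
  case (Suc k)
  have "(\<lambda>n. deriv_L1 k (h n) + (\<Sum>b\<in>Basis. deriv_L1 k (pd b (h n)))) \<longlonglongrightarrow> 0 + (\<Sum>b\<in>(Basis::'a set). 0)"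
    by (intro tendsto_add tendsto_sum Suc.IH Suc.prems null_hull_pd)
  then show ?case by simp
qed

section \<open>Temperate functionals along cutoffs\<close>

lemma schwartz_norm_le:
  assumes "\<And>bs x. set bs \<subseteq> Basis \<Longrightarrow> length bs \<le> k \<Longrightarrow> (1 + norm x) ^ k * norm (partials bs f x) \<le> B"
  shows "schwartz_norm k f \<le> B"
  unfolding schwartz_norm_def
proof (rule cSUP_least)
  have "([], 0) \<in> {bs. set bs \<subseteq> Basis \<and> length bs \<le> k} \<times> UNIV" by simp
  then show "{bs. set bs \<subseteq> Basis \<and> length bs \<le> k} \<times> UNIV \<noteq> {}" by blast
qed (use assms in auto)

text \<open>Measuring the transforms instead of the functions is the point: a weighted derivative of
  the transform is bounded by L1 norms, for which pointwise dominated convergence is enough. Only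
  finitely many multi-indices have length at most k, so their bounds may be added.\<close>

lemma null_hull_fourier_norm:
  assumes "h \<in> null_hull" "d > 0"
  shows "eventually (\<lambda>n. schwartz_norm k (fourier (h n)) < d) sequentially"
proof -
  define S where "S = {bs :: 'a list. set bs \<subseteq> Basis \<and> length bs \<le> k}"
  have fin: "finite S" unfolding S_def by (rule finite_lists_length_le) simp
  have hs: "foldr mulx bs (h n) \<in> schwartz" for bs n
    using assms by (simp add: null_hull_schwartz schwartz_foldr_mulx)
  have nn: "deriv_L1 k (foldr mulx bs (h n)) \<ge> 0" for bs n
    using fourier_decay[OF hs, of 0 k bs n] by (smt (verit) mult_nonneg_nonneg norm_ge_zero zero_le_power)
  have "(\<lambda>n. \<Sum>bs\<in>S. deriv_L1 k (foldr mulx bs (h n))) \<longlonglongrightarrow> (\<Sum>bs\<in>S. 0)"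
    by (intro tendsto_sum null_hull_deriv_L1 null_hull_foldr_mulx assms)
  then have "eventually (\<lambda>n. (\<Sum>bs\<in>S. deriv_L1 k (foldr mulx bs (h n))) < d) sequentially"
    using assms(2) by (auto intro: order_tendstoD)
  then show ?thesis
  proof eventually_elim
    case (elim n)
    have "schwartz_norm k (fourier (h n)) \<le> (\<Sum>bs\<in>S. deriv_L1 k (foldr mulx bs (h n)))"
    proof (rule schwartz_norm_le)
      fix bs :: "'a list" and y :: 'a assume bs: "set bs \<subseteq> Basis" "length bs \<le> k"
      have "(1 + norm y) ^ k * norm (partials bs (fourier (h n)) y) \<le> deriv_L1 k (foldr mulx bs (h n))"
        using assms by (simp add: partials_fourier null_hull_schwartz fourier_decay[OF hs])
      also have "\<dots> \<le> (\<Sum>bs\<in>S. deriv_L1 k (foldr mulx bs (h n)))"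
        using bs by (intro member_le_sum nn fin) (auto simp: S_def)
      finally show "(1 + norm y) ^ k * norm (partials bs (fourier (h n)) y) \<le>
          (\<Sum>bs\<in>S. deriv_L1 k (foldr mulx bs (h n)))" .
    qed
    then show ?case using elim by linarith
  qed
qed

lemma temperate_cmult: "temperate T \<Longrightarrow> f \<in> schwartz \<Longrightarrow> T (\<lambda>x. c * f x) = c * T f"
  by (simp add: temperate_def)

lemma temperate_null_hull:
  assumes T: "temperate T" and h: "h \<in> null_hull"
  shows "(\<lambda>n. T (fourier (h n))) \<longlonglongrightarrow> 0"
proof (rule tendstoI)
  fix e :: real assume "e > 0"
  then obtain k d where d: "d > 0" "\<And>f. f \<in> schwartz \<Longrightarrow> schwartz_norm k f < d \<Longrightarrow> norm (T f) < e"
    using T unfolding temperate_def by meson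
  from null_hull_fourier_norm[OF h d(1), of k]
  show "eventually (\<lambda>n. dist (T (fourier (h n))) 0 < e) sequentially"
    by eventually_elim (use d(2) h in \<open>auto simp: null_hull_schwartz schwartz_fourier\<close>)
qed

lemma partials_add_const:
  assumes "smooth f" "set bs \<subseteq> Basis" "bs \<noteq> []"
  shows "partials bs (\<lambda>x. f x + c) = partials bs f"
  using assms(2,3)
proof (induction bs)
  case (Cons b bs)
  then show ?case
    by (cases "bs = []") (auto simp: pd_add smooth_differentiable assms(1))
qed simp

text \<open>At order zero, each point eventually lies where the dilated cutoff is 1. At positive
  order the constant -1 disappears and the chain rule contributes at least one factor
  1/(n+1).\<close>

lemma vanishing_cutoff:
  assumes \<theta>: "\<theta> \<in> test_functions" and one: "\<And>x. norm x \<le> 1 \<Longrightarrow> \<theta> x = 1"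
  shows "vanishing (\<lambda>n x. \<theta> (inverse (real (Suc n)) *\<^sub>R x) + (-1))"
  unfolding vanishing_def
proof (intro allI impI)
  fix bs :: "'a list" assume bs: "set bs \<subseteq> Basis"
  define s where "s n = inverse (real (Suc n))" for n
  have s: "0 < s n" "s n \<le> 1" for n by (auto simp: s_def field_simps)
  let ?a = "\<lambda>n x. \<theta> (s n *\<^sub>R x) + (-1)"
  let ?Q = "\<lambda>a. (\<forall>n. partials bs (a n) differentiable_on UNIV) \<and>
     (\<exists>C. \<forall>n x. norm (partials bs (a n) x) \<le> C) \<and> (\<forall>x. (\<lambda>n. partials bs (a n) x) \<longlonglongrightarrow> 0)"
  have sm: "smooth (\<lambda>x. \<theta> (s n *\<^sub>R x))" for n
    using smooth_affine[OF test_smooth[OF \<theta>], of "s n" 0] by simp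
  then have "smooth (?a n)" for n by (rule smooth_add) simp
  then have 1: "partials bs (?a n) differentiable_on UNIV" for n
    using bs by (simp add: smooth_def)
  obtain C where C: "\<And>x. norm (partials bs \<theta> x) \<le> C" "C \<ge> 0"
    using schwartz_bounded[OF test_schwartz[OF partials_test[OF \<theta> bs]]] by metis
  have nil: "?Q ?a" if "bs = []"
  proof -
    have "norm (?a n x) \<le> C + 1" for n x
      using norm_triangle_ineq[of "\<theta> (s n *\<^sub>R x)" "-1"] C(1)[of "s n *\<^sub>R x"] that by simp
    moreover have "(\<lambda>n. ?a n x) \<longlonglongrightarrow> 0" for x
    proof (rule tendsto_eventually)
      have "eventually (\<lambda>n. n \<ge> nat \<lceil>norm x\<rceil>) sequentially" by (rule eventually_ge_at_top)
      then show "eventually (\<lambda>n. ?a n x = 0) sequentially"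
      proof eventually_elim
        case (elim n)
        then have "norm x \<le> real (Suc n)" by linarith
        then have "norm (s n *\<^sub>R x) \<le> 1" by (simp add: s_def field_simps)
        then show ?case using one by simp
      qed
    qed
    ultimately show "?Q ?a" using 1 that by auto
  qed
  have cons: "?Q ?a" if ne: "bs \<noteq> []"
  proof -
    have p: "partials bs (?a n) = (\<lambda>x. s n ^ length bs *\<^sub>R partials bs \<theta> (s n *\<^sub>R x))" for n
      unfolding partials_add_const[OF sm bs ne]
      using partials_affine[OF test_smooth[OF \<theta>] bs, of "s n" 0] by simp
    have le: "norm (partials bs (?a n) x) \<le> s n * C" for n x
    proof -
      have "s n ^ length bs \<le> s n ^ 1"
        using s[of n] ne by (intro power_decreasing) (auto simp: Suc_le_eq)
      then show ?thesis unfolding p using s[of n] C by (simp add: mult_mono)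
    qed
    have "norm (partials bs (?a n) x) \<le> C" for n x
      using le[of n x] mult_right_mono[OF s(2)[of n] C(2)] by linarith
    moreover have "(\<lambda>n. partials bs (?a n) x) \<longlonglongrightarrow> 0" for x
    proof (rule Lim_null_comparison[OF always_eventually])
      show "\<forall>n. norm (partials bs (?a n) x) \<le> s n * C" using le by blast
      show "(\<lambda>n. s n * C) \<longlonglongrightarrow> 0"
        unfolding s_def by (intro tendsto_mult_left_zero LIMSEQ_inverse_real_of_nat)
    qed
    ultimately show "?Q ?a" using 1 by blast
  qed
  have "?Q ?a" using nil cons by blast
  then show "?Q (\<lambda>n x. \<theta> (inverse (real (Suc n)) *\<^sub>R x) + (-1))" unfolding s_def .
qed

text \<open>This carries identities known for test functions on the Fourier side over to all
  Schwartz functions.\<close>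

lemma temperate_fourier_cutoff:
  assumes T: "temperate T" and \<theta>: "\<theta> \<in> test_functions" and one: "\<And>x. norm x \<le> 1 \<Longrightarrow> \<theta> x = 1"
    and f: "f \<in> schwartz"
  shows "(\<lambda>n. T (fourier (\<lambda>x. \<theta> (inverse (real (Suc n)) *\<^sub>R x) * f x))) \<longlonglongrightarrow> T (fourier f)"
proof -
  define h where "h n x = (\<theta> (inverse (real (Suc n)) *\<^sub>R x) + (-1)) * f x" for n x
  have h: "h \<in> null_hull"
    unfolding h_def by (rule null_hull.base[OF vanishing_cutoff[OF \<theta> one] f])
  have hs: "h n \<in> schwartz" for n by (rule null_hull_schwartz[OF h])
  have "T (fourier (\<lambda>x. \<theta> (inverse (real (Suc n)) *\<^sub>R x) * f x)) = T (fourier (h n)) + T (fourier f)" for n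
  proof -
    have "(\<lambda>x. \<theta> (inverse (real (Suc n)) *\<^sub>R x) * f x) = (\<lambda>x. h n x + f x)"
      by (simp add: h_def algebra_simps)
    then have "fourier (\<lambda>x. \<theta> (inverse (real (Suc n)) *\<^sub>R x) * f x) = (\<lambda>y. fourier (h n) y + fourier f y)"
      using fourier_add[OF hs f] by (simp add: fun_eq_iff)
    then show ?thesis
      using T schwartz_fourier[OF hs] schwartz_fourier[OF f] unfolding temperate_def by metis
  qed
  then show ?thesis
    using tendsto_add[OF temperate_null_hull[OF T h] tendsto_const[of "T (fourier f)"]] by simp
qed

lemma partials_cmult:
  assumes "smooth f" "set bs \<subseteq> Basis"
  shows "partials bs (\<lambda>x. c * f x) = (\<lambda>x. c * partials bs f x)"
  using assms(2)
proof (induction bs)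
  case (Cons b bs)
  then have "partials bs f differentiable_on UNIV" using assms(1) by (simp add: smooth_def)
  then show ?case using Cons by (simp add: pd_mult)
qed simp

text \<open>Continuity at zero involves a single seminorm of some index k. Dilation by n + 1 only
  shrinks derivatives, while the weight grows by at most (n+1)^k; rescaling into the neighbourhood
  of zero turns this into polynomial growth.\<close>

lemma temperate_cutoff_growth:
  assumes T: "temperate T" and \<theta>: "\<theta> \<in> test_functions"
  shows "\<exists>C k. \<forall>n. norm (T (\<lambda>x. \<theta> (inverse (real (Suc n)) *\<^sub>R x))) \<le> C * real (Suc n) ^ k"
proof -
  obtain k d where d: "d > 0" "\<And>f. f \<in> schwartz \<Longrightarrow> schwartz_norm k f < d \<Longrightarrow> norm (T f) < 1"
    using T zero_less_one unfolding temperate_def by meson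
  define S where "S = {bs :: 'a list. set bs \<subseteq> Basis \<and> length bs \<le> k}"
  have fin: "finite S" unfolding S_def by (rule finite_lists_length_le) simp
  have "\<forall>bs\<in>S. \<exists>C. \<forall>x. (1 + norm x) ^ k * norm (partials bs \<theta> x) \<le> C"
    using schwartz_decays[OF test_schwartz[OF partials_test[OF \<theta>]]] by (auto simp: S_def decays_def)
  then obtain B where B: "\<And>bs x. bs \<in> S \<Longrightarrow> (1 + norm x) ^ k * norm (partials bs \<theta> x) \<le> B bs"
    by metis
  \<comment> \<open>The summand 1 makes K positive, as it will stand in a denominator.\<close>
  define K where "K = 1 + (\<Sum>bs\<in>S. \<bar>B bs\<bar>)"
  have K: "B bs \<le> K" if "bs \<in> S" for bs
    using member_le_sum[OF that, of "\<lambda>bs. \<bar>B bs\<bar>"] fin by (simp add: K_def)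
  have K0: "K > 0" by (simp add: K_def add_pos_nonneg sum_nonneg)
  \<comment> \<open>The factor 2 makes the seminorm of the rescaled function at most d / 2, hence
    strictly below d.\<close>
  define c where "c n = d / (2 * K * real (Suc n) ^ k)" for n
  have c0: "c n > 0" for n using d K0 by (simp add: c_def)
  let ?f = "\<lambda>n x. \<theta> (inverse (real (Suc n)) *\<^sub>R x)"
  have fs: "?f n \<in> schwartz" for n
    using test_schwartz[OF test_affine[OF \<theta>, of "inverse (real (Suc n))" 0]] by simp
  have "schwartz_norm k (\<lambda>x. of_real (c n) * ?f n x) \<le> c n * (K * real (Suc n) ^ k)" for n
  proof (rule schwartz_norm_le)
    fix bs :: "'a list" and x :: 'a assume bs: "set bs \<subseteq> Basis" "length bs \<le> k"
    define u where "u = inverse (real (Suc n)) *\<^sub>R x"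
    have "1 + norm x \<le> real (Suc n) * (1 + norm u)"
    proof -
      have "norm x = real (Suc n) * norm u" by (simp add: u_def del: of_nat_Suc)
      then show ?thesis by (simp add: algebra_simps)
    qed
    then have "(1 + norm x) ^ k \<le> (real (Suc n) * (1 + norm u)) ^ k"
      by (rule power_mono) simp
    then have 1: "(1 + norm x) ^ k \<le> real (Suc n) ^ k * (1 + norm u) ^ k"
      by (simp only: power_mult_distrib)
    have "partials bs (?f n) x = inverse (real (Suc n)) ^ length bs *\<^sub>R partials bs \<theta> u"
      using partials_affine[OF test_smooth[OF \<theta>] bs(1), of "inverse (real (Suc n))" 0] by (simp add: u_def)
    then have "norm (partials bs (?f n) x) \<le> norm (partials bs \<theta> u)"
    proof -
      have "inverse (real (Suc n)) ^ length bs \<le> 1" by (intro power_le_one) (auto simp: field_simps)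
      then have "inverse (real (Suc n)) ^ length bs * norm (partials bs \<theta> u) \<le> 1 * norm (partials bs \<theta> u)"
        by (rule mult_right_mono) simp
      with \<open>partials bs (?f n) x = _\<close> show ?thesis by simp
    qed
    with 1 have "(1 + norm x) ^ k * norm (partials bs (?f n) x) \<le>
        (real (Suc n) ^ k * (1 + norm u) ^ k) * norm (partials bs \<theta> u)"
      by (intro mult_mono) auto
    also have "\<dots> = ((1 + norm u) ^ k * norm (partials bs \<theta> u)) * real (Suc n) ^ k" by (simp add: mult_ac)
    also have "\<dots> \<le> K * real (Suc n) ^ k"
      using B[of bs u] K[of bs] bs by (intro mult_right_mono) (auto simp: S_def)
    finally have "c n * ((1 + norm x) ^ k * norm (partials bs (?f n) x)) \<le> c n * (K * real (Suc n) ^ k)"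
      using c0[of n] by (intro mult_left_mono) auto
    then show "(1 + norm x) ^ k * norm (partials bs (\<lambda>x. of_real (c n) * ?f n x) x) \<le> c n * (K * real (Suc n) ^ k)"
      using c0[of n] unfolding partials_cmult[OF schwartz_smooth[OF fs] bs(1)]
      by (simp add: norm_mult mult_ac)
  qed
  moreover have "c n * (K * real (Suc n) ^ k) < d" for n
    using K0 d(1) by (simp add: c_def)
  ultimately have "schwartz_norm k (\<lambda>x. of_real (c n) * ?f n x) < d" for n
    by (rule le_less_trans)
  then have "norm (T (\<lambda>x. of_real (c n) * ?f n x)) < 1" for n
    by (rule d(2)[OF schwartz_cmult[OF fs]])
  moreover have "T (\<lambda>x. of_real (c n) * ?f n x) = of_real (c n) * T (?f n)" for n
    by (rule temperate_cmult[OF T fs])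
  ultimately have *: "\<bar>c n\<bar> * norm (T (?f n)) < 1" for n
    by (simp add: norm_mult)
  have "norm (T (?f n)) < 1 / c n" for n
    using *[of n] c0[of n] by (simp add: pos_less_divide_eq mult.commute)
  then have "norm (T (?f n)) \<le> 1 / c n" for n
    by (rule less_imp_le)
  then have "norm (T (?f n)) \<le> (2 * K / d) * real (Suc n) ^ k" for n
    by (simp add: c_def)
  then show ?thesis by blast
qed

section \<open>Sums of point masses\<close>

lemma bounded_borel_subset: "A \<in> bounded_borel \<Longrightarrow> B \<in> sets borel \<Longrightarrow> B \<subseteq> A \<Longrightarrow> B \<in> bounded_borel"
  unfolding bounded_borel_def using bounded_subset by auto

lemma finite_bounded_borel: "finite F \<Longrightarrow> F \<in> bounded_borel"
  by (simp add: bounded_borel_def finite_imp_bounded borel_closed finite_imp_closed)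

lemma cball_bounded_borel: "cball a r \<in> bounded_borel"
  by (simp add: bounded_borel_def)

text \<open>The supremum over bounded Borel sets is approached already by finite sets of points with
  positive mass, because L is exhausted by finite sets; conversely, every sum of masses over a
  subset of A is at most the sum of the positive ones. \<open>ennreal\<close> performs the
  truncation of negative masses.\<close>

lemma positive_variation_count_space:
  fixes \<sigma> :: "'a::euclidean_space set \<Rightarrow> real"
  assumes L: "countable L" and \<sigma>: "\<And>A. A \<in> bounded_borel \<Longrightarrow> (b has_sum \<sigma> A) (L \<inter> A)"
  shows "positive_variation \<sigma> = distr (density (count_space L) (\<lambda>x. ennreal (b x))) borel (\<lambda>x. x)"
    (is "_ = ?M")
proof -
  have "(SUP B \<in> {B \<in> bounded_borel. B \<subseteq> A}. ennreal (\<sigma> B)) = emeasure ?M A" if A: "A \<in> sets borel" for A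
  proof (rule antisym)
    have em: "emeasure ?M A = (\<integral>\<^sup>+x. ennreal (b x) * indicator A x \<partial>count_space L)"
      using A by (simp add: emeasure_distr emeasure_density indicator_def)
        (auto intro!: nn_integral_cong)
    show "(SUP B \<in> {B \<in> bounded_borel. B \<subseteq> A}. ennreal (\<sigma> B)) \<le> emeasure ?M A"
    proof (rule SUP_least, clarify)
      fix B assume B: "B \<in> bounded_borel" "B \<subseteq> A"
      show "ennreal (\<sigma> B) \<le> emeasure ?M A"
      proof (cases "emeasure ?M A")
        case (real s)
        have "\<sigma> B \<le> s"
        proof (rule has_sum_le_finite_sums[OF \<sigma>[OF B(1)]])
          fix F assume F: "finite F" "F \<subseteq> L \<inter> B"
          have "ennreal (sum b F) \<le> ennreal (\<Sum>x\<in>F. max 0 (b x))"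
            by (intro ennreal_leI sum_mono) auto
          also have "\<dots> = (\<Sum>x\<in>F. ennreal (max 0 (b x)))"
            by (rule sum_ennreal[symmetric]) simp
          also have "\<dots> = (\<Sum>x\<in>F. ennreal (b x))"
            by (intro sum.cong refl) (auto simp: max_def ennreal_neg)
          also have "\<dots> = (\<integral>\<^sup>+x. ennreal (b x) * indicator F x \<partial>count_space L)"
            using F by (subst nn_integral_count_space'[of F]) auto
          also have "\<dots> \<le> emeasure ?M A"
            unfolding em using F B by (intro nn_integral_mono) (auto split: split_indicator)
          finally show "sum b F \<le> s" using real by (simp add: ennreal_le_iff)
        qed
        then show ?thesis using real by (simp add: ennreal_leI)
      qed simp
    qed
    \<comment> \<open>An increasing exhaustion of L by finite sets, for monotone
      convergence.\<close>
    define F where "F m = {x \<in> L. to_nat_on L x < m}" for m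
    have finF: "finite (F m)" for m
    proof (rule inj_on_finite)
      show "inj_on (to_nat_on L) (F m)"
        using inj_on_to_nat_on[OF L] by (rule inj_on_subset) (auto simp: F_def)
      show "to_nat_on L ` F m \<subseteq> {..<m}" by (auto simp: F_def)
    qed simp
    have "emeasure ?M A = (\<integral>\<^sup>+x. (SUP m. ennreal (b x) * indicator (A \<inter> F m) x) \<partial>count_space L)"
      unfolding em
    proof (rule nn_integral_cong)
      fix x assume "x \<in> space (count_space L)"
      then have "x \<in> F (Suc (to_nat_on L x))" by (simp add: F_def)
      then have "ennreal (b x) * indicator A x = ennreal (b x) * indicator (A \<inter> F (Suc (to_nat_on L x))) x"
        by (simp split: split_indicator)
      also have "\<dots> \<le> (SUP m. ennreal (b x) * indicator (A \<inter> F m) x)"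
        by (rule SUP_upper) simp
      finally show "ennreal (b x) * indicator A x = (SUP m. ennreal (b x) * indicator (A \<inter> F m) x)"
        by (intro antisym SUP_least) (auto split: split_indicator)
    qed
    also have "\<dots> = (SUP m. \<integral>\<^sup>+x. ennreal (b x) * indicator (A \<inter> F m) x \<partial>count_space L)"
      by (rule nn_integral_monotone_convergence_SUP)
        (auto simp: incseq_def le_fun_def F_def split: split_indicator)
    also have "\<dots> \<le> (SUP B \<in> {B \<in> bounded_borel. B \<subseteq> A}. ennreal (\<sigma> B))"
    proof (rule SUP_least)
      fix m
      \<comment> \<open>Discarding nonpositive masses makes the value of \<sigma> equal to the
        truncated sum. G is finite, so it competes in the supremum.\<close>
      define G where "G = {x \<in> A \<inter> F m. b x > 0}"
      have "finite G" by (rule finite_subset[OF _ finF[of m]]) (auto simp: G_def)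
      moreover have "G \<subseteq> L" by (auto simp: G_def F_def)
      ultimately have G: "finite G" "G \<subseteq> L" by blast+
      have "(\<integral>\<^sup>+x. ennreal (b x) * indicator (A \<inter> F m) x \<partial>count_space L) = (\<Sum>x\<in>G. ennreal (b x))"
        using G by (subst nn_integral_count_space'[of G]) (auto simp: G_def ennreal_neg split: split_indicator)
      also have "\<dots> = ennreal (sum b G)"
        by (rule sum_ennreal) (auto simp: G_def)
      also have "sum b G = \<sigma> G"
      proof (rule has_sum_unique[OF has_sum_finite[OF G(1)]])
        show "(b has_sum \<sigma> G) G"
          using \<sigma>[OF finite_bounded_borel[OF G(1)]] G(2) by (simp add: Int_absorb1)
      qed
      also have "ennreal (\<sigma> G) \<le> (SUP B \<in> {B \<in> bounded_borel. B \<subseteq> A}. ennreal (\<sigma> B))"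
        using finite_bounded_borel[OF G(1)] by (intro SUP_upper) (auto simp: G_def)
      finally show "(\<integral>\<^sup>+x. ennreal (b x) * indicator (A \<inter> F m) x \<partial>count_space L)
          \<le> (SUP B \<in> {B \<in> bounded_borel. B \<subseteq> A}. ennreal (\<sigma> B))" .
    qed
    finally show "emeasure ?M A \<le> (SUP B \<in> {B \<in> bounded_borel. B \<subseteq> A}. ennreal (\<sigma> B))" .
  qed
  moreover have "sigma_sets UNIV (sets (borel :: 'a measure)) = sets borel"
    by (metis sets.sigma_sets_eq space_borel)
  ultimately have "positive_variation \<sigma> = measure_of UNIV (sets borel) (emeasure ?M)"
    unfolding positive_variation_def by (intro measure_of_eq) auto
  also have "\<dots> = ?M"
    using measure_of_of_measure[of ?M] by simp
  finally show ?thesis .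
qed

lemma integral_positive_variation:
  fixes \<sigma> :: "'a::euclidean_space set \<Rightarrow> real" and f :: "'a \<Rightarrow> complex"
  assumes L: "countable L" and \<sigma>: "\<And>A. A \<in> bounded_borel \<Longrightarrow> (b has_sum \<sigma> A) (L \<inter> A)"
    and f: "f \<in> borel_measurable borel"
  shows "(LINT x|positive_variation \<sigma>. f x) = (LINT x|count_space L. max 0 (b x) *\<^sub>R f x)"
proof -
  have eq: "(\<lambda>x. ennreal (b x)) = (\<lambda>x. ennreal (max 0 (b x)))"
    by (auto simp: fun_eq_iff max_def ennreal_neg)
  have pv: "positive_variation \<sigma> = distr (density (count_space L) (\<lambda>x. ennreal (b x))) borel (\<lambda>x. x)"
    using L \<sigma> by (rule positive_variation_count_space)
  show ?thesis
    unfolding pv eq using f by (subst integral_distr) (auto simp: integral_density)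
qed

text \<open>For complex families unordered summability is absolute summability.\<close>

lemma point_mass_abs_summable:
  assumes "is_point_mass_sum \<mu> L a" "A \<in> bounded_borel"
  shows "(\<lambda>x. norm (a x)) summable_on (L \<inter> A)"
  using assms summable_on_iff_abs_summable_on_complex
  unfolding is_point_mass_sum_def summable_on_def by metis

lemma integrable_point_mass:
  assumes \<mu>: "is_point_mass_sum \<mu> L a" and f: "f \<in> test_functions"
  shows "integrable (count_space L) (\<lambda>x. a x * f x)"
proof -
  obtain r where r: "\<And>x. norm x > r \<Longrightarrow> f x = 0" using test_functions_support[OF f] by auto
  obtain C where C: "\<And>x. norm (f x) \<le> C" "C \<ge> 0" using schwartz_bounded[OF test_schwartz[OF f]] by metis
  have "(\<lambda>x. norm (a x) * C) summable_on (L \<inter> cball 0 r)"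
    by (intro summable_on_cmult_left point_mass_abs_summable[OF \<mu>] cball_bounded_borel)
  then have "(\<lambda>x. norm (a x * f x)) summable_on (L \<inter> cball 0 r)"
    by (rule Infinite_Sum.abs_summable_on_comparison_test') (simp add: norm_mult mult_left_mono C)
  then have "(\<lambda>x. norm (a x * f x)) summable_on L"
    by (subst (asm) summable_on_cong_neutral[of L _ _ "\<lambda>x. norm (a x * f x)"]) (auto simp: r)
  then show ?thesis
    using abs_summable_equivalent unfolding Infinite_Set_Sum.abs_summable_on_def by blast
qed

text \<open>The Jordan parts recombine through max 0 t - max 0 (-t) = t. The integrals may be added
  because f confines them to a ball, on which the masses are absolutely summable.\<close>

lemma radon_integral_point_mass:
  assumes L: "countable L" and \<mu>: "is_point_mass_sum \<mu> L a" and f: "f \<in> test_functions"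
  shows "radon_integral \<mu> f = (LINT x|count_space L. a x * f x)"
proof -
  have int: "integrable (count_space L) (\<lambda>x. a x * f x)" by (rule integrable_point_mass[OF \<mu> f])
  have fm: "f \<in> borel_measurable borel" using schwartz_measurable[OF test_schwartz[OF f]] .
  have i: "integrable (count_space L) (\<lambda>x. max 0 (t (a x)) *\<^sub>R f x)" if t: "\<And>z. t z \<le> norm z" for t :: "complex \<Rightarrow> real"
    by (rule Bochner_Integration.integrable_bound[OF int])
      (auto simp: norm_mult intro!: mult_right_mono t)
  have re: "((\<lambda>x. Re (a x)) has_sum Re (\<mu> A)) (L \<inter> A)" "((\<lambda>x. Im (a x)) has_sum Im (\<mu> A)) (L \<inter> A)"
    "((\<lambda>x. - Re (a x)) has_sum - Re (\<mu> A)) (L \<inter> A)" "((\<lambda>x. - Im (a x)) has_sum - Im (\<mu> A)) (L \<inter> A)"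
    if "A \<in> bounded_borel" for A
    using \<mu> that unfolding is_point_mass_sum_def
    by (auto intro!: has_sum_Re has_sum_Im has_sum_uminusI)
  have b: "Re z \<le> norm z" "- Re z \<le> norm z" "Im z \<le> norm z" "- Im z \<le> norm z" for z
    using abs_Re_le_cmod[of z] abs_Im_le_cmod[of z] by linarith+
  have "radon_integral \<mu> f =
    ((LINT x|count_space L. max 0 (Re (a x)) *\<^sub>R f x) - (LINT x|count_space L. max 0 (- Re (a x)) *\<^sub>R f x)) +
     \<i> * ((LINT x|count_space L. max 0 (Im (a x)) *\<^sub>R f x) - (LINT x|count_space L. max 0 (- Im (a x)) *\<^sub>R f x))"
    unfolding radon_integral_def
    by (simp only: integral_positive_variation[OF L re(1) fm] integral_positive_variation[OF L re(2) fm]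
      integral_positive_variation[OF L re(3) fm] integral_positive_variation[OF L re(4) fm])
  also have "\<dots> = (LINT x|count_space L. (max 0 (Re (a x)) *\<^sub>R f x - max 0 (- Re (a x)) *\<^sub>R f x) +
      \<i> * (max 0 (Im (a x)) *\<^sub>R f x - max 0 (- Im (a x)) *\<^sub>R f x))"
    using i[of Re] i[of "\<lambda>z. - Re z"] i[of Im] i[of "\<lambda>z. - Im z"] b by simp
  also have "\<dots> = (LINT x|count_space L. a x * f x)"
  proof (rule Bochner_Integration.integral_cong)
    fix x
    have m: "max 0 t *\<^sub>R z - max 0 (- t) *\<^sub>R z = of_real t * z" for t :: real and z :: complex
      by (auto simp: max_def scaleR_conv_of_real)
    show "(max 0 (Re (a x)) *\<^sub>R f x - max 0 (- Re (a x)) *\<^sub>R f x) +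
      \<i> * (max 0 (Im (a x)) *\<^sub>R f x - max 0 (- Im (a x)) *\<^sub>R f x) = a x * f x"
      unfolding m by (subst complex_eq[of "a x"]) (simp add: algebra_simps)
  qed simp
  finally show ?thesis .
qed

lemma point_mass_finite:
  assumes "is_point_mass_sum \<mu> L a" "finite F" "F \<subseteq> L"
  shows "\<mu> F = sum a F"
  using assms finite_bounded_borel[OF assms(2)] has_sum_finite[OF assms(2), of a]
  unfolding is_point_mass_sum_def by (metis has_sum_unique inf.absorb2)

text \<open>The triangle inequality and additivity over a partition give the upper bound. For the
  lower bound, a finite set of atoms is split into singletons and the rest of A is one further
  block.\<close>

lemma total_variation_point_mass:
  assumes \<mu>: "is_point_mass_sum \<mu> L a"
  shows "is_point_mass_sum (total_variation \<mu>) L (\<lambda>x. of_real (norm (a x)))"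
  unfolding is_point_mass_sum_def
proof
  fix A :: "'a set" assume A: "A \<in> bounded_borel"
  let ?P = "{P. finite P \<and> P \<subseteq> sets borel \<and> partition_on A P}"
  let ?s = "\<lambda>B. infsum (\<lambda>x. norm (a x)) (L \<inter> B)"
  have sm: "(\<lambda>x. norm (a x)) summable_on (L \<inter> B)" if "B \<in> bounded_borel" for B
    by (rule point_mass_abs_summable[OF \<mu> that])
  have Bb: "B \<in> bounded_borel" if "P \<in> ?P" "B \<in> P" for P B
  proof (rule bounded_borel_subset[OF A])
    show "B \<in> sets borel" using that by auto
    show "B \<subseteq> A" using that by (auto simp: partition_on_def)
  qed
  have le: "(\<Sum>B\<in>P. norm (\<mu> B)) \<le> ?s A" if P: "P \<in> ?P" for P
  proof -
    have "(\<Sum>B\<in>P. norm (\<mu> B)) \<le> (\<Sum>B\<in>P. ?s B)"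
    proof (rule sum_mono)
      fix B assume "B \<in> P"
      then have B: "B \<in> bounded_borel" using Bb P by blast
      have "\<mu> B = infsum a (L \<inter> B)"
        using \<mu> B unfolding is_point_mass_sum_def by (metis infsumI)
      then show "norm (\<mu> B) \<le> ?s B"
        using norm_infsum_bound[OF sm[OF B]] by simp
    qed
    also have "\<dots> = ?s (\<Union>P)"
    proof -
      have "finite Q \<Longrightarrow> Q \<subseteq> P \<Longrightarrow> (\<Sum>B\<in>Q. ?s B) = ?s (\<Union>Q) \<and> \<Union>Q \<in> bounded_borel" for Q
      proof (induction Q rule: finite_induct)
        case empty
        then show ?case by (simp add: finite_bounded_borel)
      next
        case (insert B Q)
        have B: "B \<in> bounded_borel" using Bb P insert by blast
        have dj: "X \<inter> Y = {}" if "X \<in> P" "Y \<in> P" "X \<noteq> Y" for X Y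
          using P that by (auto simp: partition_on_def disjoint_def)
        have "B \<inter> X = {}" if "X \<in> Q" for X
        proof (rule dj)
          show "B \<in> P" "X \<in> P" using insert.prems that by auto
          show "B \<noteq> X" using insert.hyps that by auto
        qed
        then have disj: "B \<inter> \<Union>Q = {}" by blast
        have IH: "(\<Sum>B\<in>Q. ?s B) = ?s (\<Union>Q)" "\<Union>Q \<in> bounded_borel"
          using insert.IH insert.prems by auto
        have "?s (B \<union> \<Union>Q) = ?s B + ?s (\<Union>Q)"
          unfolding Int_Un_distrib
          by (rule infsum_Un_disjoint[OF sm[OF B] sm[OF IH(2)]]) (use disj in blast)
        moreover have "B \<union> \<Union>Q \<in> bounded_borel" using B IH(2) by (auto simp: bounded_borel_def)
        ultimately show ?case using insert.hyps IH(1) by simp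
      qed
      then show ?thesis using P by blast
    qed
    also have "\<Union>P = A" using P by (auto simp: partition_on_def)
    finally show ?thesis .
  qed
  have ge: "?s A \<le> (SUP P\<in>?P. \<Sum>B\<in>P. norm (\<mu> B))"
  proof (rule has_sum_le_finite_sums[OF has_sum_infsum[OF sm[OF A]]])
    fix F assume F: "finite F" "F \<subseteq> L \<inter> A"
    \<comment> \<open>A - F may be empty, and a partition must not contain the empty set.\<close>
    define P where "P = insert (A - F) ((\<lambda>x. {x}) ` F) - {{}}"
    have "A - F \<in> sets borel"
      using A finite_bounded_borel[OF F(1)] by (intro sets.Diff) (simp_all add: bounded_borel_def)
    moreover have "{x} \<in> sets borel" for x :: 'a by simp
    ultimately have Ps: "P \<subseteq> sets borel" unfolding P_def by blast
    have "partition_on A P"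
    proof (rule partition_onI)
      have "\<Union>(S - {{}}) = \<Union>S" for S :: "'a set set" by blast
      then have "\<Union>P = (A - F) \<union> (\<Union>x\<in>F. {x})" by (simp only: P_def Union_insert)
      also have "\<dots> = A" using F(2) by auto
      finally show "\<Union>P = A" .
      fix X Y assume "X \<in> P" "Y \<in> P" "X \<noteq> Y"
      then consider "X = A - F" "\<exists>y\<in>F. Y = {y}" | "Y = A - F" "\<exists>x\<in>F. X = {x}"
        | "\<exists>x\<in>F. X = {x}" "\<exists>y\<in>F. Y = {y}"
        unfolding P_def by blast
      then show "disjnt X Y" using \<open>X \<noteq> Y\<close> by cases (auto simp: disjnt_def)
    next
      show "{} \<notin> P" by (simp add: P_def)
    qed
    moreover have "finite P" using F by (simp add: P_def)
    ultimately have P: "P \<in> ?P" using Ps by simp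
    have "(\<Sum>x\<in>F. norm (a x)) = (\<Sum>x\<in>F. norm (\<mu> {x}))"
      using F by (intro sum.cong refl) (subst point_mass_finite[OF \<mu>], auto)
    also have "\<dots> = (\<Sum>B\<in>(\<lambda>x. {x}) ` F. norm (\<mu> B))"
      by (subst sum.reindex) (auto simp: inj_on_def)
    also have "\<dots> \<le> (\<Sum>B\<in>P. norm (\<mu> B))"
      using P by (intro sum_mono2) (auto simp: P_def)
    also have "\<dots> \<le> (SUP P\<in>?P. \<Sum>B\<in>P. norm (\<mu> B))"
      using P le by (intro cSUP_upper bdd_aboveI2) auto
    finally show "(\<Sum>x\<in>F. norm (a x)) \<le> (SUP P\<in>?P. \<Sum>B\<in>P. norm (\<mu> B))" .
  qed
  \<comment> \<open>The one-block partition, or the empty partition if A is empty; it shows that the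
    supremum is over a nonempty set.\<close>
  have "{A} - {{}} \<in> ?P" using A by (auto simp: partition_on_def bounded_borel_def disjoint_def)
  then have "(SUP P\<in>?P. \<Sum>B\<in>P. norm (\<mu> B)) \<le> ?s A"
    by (intro cSUP_least le) auto
  then have "(SUP P\<in>?P. \<Sum>B\<in>P. norm (\<mu> B)) = ?s A"
    using ge by (rule antisym)
  then have "total_variation \<mu> A = of_real (?s A)"
    by (simp only: total_variation_def)
  then show "((\<lambda>x. complex_of_real (norm (a x))) has_sum total_variation \<mu> A) (L \<inter> A)"
    using has_sum_of_real[OF has_sum_infsum[OF sm[OF A]], where 'a=complex] by simp
qed

text \<open>Integrate against the variation a nonnegative bump that is 1 on the ball of radius n +
  1: the integral majorizes the masses there, and dilation bounds it polynomially.\<close>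

lemma temperate_measure_growth:
  fixes a :: "'a::euclidean_space \<Rightarrow> complex"
  assumes L: "countable L" and \<mu>: "is_point_mass_sum \<mu> L a" and t: "temperate_measure (total_variation \<mu>)"
  shows "\<exists>C k. \<forall>n F. finite F \<longrightarrow> F \<subseteq> L \<inter> cball 0 (real (Suc n)) \<longrightarrow> (\<Sum>x\<in>F. norm (a x)) \<le> C * real (Suc n) ^ k"
proof -
  obtain T where T: "temperate T" "extends_measure T (total_variation \<mu>)"
    using t unfolding temperate_measure_def by blast
  obtain p :: "'a \<Rightarrow> complex" where p: "p \<in> test_functions" "\<And>x. norm x \<le> 1 \<Longrightarrow> p x = 1"
    "\<And>x. p x = of_real (Re (p x))" "\<And>x. Re (p x) \<ge> 0"
    using exists_bump[of 1 2, where 'a='a] by auto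
  obtain C k where C: "\<And>n. norm (T (\<lambda>x. p (inverse (real (Suc n)) *\<^sub>R x))) \<le> C * real (Suc n) ^ k"
    using temperate_cutoff_growth[OF T(1) p(1)] by blast
  have "(\<Sum>x\<in>F. norm (a x)) \<le> C * real (Suc n) ^ k" if F: "finite F" "F \<subseteq> L \<inter> cball 0 (real (Suc n))" for n F
  proof -
    define q where "q x = p (inverse (real (Suc n)) *\<^sub>R x)" for x
    have q: "q \<in> test_functions"
      using test_affine[OF p(1), of "inverse (real (Suc n))" 0] by (simp add: q_def[abs_def])
    have q1: "q x = 1" if "x \<in> F" for x
      using F(2) that by (auto simp: q_def field_simps intro!: p(2))
    have Tq: "T q = (LINT x|count_space L. of_real (norm (a x)) * q x)"
      using T(2) q radon_integral_point_mass[OF L total_variation_point_mass[OF \<mu>] q]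
      unfolding extends_measure_def by simp
    have int: "integrable (count_space L) (\<lambda>x. of_real (norm (a x)) * q x)"
      by (rule integrable_point_mass[OF total_variation_point_mass[OF \<mu>] q])
    have re: "Re (q x) \<ge> 0" for x using p(4) by (simp add: q_def)
    define g where "g x = Re (of_real (norm (a x)) * q x)" for x
    have g: "Infinite_Set_Sum.abs_summable_on g L"
      unfolding Infinite_Set_Sum.abs_summable_on_def g_def by (rule integrable_Re[OF int])
    then have "g summable_on L"
      by (rule abs_summable_summable[OF iffD2[OF abs_summable_equivalent]])
    then have "sum g F \<le> infsum g L"
      using F re by (intro finite_sum_le_infsum) (auto simp: g_def)
    moreover have "sum g F = (\<Sum>x\<in>F. norm (a x))"
      by (intro sum.cong refl) (simp add: g_def q1)
    ultimately have "(\<Sum>x\<in>F. norm (a x)) \<le> infsum g L" by simp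
    also have "\<dots> = (LINT x|count_space L. Re (of_real (norm (a x)) * q x))"
      using infsetsum_infsum[OF g] by (simp add: infsetsum_def g_def[abs_def])
    also have "\<dots> = Re (T q)" unfolding Tq by (rule integral_Re[OF int])
    also have "\<dots> \<le> norm (T q)" by (rule complex_Re_le_cmod)
    also have "\<dots> \<le> C * real (Suc n) ^ k" using C[of n] by (simp add: q_def[abs_def])
    finally show ?thesis .
  qed
  then show ?thesis by blast
qed

text \<open>Group the atoms by the floor n of their norm. The masses in one group contribute at most
  (n+1)^k, so decay of order k + 2 leaves inverse squares.\<close>

lemma integrable_point_mass_decays:
  fixes a f :: "'a::euclidean_space \<Rightarrow> complex"
  assumes L: "countable L" and \<mu>: "is_point_mass_sum \<mu> L a" and t: "temperate_measure (total_variation \<mu>)"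
    and f: "decays f"
  shows "integrable (count_space L) (\<lambda>x. a x * f x)"
proof -
  obtain C k where C: "\<And>n F. finite F \<Longrightarrow> F \<subseteq> L \<inter> cball 0 (real (Suc n)) \<Longrightarrow> (\<Sum>x\<in>F. norm (a x)) \<le> C * real (Suc n) ^ k"
    using temperate_measure_growth[OF L \<mu> t] by blast
  obtain D where D: "\<And>x. norm (f x) \<le> D * inverse ((1 + norm x) ^ (k + 2))" "D \<ge> 0"
    using decays_bound[OF f] by metis
  have C0: "C \<ge> 0" using C[of "{}" 0] by simp
  define Z where "Z = (\<Sum>n. inverse (real (Suc n) ^ 2))"
  have sz: "summable (\<lambda>n. inverse (real (Suc n) ^ 2))"
    using inverse_power_summable[of 2, where 'a=real] by (subst summable_Suc_iff) simp
  have "(\<Sum>x\<in>F. norm (a x * f x)) \<le> C * D * Z" if F: "finite F" "F \<subseteq> L" for F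
  proof -
    define s where "s x = nat \<lfloor>norm x\<rfloor>" for x :: 'a
    have s: "real (s x) \<le> norm x" "norm x \<le> real (Suc (s x))" for x
      using norm_ge_zero[of x] unfolding s_def by linarith+
    have "(\<Sum>x\<in>F. norm (a x * f x)) = (\<Sum>n\<in>s ` F. \<Sum>x\<in>{x\<in>F. s x = n}. norm (a x * f x))"
      using F by (intro sum.image_gen)
    also have "\<dots> \<le> (\<Sum>n\<in>s ` F. C * D * inverse (real (Suc n) ^ 2))"
    proof (rule sum_mono)
      fix n
      have "(\<Sum>x\<in>{x\<in>F. s x = n}. norm (a x * f x)) \<le>
          (\<Sum>x\<in>{x\<in>F. s x = n}. norm (a x) * (D * inverse (real (Suc n) ^ (k + 2))))"
      proof (rule sum_mono)
        fix x assume "x \<in> {x\<in>F. s x = n}"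
        then have "real n \<le> norm x" using s(1)[of x] by simp
        then have "inverse ((1 + norm x) ^ (k + 2)) \<le> inverse (real (Suc n) ^ (k + 2))"
          by (intro le_imp_inverse_le power_mono) auto
        then have "norm (f x) \<le> D * inverse (real (Suc n) ^ (k + 2))"
          using D(1)[of x] D(2) mult_left_mono order_trans by blast
        then show "norm (a x * f x) \<le> norm (a x) * (D * inverse (real (Suc n) ^ (k + 2)))"
          by (simp add: norm_mult mult_left_mono)
      qed
      also have "\<dots> = (\<Sum>x\<in>{x\<in>F. s x = n}. norm (a x)) * (D * inverse (real (Suc n) ^ (k + 2)))"
        by (simp add: sum_distrib_right)
      also have "\<dots> \<le> (C * real (Suc n) ^ k) * (D * inverse (real (Suc n) ^ (k + 2)))"
      proof (intro mult_right_mono C)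
        show "{x \<in> F. s x = n} \<subseteq> L \<inter> cball 0 (real (Suc n))" using F s(2) by auto
      qed (use F D in auto)
      also have "\<dots> = C * D * inverse (real (Suc n) ^ 2)"
        by (simp add: power_add field_simps power2_eq_square del: of_nat_Suc)
      finally show "(\<Sum>x\<in>{x\<in>F. s x = n}. norm (a x * f x)) \<le> C * D * inverse (real (Suc n) ^ 2)" .
    qed
    also have "\<dots> = C * D * (\<Sum>n\<in>s ` F. inverse (real (Suc n) ^ 2))"
      by (simp add: sum_distrib_left)
    also have "\<dots> \<le> C * D * Z"
      unfolding Z_def using F C0 D(2) by (intro mult_left_mono sum_le_suminf sz) auto
    finally show ?thesis .
  qed
  then have "(\<lambda>x. norm (a x * f x)) summable_on L"
    by (intro nonneg_bdd_above_summable_on bdd_aboveI2[of _ _ "C * D * Z"]) auto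
  then show ?thesis
    using abs_summable_equivalent unfolding Infinite_Set_Sum.abs_summable_on_def by blast
qed

lemma LIMSEQ_point_mass_cutoff:
  fixes a f :: "'a::euclidean_space \<Rightarrow> complex"
  assumes int: "integrable (count_space L) (\<lambda>x. a x * f x)"
    and p: "p \<in> test_functions" and one: "\<And>x. norm x \<le> 1 \<Longrightarrow> p x = 1"
  shows "(\<lambda>n. LINT x|count_space L. a x * (p (inverse (real (Suc n)) *\<^sub>R x) * f x)) \<longlonglongrightarrow>
    (LINT x|count_space L. a x * f x)"
proof -
  obtain C where C: "\<And>x. norm (p x) \<le> C" using schwartz_bounded[OF test_schwartz[OF p]] by metis
  show ?thesis
  proof (rule integral_dominated_convergence)
    show "integrable (count_space L) (\<lambda>x. C * norm (a x * f x))"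
      by (intro integrable_mult_right integrable_norm int)
    show "AE x in count_space L. norm (a x * (p (inverse (real (Suc n)) *\<^sub>R x) * f x)) \<le> C * norm (a x * f x)" for n
    proof (rule AE_I2)
      fix x
      have "norm (p (inverse (real (Suc n)) *\<^sub>R x)) * norm (a x * f x) \<le> C * norm (a x * f x)"
        by (intro mult_right_mono C) simp
      then show "norm (a x * (p (inverse (real (Suc n)) *\<^sub>R x) * f x)) \<le> C * norm (a x * f x)"
        by (simp add: norm_mult mult_ac)
    qed
    show "AE x in count_space L. (\<lambda>n. a x * (p (inverse (real (Suc n)) *\<^sub>R x) * f x)) \<longlonglongrightarrow> a x * f x"
    proof (rule AE_I2)
      fix x
      have "(\<lambda>n. p (inverse (real (Suc n)) *\<^sub>R x) + (-1)) \<longlonglongrightarrow> 0"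
        by (rule vanishingD(3)[OF vanishing_cutoff[OF p one]])
      then have "(\<lambda>n. p (inverse (real (Suc n)) *\<^sub>R x)) \<longlonglongrightarrow> 1"
        by (simp add: LIM_zero_iff)
      from tendsto_mult[OF tendsto_const[of "a x"] tendsto_mult[OF this tendsto_const[of "f x"]]]
      show "(\<lambda>n. a x * (p (inverse (real (Suc n)) *\<^sub>R x) * f x)) \<longlonglongrightarrow> a x * f x" by simp
    qed
  qed auto
qed

text \<open>By inversion f is itself a transform, of a Schwartz function h. Cut off h, use that
  \<rho> represents the transformed functional on test functions, and let the cutoff widen on both
  sides.\<close>

lemma fourier_pairing:
  fixes a b :: "'a::euclidean_space \<Rightarrow> complex"
  assumes L: "countable L" "is_point_mass_sum \<mu> L a" and K: "countable K" "is_point_mass_sum \<rho> K b"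
    and \<rho>: "has_fourier_measure \<mu> \<rho>" and t: "temperate_measure (total_variation \<rho>)"
    and c: "c \<noteq> 0" "\<And>f x. f \<in> schwartz \<Longrightarrow> fourier (fourier f) (x::'a) = c * f (- x)"
    and f: "f \<in> test_functions"
  shows "integrable (count_space K) (\<lambda>y. b y * fourier f (- y))"
    and "(LINT x|count_space L. a x * f x) = inverse c * (LINT y|count_space K. b y * fourier f (- y))"
proof -
  have fs: "f \<in> schwartz" by (rule test_schwartz[OF f])
  have hs: "(\<lambda>y. fourier f (- y)) \<in> schwartz"
    using schwartz_affine[OF schwartz_fourier[OF fs], of "-1" 0] by simp
  show int: "integrable (count_space K) (\<lambda>y. b y * fourier f (- y))"
    by (rule integrable_point_mass_decays[OF K t schwartz_decays[OF hs]])
  \<comment> \<open>The reflection undoes the sign in the inversion formula and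
    \<open>inverse c\<close> its constant, so that \<open>fourier h\<close> is f.\<close>
  define h where "h y = inverse c * fourier f (- y)" for y
  have h: "h \<in> schwartz" unfolding h_def by (rule schwartz_cmult[OF hs])
  have "fourier h x = f x" for x
  proof -
    have "fourier h x = inverse c * fourier (\<lambda>y. fourier f (- y)) x"
      unfolding h_def[abs_def] by (rule fourier_cmult)
    then show ?thesis
      using fourier_affine[OF schwartz_integrable[OF schwartz_fourier[OF fs]], of "-1" 0 x]
        c(2)[OF fs, of "- x"] c(1) by simp
  qed
  then have fh: "fourier h = f" by blast
  obtain T where T: "temperate T" "extends_measure T \<mu>" "extends_measure (fourier_distribution T) \<rho>"
    using \<rho> unfolding has_fourier_measure_def by blast
  obtain p :: "'a \<Rightarrow> complex" where p: "p \<in> test_functions" "\<And>x. norm x \<le> 1 \<Longrightarrow> p x = 1"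
    using exists_bump[of 1 2, where 'a='a] by auto
  have "T (fourier (\<lambda>x. p (inverse (real (Suc n)) *\<^sub>R x) * h x)) =
      (LINT y|count_space K. b y * (p (inverse (real (Suc n)) *\<^sub>R y) * h y))" for n
  proof -
    have "(\<lambda>x. p (inverse (real (Suc n)) *\<^sub>R x)) \<in> test_functions"
      using test_affine[OF p(1), of "inverse (real (Suc n))" 0] by simp
    then have "(\<lambda>x. p (inverse (real (Suc n)) *\<^sub>R x) * h x) \<in> test_functions"
      by (rule test_mult[OF _ schwartz_smooth[OF h]])
    then show ?thesis
      using T(3) radon_integral_point_mass[OF K] unfolding extends_measure_def fourier_distribution_def by simp
  qed
  moreover have "(\<lambda>n. T (fourier (\<lambda>x. p (inverse (real (Suc n)) *\<^sub>R x) * h x))) \<longlonglongrightarrow> T f"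
    using temperate_fourier_cutoff[OF T(1) p h] by (simp add: fh)
  moreover have "(\<lambda>n. LINT y|count_space K. b y * (p (inverse (real (Suc n)) *\<^sub>R y) * h y)) \<longlonglongrightarrow>
      (LINT y|count_space K. b y * h y)"
    by (intro LIMSEQ_point_mass_cutoff integrable_point_mass_decays[OF K t schwartz_decays[OF h]] p)
  ultimately have "T f = (LINT y|count_space K. b y * h y)"
    by (simp add: LIMSEQ_unique)
  also have "\<dots> = (LINT y|count_space K. inverse c * (b y * fourier f (- y)))"
    by (simp add: h_def mult_ac)
  also have "\<dots> = inverse c * (LINT y|count_space K. b y * fourier f (- y))" by simp
  finally show "(LINT x|count_space L. a x * f x) = inverse c * (LINT y|count_space K. b y * fourier f (- y))"
    using T(2) f radon_integral_point_mass[OF L f] unfolding extends_measure_def by simp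
qed

section \<open>Almost periodicity\<close>

text \<open>Waves have modulus 1, so Bolzano-Weierstrass applies to one frequency at a time; a
  diagonal sequence serves all of the countably many frequencies.\<close>

lemma waves_convergent_subsequence:
  fixes x :: "nat \<Rightarrow> 'a::euclidean_space"
  assumes K: "countable K"
  shows "\<exists>s. strict_mono s \<and> (\<forall>y\<in>K. convergent (\<lambda>k. wave (x (s k) \<bullet> y)))"
proof -
  define P where "P n s \<longleftrightarrow> convergent (\<lambda>k. wave (x (s k) \<bullet> from_nat_into K n))" for n and s :: "nat \<Rightarrow> nat"
  interpret subseqs P
  proof
    fix n and s :: "nat \<Rightarrow> nat"
    have "bounded (range (\<lambda>k. wave (x (s k) \<bullet> from_nat_into K n)))"
      by (auto simp: bounded_iff intro!: exI[of _ 1])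
    then obtain z r where "strict_mono r" "((\<lambda>k. wave (x (s k) \<bullet> from_nat_into K n)) \<circ> r) \<longlonglongrightarrow> z"
      using bounded_imp_convergent_subsequence by blast
    then show "\<exists>r'. strict_mono r' \<and> P n (s \<circ> r')"
      unfolding P_def by (intro exI[of _ r]) (auto simp: o_def intro: convergentI)
  qed
  \<comment> \<open>Only a tail of the diagonal sequence is a subsequence of the one chosen for the
    n-th frequency; the initial segment does not affect convergence and is restored below.\<close>
  have "P n (diagseq \<circ> (+) (Suc n))" for n
  proof (rule diagseq_holds)
    fix r s :: "nat \<Rightarrow> nat" and n assume "strict_mono r" "P n s"
    then show "P n (s \<circ> r)"
      using convergent_subseq_convergent[of "\<lambda>k. wave (x (s k) \<bullet> from_nat_into K n)" r]
      by (simp add: P_def o_def)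
  qed
  then have "convergent (\<lambda>k. wave (x (diagseq (k + Suc n)) \<bullet> from_nat_into K n))" for n
    by (simp only: P_def o_def add.commute)
  then have "convergent (\<lambda>k. wave (x (diagseq k) \<bullet> from_nat_into K n))" for n
    using convergent_ignore_initial_segment[of "\<lambda>k. wave (x (diagseq k) \<bullet> from_nat_into K n)" "Suc n"] by blast
  then have "\<forall>y\<in>K. convergent (\<lambda>k. wave (x (diagseq k) \<bullet> y))"
    using from_nat_into_surj[OF K] by metis
  then show ?thesis using subseq_diagseq by blast
qed

text \<open>The waves converge at each frequency without any uniformity. Weighting by the integrable
  c and dominated convergence make the total error small, and it is independent of t because a
  translation only inserts factors of modulus 1.\<close>

lemma almost_periodic_translates:
  fixes x :: "nat \<Rightarrow> 'a::euclidean_space"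
  assumes int: "integrable (count_space K) c"
    and conv: "\<And>y. y \<in> K \<Longrightarrow> convergent (\<lambda>k. wave (x k \<bullet> y))"
  obtains e where "e \<longlonglongrightarrow> 0" "\<And>k l t. norm ((LINT y|count_space K. c y * wave ((t + (x k - x l)) \<bullet> y)) -
      (LINT y|count_space K. c y * wave (t \<bullet> y))) \<le> e k + e l"
proof -
  \<comment> \<open>Comparing both waves with their limit splits the error into one term for k and
    one for l.\<close>
  define z where "z y = lim (\<lambda>k. wave (x k \<bullet> y))" for y
  have z: "(\<lambda>k. wave (x k \<bullet> y)) \<longlonglongrightarrow> z y" if "y \<in> K" for y
    using conv[OF that] by (simp add: z_def convergent_LIMSEQ_iff)
  have nz: "norm (z y) \<le> 1" if "y \<in> K" for y
    by (rule LIMSEQ_le_const2[OF tendsto_norm[OF z[OF that]]]) simp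
  define e where "e k = (LINT y|count_space K. norm (c y) * norm (wave (x k \<bullet> y) - z y))" for k
  have bd: "norm (wave (x k \<bullet> y) - z y) \<le> 2" if "y \<in> K" for k y
    using norm_triangle_ineq4[of "wave (x k \<bullet> y)" "z y"] nz[OF that] by simp
  have ie: "integrable (count_space K) (\<lambda>y. norm (c y) * norm (wave (x k \<bullet> y) - z y))" for k
  proof (rule Bochner_Integration.integrable_bound)
    show "integrable (count_space K) (\<lambda>y. 2 * norm (c y))"
      by (intro integrable_mult_right integrable_norm int)
    show "AE y in count_space K. norm (norm (c y) * norm (wave (x k \<bullet> y) - z y)) \<le> norm (2 * norm (c y))"
    proof (rule AE_I2)
      fix y assume "y \<in> space (count_space K)"
      then have "norm (c y) * norm (wave (x k \<bullet> y) - z y) \<le> norm (c y) * 2"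
        by (intro mult_left_mono bd) auto
      then show "norm (norm (c y) * norm (wave (x k \<bullet> y) - z y)) \<le> norm (2 * norm (c y))" by simp
    qed
  qed simp
  have iw: "integrable (count_space K) (\<lambda>y. c y * wave (t \<bullet> y))" for t
    by (rule Bochner_Integration.integrable_bound[OF int]) (auto simp: norm_mult)
  have "(\<lambda>k. e k) \<longlonglongrightarrow> integral\<^sup>L (count_space K) (\<lambda>y. 0::real)"
    unfolding e_def
  proof (rule integral_dominated_convergence)
    show "integrable (count_space K) (\<lambda>y. 2 * norm (c y))"
      by (intro integrable_mult_right integrable_norm int)
    show "AE y in count_space K. norm (norm (c y) * norm (wave (x k \<bullet> y) - z y)) \<le> 2 * norm (c y)" for k
    proof (rule AE_I2)
      fix y assume "y \<in> space (count_space K)"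
      then have "norm (c y) * norm (wave (x k \<bullet> y) - z y) \<le> norm (c y) * 2"
        by (intro mult_left_mono bd) auto
      then show "norm (norm (c y) * norm (wave (x k \<bullet> y) - z y)) \<le> 2 * norm (c y)" by simp
    qed
    show "AE y in count_space K. (\<lambda>k. norm (c y) * norm (wave (x k \<bullet> y) - z y)) \<longlonglongrightarrow> 0"
    proof (rule AE_I2)
      fix y assume "y \<in> space (count_space K)"
      then have "(\<lambda>k. wave (x k \<bullet> y) - z y) \<longlonglongrightarrow> 0" using z by (simp add: LIM_zero)
      then show "(\<lambda>k. norm (c y) * norm (wave (x k \<bullet> y) - z y)) \<longlonglongrightarrow> 0"
        by (intro tendsto_mult_right_zero tendsto_norm_zero)
    qed
  qed auto
  then have e0: "e \<longlonglongrightarrow> 0" by simp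
  have "norm ((LINT y|count_space K. c y * wave ((t + (x k - x l)) \<bullet> y)) -
      (LINT y|count_space K. c y * wave (t \<bullet> y))) \<le> e k + e l" for k l t
  proof -
    have "(LINT y|count_space K. c y * wave ((t + (x k - x l)) \<bullet> y)) - (LINT y|count_space K. c y * wave (t \<bullet> y))
       = (LINT y|count_space K. c y * wave ((t + (x k - x l)) \<bullet> y) - c y * wave (t \<bullet> y))"
      by (rule Bochner_Integration.integral_diff[OF iw iw, symmetric])
    also have "norm \<dots> \<le> (LINT y|count_space K. norm (c y) * norm (wave (x k \<bullet> y) - z y) +
        norm (c y) * norm (wave (x l \<bullet> y) - z y))"
    proof (rule order_trans[OF integral_norm_bound integral_mono])
      show "integrable (count_space K) (\<lambda>y. norm (c y * wave ((t + (x k - x l)) \<bullet> y) - c y * wave (t \<bullet> y)))"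
        by (intro integrable_norm Bochner_Integration.integrable_diff iw)
      show "integrable (count_space K) (\<lambda>y. norm (c y) * norm (wave (x k \<bullet> y) - z y) +
          norm (c y) * norm (wave (x l \<bullet> y) - z y))"
        by (intro Bochner_Integration.integrable_add ie)
      fix y
      \<comment> \<open>The common factor has modulus 1, and with it t leaves the estimate.\<close>
      have "c y * wave ((t + (x k - x l)) \<bullet> y) - c y * wave (t \<bullet> y) =
          c y * (wave ((t - x l) \<bullet> y) * (wave (x k \<bullet> y) - wave (x l \<bullet> y)))"
      proof -
        have "wave ((t + (x k - x l)) \<bullet> y) = wave ((t - x l) \<bullet> y) * wave (x k \<bullet> y)"
          "wave (t \<bullet> y) = wave ((t - x l) \<bullet> y) * wave (x l \<bullet> y)"
          unfolding wave_add[symmetric] by (simp_all add: inner_add_left inner_diff_left algebra_simps)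
        then show ?thesis by (simp only: right_diff_distrib)
      qed
      then have "norm (c y * wave ((t + (x k - x l)) \<bullet> y) - c y * wave (t \<bullet> y)) =
          norm (c y) * norm ((wave (x k \<bullet> y) - z y) - (wave (x l \<bullet> y) - z y))"
        by (simp add: norm_mult)
      also have "\<dots> \<le> norm (c y) * (norm (wave (x k \<bullet> y) - z y) + norm (wave (x l \<bullet> y) - z y))"
        by (intro mult_left_mono norm_triangle_ineq4) simp
      finally show "norm (c y * wave ((t + (x k - x l)) \<bullet> y) - c y * wave (t \<bullet> y)) \<le>
          norm (c y) * norm (wave (x k \<bullet> y) - z y) + norm (c y) * norm (wave (x l \<bullet> y) - z y)"
        by (simp add: distrib_left)
    qed
    also have "\<dots> = e k + e l"
      unfolding e_def by (rule Bochner_Integration.integral_add[OF ie ie])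
    finally show ?thesis .
  qed
  then show ?thesis using that e0 by blast
qed

lemma smoothed_measure_translates:
  fixes a b :: "'a::euclidean_space \<Rightarrow> complex" and x :: "nat \<Rightarrow> 'a"
  assumes L: "countable L" "is_point_mass_sum \<mu> L a" and K: "countable K" "is_point_mass_sum \<rho> K b"
    and \<rho>: "has_fourier_measure \<mu> \<rho>" and t: "temperate_measure (total_variation \<rho>)"
    and conv: "\<And>y. y \<in> K \<Longrightarrow> convergent (\<lambda>k. wave (x k \<bullet> - y))"
    and f: "f \<in> test_functions"
  shows "\<exists>e. e \<longlonglongrightarrow> 0 \<and> (\<forall>k l t. norm ((LINT y|count_space L. a y * f (y - (t + (x k - x l)))) -
      (LINT y|count_space L. a y * f (y - t))) \<le> e k + e l)"
proof -
  obtain c :: complex where c: "c \<noteq> 0"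
    "\<And>f x. f \<in> schwartz \<Longrightarrow> fourier (fourier f) (x::'a) = c * f (- x)"
    using fourier_inversion_const by blast
  define d where "d y = inverse c * (b y * fourier f (- y))" for y
  have F: "(LINT y|count_space L. a y * f (y - t)) = (LINT y|count_space K. d y * wave (t \<bullet> - y))" for t
  proof -
    have ft: "(\<lambda>y. f (y - t)) \<in> test_functions" using test_affine[OF f, of 1 "- t"] by simp
    have "fourier (\<lambda>y. f (y - t)) (- y) = wave (t \<bullet> - y) * fourier f (- y)" for y
      using fourier_affine[OF schwartz_integrable[OF test_schwartz[OF f]], of 1 "- t" "- y"] by simp
    then have "(LINT y|count_space L. a y * f (y - t)) =
        inverse c * (LINT y|count_space K. b y * (wave (t \<bullet> - y) * fourier f (- y)))"
      using fourier_pairing(2)[OF L K \<rho> t c ft] by simp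
    also have "\<dots> = (LINT y|count_space K. inverse c * (b y * (wave (t \<bullet> - y) * fourier f (- y))))"
      by (rule integral_mult_right_zero[symmetric])
    also have "\<dots> = (LINT y|count_space K. d y * wave (t \<bullet> - y))"
      by (simp add: d_def mult_ac)
    finally show ?thesis .
  qed
  have d: "integrable (count_space K) d"
    unfolding d_def by (rule integrable_mult_right[OF fourier_pairing(1)[OF L K \<rho> t c f]])
  \<comment> \<open>The smoothed measure at t carries the waves of -t at the frequencies y, so the
    general estimate is applied to the negated translations.\<close>
  have "(\<lambda>k. wave (- x k \<bullet> y)) = (\<lambda>k. wave (x k \<bullet> - y))" for y by simp
  then have "convergent (\<lambda>k. wave ((- x k) \<bullet> y))" if "y \<in> K" for y
    using conv[OF that] by metis
  from almost_periodic_translates[OF d this]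
  obtain e where e: "e \<longlonglongrightarrow> 0" "\<And>k l t. norm ((LINT y|count_space K. d y * wave ((t + (- x k - - x l)) \<bullet> y)) -
      (LINT y|count_space K. d y * wave (t \<bullet> y))) \<le> e k + e l"
    by blast
  have "norm ((LINT y|count_space L. a y * f (y - (t + (x k - x l)))) -
      (LINT y|count_space L. a y * f (y - t))) \<le> e k + e l" for k l t
  proof -
    have "(- t + (- x k - - x l)) \<bullet> y = (t + (x k - x l)) \<bullet> - y" for y
      by (simp add: inner_add_left inner_diff_left)
    then show ?thesis using e(2)[of "- t" k l] unfolding F by simp
  qed
  then show ?thesis using e(1) by blast
qed

section \<open>Locating a free shell\<close>

text \<open>Pigeonhole: the open shells are disjoint, so each of the at most 2 N distances lies in
  at most one of the 2 N + 1 shells.\<close>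

lemma exists_free_shell:
  fixes d d' :: "'b \<Rightarrow> real"
  assumes "finite A" "card A \<le> N" "finite B" "card B \<le> N" and w: "w > 0"
  shows "\<exists>j\<le>2 * N. (\<forall>n\<in>A. d n \<le> w * (2 * real j + 1) \<or> w * (2 * real j + 2) \<le> d n) \<and>
    (\<forall>n\<in>B. d' n \<le> w * (2 * real j + 1) \<or> w * (2 * real j + 2) \<le> d' n)"
proof (rule ccontr)
  assume c: "\<not> ?thesis"
  \<comment> \<open>Inside shell j the integer part of s / w is the odd number 2 j + 1; halving it
    recovers j.\<close>
  define i where "i s = nat \<lfloor>s / w\<rfloor> div 2" for s
  have i: "i s = j" if "w * (2 * real j + 1) < s" "s < w * (2 * real j + 2)" for s j
  proof -
    have "2 * real j + 1 < s / w" "s / w < 2 * real j + 2"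
      using that w by (simp_all add: field_simps)
    then have "\<lfloor>s / w\<rfloor> = int (2 * j + 1)" by (simp add: floor_eq_iff)
    then have "nat \<lfloor>s / w\<rfloor> = 2 * j + 1" by simp
    then show ?thesis by (simp add: i_def)
  qed
  have "{..2 * N} \<subseteq> (\<lambda>n. i (d n)) ` A \<union> (\<lambda>n. i (d' n)) ` B"
  proof
    fix j assume "j \<in> {..2 * N}"
    then have "\<not> ((\<forall>n\<in>A. d n \<le> w * (2 * real j + 1) \<or> w * (2 * real j + 2) \<le> d n) \<and>
      (\<forall>n\<in>B. d' n \<le> w * (2 * real j + 1) \<or> w * (2 * real j + 2) \<le> d' n))"
      using c by blast
    then have "(\<exists>n\<in>A. w * (2 * real j + 1) < d n \<and> d n < w * (2 * real j + 2)) \<or>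
      (\<exists>n\<in>B. w * (2 * real j + 1) < d' n \<and> d' n < w * (2 * real j + 2))"
      unfolding not_le[symmetric] by blast
    then show "j \<in> (\<lambda>n. i (d n)) ` A \<union> (\<lambda>n. i (d' n)) ` B"
      using i by blast
  qed
  then have "card {..2 * N} \<le> card ((\<lambda>n. i (d n)) ` A \<union> (\<lambda>n. i (d' n)) ` B)"
    using assms by (intro card_mono) auto
  also have "\<dots> \<le> card ((\<lambda>n. i (d n)) ` A) + card ((\<lambda>n. i (d' n)) ` B)"
    by (rule card_Un_le)
  also have "\<dots> \<le> N + N"
    using assms by (intro add_mono order_trans[OF card_image_le]) auto
  finally show False by simp
qed

lemma integral_count_space_finite:
  fixes f :: "'a \<Rightarrow> complex"
  assumes "finite S" "S \<subseteq> L" "\<And>x. x \<in> L - S \<Longrightarrow> f x = 0"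
  shows "(LINT x|count_space L. f x) = sum f S"
proof -
  have "{x \<in> L. f x \<noteq> 0} \<subseteq> S" using assms by blast
  moreover from this have "finite {x \<in> L. f x \<noteq> 0}" using assms(1) finite_subset by blast
  ultimately show ?thesis
    using assms by (subst lebesgue_integral_count_space_finite_support) (auto intro!: sum.mono_neutral_left)
qed

lemma integral_enumerated:
  fixes f :: "'a \<Rightarrow> complex"
  assumes "inj l" "range l = L" "finite A" "\<And>n. n \<notin> A \<Longrightarrow> f (l n) = 0"
  shows "(LINT x|count_space L. f x) = (\<Sum>n\<in>A. f (l n))"
proof -
  have "(LINT x|count_space L. f x) = sum f (l ` A)"
    using assms by (intro integral_count_space_finite) auto
  also have "\<dots> = (\<Sum>n\<in>A. f (l n))"
    using assms(1) by (subst sum.reindex) (auto intro: inj_on_subset)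
  finally show ?thesis .
qed

text \<open>No bound on the masses is available, so the displacement of the atoms is only harmless because
  the free shell makes \<open>f\<close> take the same value 0 or 1 at both atoms of each pair.\<close>

lemma smoothed_difference_small:
  fixes l g :: "nat \<Rightarrow> 'a::euclidean_space" and t :: 'a and a b :: "'a \<Rightarrow> complex"
  assumes l: "inj l" "range l = L" and g: "inj g" "range g = K"
    and N: "finite {n. l n \<in> ball t 1}" "card {n. l n \<in> ball t 1} \<le> N"
      "finite {n. g n \<in> ball t 1}" "card {n. g n \<in> ball t 1} \<le> N"
    and close: "\<And>n. l n \<in> ball t 1 \<or> g n \<in> ball t 1 \<Longrightarrow> norm (l n - g n) < w \<and> norm (a (l n) - b (g n)) \<le> \<delta>"
    and w: "w > 0" "w * (4 * real N + 4) \<le> 1" and \<delta>: "\<delta> \<ge> 0"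
    and f: "\<And>j x. norm x \<le> w * (2 * real j + 1) \<Longrightarrow> f j x = 1"
      "\<And>j x. w * (2 * real j + 2) \<le> norm x \<Longrightarrow> f j x = 0"
  shows "\<exists>j\<le>2 * N. norm ((LINT y|count_space L. a y * f j (y - t)) -
    (LINT y|count_space K. b y * f j (y - t))) \<le> 2 * real N * \<delta>"
proof -
  define A where "A = {n. l n \<in> ball t 1}"
  define B where "B = {n. g n \<in> ball t 1}"
  have AB: "finite A" "card A \<le> N" "finite B" "card B \<le> N" using N by (simp_all add: A_def B_def)
  obtain j where j: "j \<le> 2 * N"
    "\<And>n. n \<in> A \<Longrightarrow> norm (l n - t) \<le> w * (2 * real j + 1) \<or> w * (2 * real j + 2) \<le> norm (l n - t)"
    "\<And>n. n \<in> B \<Longrightarrow> norm (g n - t) \<le> w * (2 * real j + 1) \<or> w * (2 * real j + 2) \<le> norm (g n - t)"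
    using exists_free_shell[OF AB w(1), of "\<lambda>n. norm (l n - t)" "\<lambda>n. norm (g n - t)"] by auto
  \<comment> \<open>Even the outermost shell fits into the unit ball around t, the region in which
    atoms are counted.\<close>
  have jw: "w * (2 * real j + 2) \<le> 1"
  proof -
    have "w * (2 * real j + 2) \<le> w * (4 * real N + 4)"
      using j(1) w(1) by (intro mult_left_mono) auto
    then show ?thesis using w(2) by linarith
  qed
  have far: "f j (y - t) = 0" if "y \<notin> ball t 1" for y
    using that jw by (intro f(2)) (auto simp: dist_norm norm_minus_commute)
  \<comment> \<open>Atoms outside the unit ball are beyond the outer radius anyway. The dichotomy is
    needed for every n, since possibly only one atom of a pair lies in the ball.\<close>
  have la: "norm (l n - t) \<le> w * (2 * real j + 1) \<or> w * (2 * real j + 2) \<le> norm (l n - t)" for n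
    using j(2)[of n] jw by (cases "n \<in> A") (auto simp: A_def dist_norm norm_minus_commute)
  have gb: "norm (g n - t) \<le> w * (2 * real j + 1) \<or> w * (2 * real j + 2) \<le> norm (g n - t)" for n
    using j(3)[of n] jw by (cases "n \<in> B") (auto simp: B_def dist_norm norm_minus_commute)
  have summand: "norm (a (l n) * f j (l n - t) - b (g n) * f j (g n - t)) \<le> \<delta>" if n: "n \<in> A \<union> B" for n
  proof -
    have c: "norm (l n - g n) < w" "norm (a (l n) - b (g n)) \<le> \<delta>"
      using close[of n] n by (auto simp: A_def B_def)
    have d: "norm (l n - t) < norm (g n - t) + w" "norm (g n - t) < norm (l n - t) + w"
      using c(1) norm_triangle_ineq[of "l n - g n" "g n - t"] norm_triangle_ineq[of "g n - l n" "l n - t"]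
      by (auto simp: norm_minus_commute)
    have w2: "w * (2 * real j + 2) = w * (2 * real j + 1) + w" by (simp add: algebra_simps)
    \<comment> \<open>The shell has width w and the two distances differ by less than w, so the pair
      cannot lie on opposite sides of it.\<close>
    have "norm (l n - t) \<le> w * (2 * real j + 1) \<and> norm (g n - t) \<le> w * (2 * real j + 1) \<or>
        w * (2 * real j + 2) \<le> norm (l n - t) \<and> w * (2 * real j + 2) \<le> norm (g n - t)"
      using la[of n] gb[of n] d w2 by linarith
    then show ?thesis
      using c(2) \<delta> by (auto simp: f)
  qed
  \<comment> \<open>Both integrals are written over the same index set so that the summands can be
    compared pair by pair; the additional indices contribute 0.\<close>
  have "(LINT y|count_space L. a y * f j (y - t)) = (\<Sum>n\<in>A \<union> B. a (l n) * f j (l n - t))"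
    using AB far by (intro integral_enumerated[OF l]) (auto simp: A_def)
  moreover have "(LINT y|count_space K. b y * f j (y - t)) = (\<Sum>n\<in>A \<union> B. b (g n) * f j (g n - t))"
    using AB far by (intro integral_enumerated[OF g]) (auto simp: B_def)
  ultimately have "norm ((LINT y|count_space L. a y * f j (y - t)) - (LINT y|count_space K. b y * f j (y - t))) =
      norm (\<Sum>n\<in>A \<union> B. a (l n) * f j (l n - t) - b (g n) * f j (g n - t))"
    by (simp add: sum_subtractf)
  also have "\<dots> \<le> of_nat (card (A \<union> B)) * \<delta>"
    by (rule sum_norm_bound[OF summand])
  also have "\<dots> \<le> 2 * real N * \<delta>"
  proof (rule mult_right_mono[OF _ \<delta>])
    have "card (A \<union> B) \<le> 2 * N" using card_Un_le[of A B] AB by linarith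
    then show "of_nat (card (A \<union> B)) \<le> 2 * real N" by linarith
  qed
  finally show ?thesis using j(1) by blast
qed

section \<open>Uniqueness\<close>

lemma point_mass_outside_supp:
  assumes "x \<notin> supp \<mu>"
  shows "\<mu> {x} = 0" "\<exists>e>0. ball x e \<inter> supp \<mu> = {}"
proof -
  have "\<exists>e>0. \<forall>A\<in>bounded_borel. A \<subseteq> ball x e \<longrightarrow> \<mu> A = 0"
    using assms unfolding supp_def mem_Collect_eq by blast
  then obtain e where e: "e > 0" "\<forall>A\<in>bounded_borel. A \<subseteq> ball x e \<longrightarrow> \<mu> A = 0"
    by blast
  have "{x} \<subseteq> ball x e" using e(1) by simp
  then show "\<mu> {x} = 0" using e(2) finite_bounded_borel[of "{x}"] by blast
  have "y \<notin> supp \<mu>" if y: "y \<in> ball x e" for y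
  proof
    assume "y \<in> supp \<mu>"
    moreover have "e - dist x y > 0" using y by simp
    ultimately obtain A where A: "A \<in> bounded_borel" "A \<subseteq> ball y (e - dist x y)" "\<mu> A \<noteq> 0"
      unfolding supp_def mem_Collect_eq by blast
    have "ball y (e - dist x y) \<subseteq> ball x e"
    proof
      fix z assume "z \<in> ball y (e - dist x y)"
      then have "dist x y + dist y z < e" by simp
      then have "dist x z < e" using dist_triangle[of x z y] by linarith
      then show "z \<in> ball x e" by simp
    qed
    then show False using A e(2) by blast
  qed
  then show "\<exists>e>0. ball x e \<inter> supp \<mu> = {}" using e(1) by blast
qed

text \<open>Discreteness speaks of points of the support; at other points the support has an open
  complement. Both cases are needed, as p may be an atom of only one measure.\<close>

lemma supp_isolated:
  assumes "discrete_measure \<mu>"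
  shows "\<exists>e>0. ball x e \<inter> supp \<mu> \<subseteq> {x}"
proof (cases "x \<in> supp \<mu>")
  case True
  with assms obtain e where "e > 0" "ball x e \<inter> supp \<mu> = {x}"
    unfolding discrete_measure_def by metis
  then show ?thesis by (intro exI[of _ e]) simp
next
  case False
  from point_mass_outside_supp(2)[OF this] obtain e where "e > 0" "ball x e \<inter> supp \<mu> = {}"
    by metis
  then show ?thesis by (intro exI[of _ e]) simp
qed

lemma integral_isolated:
  assumes "ball x e \<inter> supp \<mu> \<subseteq> {x}" "f 0 = 1" "\<And>y. norm y \<ge> e \<Longrightarrow> f y = 0"
  shows "(LINT y|count_space (supp \<mu>). \<mu> {y} * f (y - x)) = \<mu> {x}"
proof -
  have "(LINT y|count_space (supp \<mu>). \<mu> {y} * f (y - x)) = (\<Sum>y\<in>{x} \<inter> supp \<mu>. \<mu> {y} * f (y - x))"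
  proof (rule integral_count_space_finite)
    fix y assume "y \<in> supp \<mu> - {x} \<inter> supp \<mu>"
    then have "y \<notin> ball x e" using assms(1) by auto
    then have "norm (y - x) \<ge> e" by (simp add: dist_norm norm_minus_commute)
    then show "\<mu> {y} * f (y - x) = 0" by (simp add: assms(3))
  qed auto
  also have "\<dots> = \<mu> {x}"
    using assms(2) point_mass_outside_supp(1)[of x \<mu>] by (cases "x \<in> supp \<mu>") auto
  finally show ?thesis .
qed

text \<open>Masses vanish off the supports, so both sums may be taken over all of A, where they
  agree term by term.\<close>

lemma point_mass_sums_eq:
  assumes \<mu>: "is_point_mass_sum \<mu> (supp \<mu>) (\<lambda>y. \<mu> {y})" and \<nu>: "is_point_mass_sum \<nu> (supp \<nu>) (\<lambda>y. \<nu> {y})"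
    and eq: "\<And>y. \<mu> {y} = \<nu> {y}" and A: "A \<in> bounded_borel"
  shows "\<mu> A = \<nu> A"
proof -
  have "((\<lambda>y. \<mu> {y}) has_sum \<mu> A) A"
    using \<mu> A point_mass_outside_supp(1)[of _ \<mu>] unfolding is_point_mass_sum_def
    by (subst has_sum_cong_neutral[of "supp \<mu> \<inter> A" A _ "\<lambda>y. \<mu> {y}"]) auto
  moreover have "((\<lambda>y. \<nu> {y}) has_sum \<nu> A) A"
    using \<nu> A point_mass_outside_supp(1)[of _ \<nu>] unfolding is_point_mass_sum_def
    by (subst has_sum_cong_neutral[of "supp \<nu> \<inter> A" A _ "\<lambda>y. \<nu> {y}"]) auto
  ultimately show ?thesis unfolding eq by (rule has_sum_unique)
qed

lemma masses_coincide:
  fixes \<mu> \<nu> \<mu>hat \<nu>hat :: "'a::euclidean_space set \<Rightarrow> complex"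
    and l g x :: "nat \<Rightarrow> 'a" and r :: "nat \<Rightarrow> real" and p :: 'a
  assumes disc: "discrete_measure \<mu>" "discrete_measure \<nu>"
    and \<mu>: "is_point_mass_sum \<mu> (supp \<mu>) (\<lambda>y. \<mu> {y})"
    and \<nu>: "is_point_mass_sum \<nu> (supp \<nu>) (\<lambda>y. \<nu> {y})"
    and hat: "has_fourier_measure \<mu> \<mu>hat" "has_fourier_measure \<nu> \<nu>hat"
    and atomic: "atomic_measure \<mu>hat" "atomic_measure \<nu>hat"
    and temp: "temperate_measure (total_variation \<mu>hat)" "temperate_measure (total_variation \<nu>hat)"
    and r: "filterlim r at_top sequentially" and x0: "\<forall>\<^sub>F k in sequentially. x k \<noteq> 0"
    and rx: "(\<lambda>k. r k / norm (x k)) \<longlonglongrightarrow> 0" and E: "(\<Union>k. ball (x k) (r k)) \<subseteq> E"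
    and l: "inj l" "range l = supp \<mu>" and g: "inj g" "range g = supp \<nu>"
    and N: "\<forall>y\<in>E. finite {n. l n \<in> ball y 1} \<and> card {n. l n \<in> ball y 1} \<le> N \<and>
                finite {n. g n \<in> ball y 1} \<and> card {n. g n \<in> ball y 1} \<le> N"
    and lg: "((\<lambda>n. l n - g n) \<longlongrightarrow> 0) (inf sequentially (principal {n. l n \<in> E \<or> g n \<in> E}))"
    and \<mu>\<nu>: "((\<lambda>n. \<mu> {l n} - \<nu> {g n}) \<longlongrightarrow> 0) (inf sequentially (principal {n. l n \<in> E \<or> g n \<in> E}))"
  shows "\<mu> {p} = \<nu> {p}"
proof (rule ccontr)
  assume neq: "\<mu> {p} \<noteq> \<nu> {p}"
  define d where "d = norm (\<mu> {p} - \<nu> {p})"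
  have d: "d > 0" using neq by (simp add: d_def)
  obtain e1 e2 where e12: "e1 > 0" "ball p e1 \<inter> supp \<mu> \<subseteq> {p}" "e2 > 0" "ball p e2 \<inter> supp \<nu> \<subseteq> {p}"
    using supp_isolated[OF disc(1)] supp_isolated[OF disc(2)] by metis
  define e where "e = min 1 (min e1 e2)"
  have e: "e > 0" "e \<le> 1" "ball p e \<inter> supp \<mu> \<subseteq> {p}" "ball p e \<inter> supp \<nu> \<subseteq> {p}"
    using e12 by (auto simp: e_def)
  \<comment> \<open>The largest outer radius, for j = 2 N, is w (4 N + 2), hence below e: all shells
    lie in the ball isolating p and, as e \<le> 1, in the unit ball.\<close>
  define w where "w = e / (4 * real N + 4)"
  have w: "w > 0" using e(1) by (simp add: w_def add_nonneg_pos)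
  have we: "w * (4 * real N + 4) = e" by (simp add: w_def add_nonneg_pos[THEN less_imp_neq, symmetric])
  have "\<exists>f\<in>test_functions. (\<forall>y::'a. norm y \<le> w * (2 * real j + 1) \<longrightarrow> f y = 1) \<and>
      (\<forall>y. w * (2 * real j + 2) \<le> norm y \<longrightarrow> f y = 0)" for j
    using exists_bump[of "w * (2 * real j + 1)" "w * (2 * real j + 2)", where 'a='a] w by auto
  then obtain f where f: "\<And>j. f j \<in> test_functions"
    "\<And>j y. norm (y::'a) \<le> w * (2 * real j + 1) \<Longrightarrow> f j y = (1::complex)"
    "\<And>j y. w * (2 * real j + 2) \<le> norm y \<Longrightarrow> f j y = 0"
    by metis
  define D where "D j t = (LINT y|count_space (supp \<mu>). \<mu> {y} * f j (y - t)) -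
    (LINT y|count_space (supp \<nu>). \<nu> {y} * f j (y - t))" for j t
  have Dp: "D j p = \<mu> {p} - \<nu> {p}" if j: "j \<le> 2 * N" for j
  proof -
    have "w * (2 * real j + 2) \<le> e"
      unfolding we[symmetric] using j w by (intro mult_left_mono) auto
    then have "f j y = 0" if "norm y \<ge> e" for y using that by (intro f(3)) linarith
    moreover have "f j 0 = 1" using w by (intro f(2)) auto
    ultimately show ?thesis
      unfolding D_def
      using integral_isolated[OF e(3), of "f j"] integral_isolated[OF e(4), of "f j"] by simp
  qed
  obtain K1 b1 K2 b2 where K: "countable K1" "is_point_mass_sum \<mu>hat K1 b1"
    "countable K2" "is_point_mass_sum \<nu>hat K2 b2"
    using atomic unfolding atomic_measure_def by metis
  \<comment> \<open>Frequencies enter with a negative sign. Both atom sets are treated together, so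
    one subsequence serves both measures.\<close>
  have "countable (uminus ` (K1 \<union> K2))" using K by simp
  from waves_convergent_subsequence[OF this, of x]
  obtain s where s: "strict_mono s" "\<And>y. y \<in> K1 \<union> K2 \<Longrightarrow> convergent (\<lambda>k. wave (x (s k) \<bullet> - y))"
    by auto
  have co: "countable (supp \<mu>)" "countable (supp \<nu>)"
    using l(2) g(2) by (metis countable_image countableI_type)+
  have "\<exists>\<epsilon>. \<epsilon> \<longlonglongrightarrow> 0 \<and> (\<forall>k m t. norm (D j (t + (x (s k) - x (s m))) - D j t) \<le> \<epsilon> k + \<epsilon> m)" for j
  proof -
    obtain \<epsilon>1 where 1: "\<epsilon>1 \<longlonglongrightarrow> 0" "\<forall>k m t. norm ((LINT y|count_space (supp \<mu>). \<mu> {y} * f j (y - (t + (x (s k) - x (s m))))) -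
      (LINT y|count_space (supp \<mu>). \<mu> {y} * f j (y - t))) \<le> \<epsilon>1 k + \<epsilon>1 m"
      using smoothed_measure_translates[OF co(1) \<mu> K(1,2) hat(1) temp(1) _ f(1), of "\<lambda>k. x (s k)" j] s(2)
      by auto
    obtain \<epsilon>2 where 2: "\<epsilon>2 \<longlonglongrightarrow> 0" "\<forall>k m t. norm ((LINT y|count_space (supp \<nu>). \<nu> {y} * f j (y - (t + (x (s k) - x (s m))))) -
      (LINT y|count_space (supp \<nu>). \<nu> {y} * f j (y - t))) \<le> \<epsilon>2 k + \<epsilon>2 m"
      using smoothed_measure_translates[OF co(2) \<nu> K(3,4) hat(2) temp(2) _ f(1), of "\<lambda>k. x (s k)" j] s(2)
      by auto
    have "norm (D j (t + (x (s k) - x (s m))) - D j t) \<le> (\<epsilon>1 k + \<epsilon>2 k) + (\<epsilon>1 m + \<epsilon>2 m)" for k m t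
    proof -
      have tri: "norm ((a - b) - (a' - b')) \<le> norm (a - a') + norm (b - b')" for a b a' b' :: complex
        using norm_triangle_ineq4[of "a - a'" "b - b'"] by (simp add: algebra_simps)
      show ?thesis
        unfolding D_def using order_trans[OF tri add_mono[OF 1(2)[rule_format] 2(2)[rule_format]]] by (simp add: algebra_simps)
    qed
    then show ?thesis
      using tendsto_add[OF 1(1) 2(1)] by (intro exI[of _ "\<lambda>k. \<epsilon>1 k + \<epsilon>2 k"]) simp
  qed
  then obtain \<epsilon> where \<epsilon>: "\<And>j. \<epsilon> j \<longlonglongrightarrow> 0"
    "\<And>j k m t. norm (D j (t + (x (s k) - x (s m))) - D j t) \<le> \<epsilon> j k + \<epsilon> j m"
    by metis
  \<comment> \<open>Finitely many j allow a common m. Two errors below d / 4 leave more than half of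
    the value at p.\<close>
  have "eventually (\<lambda>k. \<forall>j\<in>{..2 * N}. \<epsilon> j k < d / 4) sequentially"
    using d by (intro eventually_ball_finite ballI order_tendstoD(2)[OF \<epsilon>(1)]) auto
  then obtain m where m: "\<And>k j. k \<ge> m \<Longrightarrow> j \<le> 2 * N \<Longrightarrow> \<epsilon> j k < d / 4"
    unfolding eventually_sequentially by auto
  define t where "t k = p + (x (s k) - x (s m))" for k
  have Dt: "norm (D j (t k)) \<ge> d / 2" if "k \<ge> m" "j \<le> 2 * N" for j k
  proof -
    have "norm (D j (t k) - D j p) < d / 2"
      using \<epsilon>(2)[of j p k m] m[OF that] m[of m, OF _ that(2)] by (simp add: t_def)
    then show ?thesis
      using norm_triangle_ineq2[of "D j p" "D j (t k)"] Dp[OF that(2)]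
      by (simp add: d_def norm_minus_commute)
  qed
  \<comment> \<open>At most 2 N summands of size \<delta> must stay below d / 2; adding 1 keeps the
    denominator positive for N = 0.\<close>
  define \<delta> where "\<delta> = d / (4 * (2 * real N + 1))"
  have \<delta>: "\<delta> > 0" "2 * real N * \<delta> < d / 2"
    using d by (simp_all add: \<delta>_def field_simps add_pos_nonneg)
  have "eventually (\<lambda>n. l n \<in> E \<or> g n \<in> E \<longrightarrow> norm (l n - g n) < w) sequentially"
    using tendstoD[OF lg w] by (simp add: eventually_inf_principal)
  moreover have "eventually (\<lambda>n. l n \<in> E \<or> g n \<in> E \<longrightarrow> norm (\<mu> {l n} - \<nu> {g n}) < \<delta>) sequentially"
    using tendstoD[OF \<mu>\<nu> \<delta>(1)] by (simp add: eventually_inf_principal)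
  ultimately have "eventually (\<lambda>n. l n \<in> E \<or> g n \<in> E \<longrightarrow> norm (l n - g n) < w \<and> norm (\<mu> {l n} - \<nu> {g n}) < \<delta>) sequentially"
    by eventually_elim blast
  then obtain n0 where n0: "\<And>n. n \<ge> n0 \<Longrightarrow> l n \<in> E \<or> g n \<in> E \<Longrightarrow> norm (l n - g n) < w \<and> norm (\<mu> {l n} - \<nu> {g n}) < \<delta>"
    unfolding eventually_sequentially by auto
  \<comment> \<open>The pairs before n0 have no good estimates; all of their atoms lie within radius
    R.\<close>
  define R where "R = (\<Sum>n<n0. norm (l n) + norm (g n))"
  have R: "norm (l n) \<le> R" "norm (g n) \<le> R" if "n < n0" for n
  proof -
    have "norm (l n) + norm (g n) \<le> R"
      using member_le_sum[of n "{..<n0}" "\<lambda>n. norm (l n) + norm (g n)"] that by (simp add: R_def)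
    then show "norm (l n) \<le> R" "norm (g n) \<le> R"
      using norm_ge_zero[of "l n"] norm_ge_zero[of "g n"] by linarith+
  qed
  have ls: "filterlim s sequentially sequentially" by (rule filterlim_subseq[OF s(1)])
  have rs: "filterlim (\<lambda>k. r (s k)) at_top sequentially" by (rule filterlim_compose[OF r ls])
  \<comment> \<open>From a ratio below 1 the centres inherit the divergence of the radii. A
    vanishing centre would make the quotient 0 by convention, whence the appeal to
    \<open>x0\<close>.\<close>
  have "eventually (\<lambda>k. r k / norm (x k) < 1) sequentially"
    using order_tendstoD(2)[OF rx] by simp
  with x0 have "eventually (\<lambda>k. r k \<le> norm (x k)) sequentially"
    by eventually_elim (simp add: divide_less_eq)
  then have "filterlim (\<lambda>k. norm (x k)) at_top sequentially"
    by (rule filterlim_at_top_mono[OF r])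
  then have xs: "filterlim (\<lambda>k. norm (x (s k))) at_top sequentially" by (rule filterlim_compose[OF _ ls])
  \<comment> \<open>The offset from the centre does not depend on k, so a large radius keeps the
    unit ball around \<open>t k\<close> inside E.\<close>
  define v where "v = p - x (s m)"
  have tv: "t k = x (s k) + v" for k by (simp add: t_def v_def)
  have "eventually (\<lambda>k. norm v + 2 \<le> r (s k)) sequentially"
    "eventually (\<lambda>k. R + norm v + 2 \<le> norm (x (s k))) sequentially"
    using rs xs by (simp_all add: filterlim_at_top)
  then have "eventually (\<lambda>k. k \<ge> m \<and> norm v + 2 \<le> r (s k) \<and> R + norm v + 2 \<le> norm (x (s k))) sequentially"
    using eventually_ge_at_top[of m] by eventually_elim blast
  then obtain k where k: "k \<ge> m" "norm v + 2 \<le> r (s k)" "R + norm v + 2 \<le> norm (x (s k))"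
    using eventually_happens' sequentially_bot by blast
  have tE: "ball (t k) 1 \<subseteq> E"
  proof
    fix y assume "y \<in> ball (t k) 1"
    then have "norm (y - t k) < 1" by (simp add: dist_norm norm_minus_commute)
    then have "norm (y - x (s k)) < r (s k)"
      using norm_triangle_ineq[of "y - t k" v] k(2) by (simp add: tv)
    then have "y \<in> ball (x (s k)) (r (s k))" by (simp add: dist_norm norm_minus_commute)
    then show "y \<in> E" using E by blast
  qed
  have far: "norm y > R" if "y \<in> ball (t k) 1" for y
  proof -
    have "norm (y - t k) < 1" using that by (simp add: dist_norm norm_minus_commute)
    moreover have "norm (t k) \<le> norm y + norm (y - t k)"
      using norm_triangle_ineq4[of y "y - t k"] by simp
    moreover have "norm (x (s k)) \<le> norm (t k) + norm v"
      using norm_triangle_ineq4[of "t k" v] by (simp add: tv)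
    ultimately show ?thesis using k(3) by linarith
  qed
  have close: "norm (l n - g n) < w \<and> norm (\<mu> {l n} - \<nu> {g n}) \<le> \<delta>" if n: "l n \<in> ball (t k) 1 \<or> g n \<in> ball (t k) 1" for n
  proof -
    have "n \<ge> n0"
    proof (rule ccontr)
      assume "\<not> n \<ge> n0"
      then have "norm (l n) \<le> R" "norm (g n) \<le> R" using R[of n] by simp_all
      then show False using n far[of "l n"] far[of "g n"] by linarith
    qed
    moreover have "l n \<in> E \<or> g n \<in> E" using n tE by blast
    ultimately show ?thesis using n0[of n] by simp
  qed
  have "t k \<in> E" using tE by auto
  then have Nt: "finite {n. l n \<in> ball (t k) 1}" "card {n. l n \<in> ball (t k) 1} \<le> N"
    "finite {n. g n \<in> ball (t k) 1}" "card {n. g n \<in> ball (t k) 1} \<le> N"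
    using N by auto
  have "\<exists>j\<le>2 * N. norm (D j (t k)) \<le> 2 * real N * \<delta>"
    unfolding D_def
    by (rule smoothed_difference_small[where l=l and g=g and w=w, OF l g Nt close w _ _ f(2) f(3)])
      (use we e(2) \<delta>(1) in auto)
  then show False using Dt[OF k(1)] \<delta>(2) by fastforce
qed

theorem theorem2:
  fixes \<mu> \<nu> \<mu>hat \<nu>hat :: "'a::euclidean_space set \<Rightarrow> complex"
    and \<Lambda> \<Gamma> E :: "'a set"
    and l g x :: "nat \<Rightarrow> 'a"
    and r :: "nat \<Rightarrow> real"
    and N :: nat
  assumes "radon \<mu>" and "radon \<nu>"
    and "discrete_measure \<mu>" and "discrete_measure \<nu>"
    and "\<Lambda> = supp \<mu>" and "\<Gamma> = supp \<nu>"
    and "is_point_mass_sum \<mu> \<Lambda> (\<lambda>y. \<mu> {y})"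
    and "is_point_mass_sum \<nu> \<Gamma> (\<lambda>y. \<nu> {y})"
    and "temperate_measure \<mu>" and "temperate_measure \<nu>"
    and "has_fourier_measure \<mu> \<mu>hat" and "has_fourier_measure \<nu> \<nu>hat"
    and "atomic_measure \<mu>hat" and "atomic_measure \<nu>hat"
    and "temperate_measure (total_variation \<mu>hat)"
    and "temperate_measure (total_variation \<nu>hat)"
    and "filterlim r at_top sequentially"
    and "\<forall>\<^sub>F k in sequentially. x k \<noteq> 0"
    and "(\<lambda>k. r k / norm (x k)) \<longlonglongrightarrow> 0"
    and "(\<Union>k. ball (x k) (r k)) \<subseteq> E"
    and "inj l" and "range l = \<Lambda>"
    and "inj g" and "range g = \<Gamma>"
    and "\<forall>y\<in>E. finite {n. l n \<in> ball y 1} \<and> card {n. l n \<in> ball y 1} \<le> N \<and>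
                finite {n. g n \<in> ball y 1} \<and> card {n. g n \<in> ball y 1} \<le> N"
    and "((\<lambda>n. l n - g n) \<longlongrightarrow> 0)
           (inf sequentially (principal {n. l n \<in> E \<or> g n \<in> E}))"
    and "((\<lambda>n. \<mu> {l n} - \<nu> {g n}) \<longlongrightarrow> 0)
           (inf sequentially (principal {n. l n \<in> E \<or> g n \<in> E}))"
  shows "\<forall>A\<in>bounded_borel. \<mu> A = \<nu> A"
proof
  note \<mu> = assms(7)[unfolded assms(5)]
  note \<nu> = assms(8)[unfolded assms(6)]
  have eq: "\<mu> {y} = \<nu> {y}" for y
    by (rule masses_coincide[OF assms(3,4) \<mu> \<nu> assms(11-21) assms(22)[unfolded assms(5)]
      assms(23) assms(24)[unfolded assms(6)] assms(25-27)])
  fix A :: "'a set" assume "A \<in> bounded_borel"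
  then show "\<mu> A = \<nu> A" by (rule point_mass_sums_eq[OF \<mu> \<nu> eq])
qed

end
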